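(* Let $F$ be a field of characteristic zero, let $n\geq 1$, let $\lambda\in F$, and let $R$ be a Rota–Baxter operator of weight $\lambda$ on the matrix algebra $M_n(F)$ whose minimal polynomial (as a linear operator on $M_n(F)$) has degree $2n-1$. (a) If $\lambda=0$, then $R$ equals $B_0$ up to conjugation with automorphisms and transpose of $M_n(F)$ and up to multiplication by a nonzero scalar; that is, there exist a nonzero $c\in F$ and a map $\psi$ that is an automorphism or an antiautomorphism of the $F$-algebra $M_n(F)$ such that $R=c\,\psi^{-1}B_0\psi$. (b) If $\lambda\neq 0$, then $R$ equals $\lambda B_1$ up to conjugation with automorphisms and transpose of $M_n(F)$ and up to the action of the map $\phi\colon R\mapsto -R-\lambda\,\mathrm{id}$; that is, there exists a map $\psi$ that is an automorphism or an antiautomorphism of the $F$-algebra $M_n(F)$ such that either $R=\psi^{-1}(\lambda B_1)\psi$ or $-R-\lambda\,\mathrm{id}=\psi^{-1}(\lambda B_1)\psi$. Here $B_0,B_1\colon M_n(F)\to M_n(F)$ are the linear maps given on matrix units by $$B_0(e_{ij})=\begin{cases}\sum_{r\geq 0}e_{i+r,\,j+r+1}, & i\leq j,\\ -\sum_{r\geq 1}e_{i-r,\,j-r+1}, & i>j,\end{cases}\qquad B_1(e_{ij})=\begin{cases}\sum_{r\geq 1}e_{i+r,\,j+r}, & i\geq j,\\ -\sum_{r\geq 0}e_{i-r,\,j-r}, & i<j.\end{cases}$$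
   Context: A linear map $R\colon A\to A$ on an $F$-algebra $A$ is a Rota–Baxter operator of weight $\lambda\in F$ if $R(x)R(y)=R(R(x)y+xR(y)+\lambda xy)$ for all $x,y\in A$. The $e_{ij}$, $1\leq i,j\leq n$, are the matrix units of $M_n(F)$; in the sums defining $B_0$ and $B_1$, only terms whose two indices both lie in $\{1,\ldots,n\}$ occur (i.e. $e_{pq}:=0$ if $p$ or $q$ is outside $\{1,\dots,n\}$). An antiautomorphism of $A$ is a bijective linear map $\psi\colon A\to A$ with $\psi(xy)=\psi(y)\psi(x)$ for all $x,y\in A$; every antiautomorphism of $M_n(F)$ is a composition of an automorphism with the transpose. If $R$ is a Rota–Baxter operator of weight $\lambda$, then so are $-R-\lambda\,\mathrm{id}$ and $\psi^{-1}R\psi$ for every automorphism or antiautomorphism $\psi$. *)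

theory Defs
  imports
    "Jordan_Normal_Form.VS_Connect"
    "HOL-Algebra.QuotRing"
    "HOL-Computational_Algebra.Polynomial"
begin

text \<open>The algebra \<open>M\<^sub>n(F)\<close> has carrier \<^term>\<open>carrier_mat n n\<close>; maps on it are HOL functions of which
  only the values on this carrier matter.\<close>

abbreviation matrix_space :: "nat \<Rightarrow> ('a::field, 'a mat) module" where
  "matrix_space n \<equiv> module_mat TYPE('a) n n"

abbreviation matrix_ring :: "nat \<Rightarrow> 'a::field mat ring" where
  "matrix_ring n \<equiv> ring_mat TYPE('a) n ()"

definition linear_operator :: "nat \<Rightarrow> ('a::field mat \<Rightarrow> 'a mat) \<Rightarrow> bool" where
  "linear_operator n f \<longleftrightarrow> linear_map class_ring (matrix_space n) (matrix_space n) f"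

definition rota_baxter_operator :: "nat \<Rightarrow> 'a::field \<Rightarrow> ('a mat \<Rightarrow> 'a mat) \<Rightarrow> bool" where
  "rota_baxter_operator n l R \<longleftrightarrow> linear_operator n R \<and>
    (\<forall>x\<in>carrier_mat n n. \<forall>y\<in>carrier_mat n n.
      R x * R y = R (R x * y + x * R y + l \<cdot>\<^sub>m (x * y)))"

definition algebra_automorphism :: "nat \<Rightarrow> ('a::field mat \<Rightarrow> 'a mat) \<Rightarrow> bool" where
  "algebra_automorphism n \<psi> \<longleftrightarrow>
    linear_operator n \<psi> \<and> \<psi> \<in> ring_iso (matrix_ring n) (matrix_ring n)"

definition algebra_antiautomorphism :: "nat \<Rightarrow> ('a::field mat \<Rightarrow> 'a mat) \<Rightarrow> bool" where
  "algebra_antiautomorphism n \<psi> \<longleftrightarrow>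
    linear_operator n \<psi> \<and> bij_betw \<psi> (carrier_mat n n) (carrier_mat n n) \<and>
    (\<forall>x\<in>carrier_mat n n. \<forall>y\<in>carrier_mat n n. \<psi> (x * y) = \<psi> y * \<psi> x)"

definition conjugate_operator ::
  "nat \<Rightarrow> ('a::field mat \<Rightarrow> 'a mat) \<Rightarrow> ('a mat \<Rightarrow> 'a mat) \<Rightarrow> 'a mat \<Rightarrow> 'a mat" where
  "conjugate_operator n \<psi> B X = inv_into (carrier_mat n n) \<psi> (B (\<psi> X))"

definition eval_at_operator ::
  "nat \<Rightarrow> 'a::field poly \<Rightarrow> ('a mat \<Rightarrow> 'a mat) \<Rightarrow> 'a mat \<Rightarrow> 'a mat" where
  "eval_at_operator n p R X =
    (\<Oplus>\<^bsub>matrix_space n\<^esub> k\<in>{..degree p}. coeff p k \<cdot>\<^sub>m (R ^^ k) X)"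

definition annihilates :: "nat \<Rightarrow> 'a::field poly \<Rightarrow> ('a mat \<Rightarrow> 'a mat) \<Rightarrow> bool" where
  "annihilates n p R \<longleftrightarrow> (\<forall>X\<in>carrier_mat n n. eval_at_operator n p R X = 0\<^sub>m n n)"

definition is_minimal_polynomial :: "nat \<Rightarrow> ('a::field mat \<Rightarrow> 'a mat) \<Rightarrow> 'a poly \<Rightarrow> bool" where
  "is_minimal_polynomial n R p \<longleftrightarrow> lead_coeff p = 1 \<and> annihilates n p R \<and>
    (\<forall>q. q \<noteq> 0 \<longrightarrow> annihilates n q R \<longrightarrow> degree p \<le> degree q)"

text \<open>Matrix units are indexed from 1, whereas the entries of a \<^typ>\<open>'a mat\<close> are indexed from 0. The
  indices are integers, so that \<^term>\<open>matrix_unit n p q\<close> is the zero matrix whenever \<open>p\<close> or \<open>q\<close> lies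
  outside \<open>{1..n}\<close>; with natural numbers, truncated subtraction would spoil this for \<open>i - r\<close>.\<close>

definition matrix_unit :: "nat \<Rightarrow> int \<Rightarrow> int \<Rightarrow> 'a::field mat" where
  "matrix_unit n p q = mat n n (\<lambda>(a, b). if int a + 1 = p \<and> int b + 1 = q then 1 else 0)"

definition linear_extension ::
  "nat \<Rightarrow> (int \<Rightarrow> int \<Rightarrow> 'a::field mat) \<Rightarrow> 'a mat \<Rightarrow> 'a mat" where
  "linear_extension n f X =
    (\<Oplus>\<^bsub>matrix_space n\<^esub> i\<in>{1..int n}. \<Oplus>\<^bsub>matrix_space n\<^esub> j\<in>{1..int n}.
      X $$ (nat (i - 1), nat (j - 1)) \<cdot>\<^sub>m f i j)"

text \<open>The sums over \<open>r\<close> may be cut off at \<open>n\<close>: for \<open>r \<ge> n\<close> and \<open>i\<close> in \<open>{1..n}\<close> both \<open>i + r\<close> and \<open>i - r\<close>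
  lie outside \<open>{1..n}\<close>.\<close>

definition B0_on_unit :: "nat \<Rightarrow> int \<Rightarrow> int \<Rightarrow> 'a::field mat" where
  "B0_on_unit n i j =
    (if i \<le> j then \<Oplus>\<^bsub>matrix_space n\<^esub> r\<in>{0..int n}. matrix_unit n (i + r) (j + r + 1)
     else - (\<Oplus>\<^bsub>matrix_space n\<^esub> r\<in>{1..int n}. matrix_unit n (i - r) (j - r + 1)))"

definition B1_on_unit :: "nat \<Rightarrow> int \<Rightarrow> int \<Rightarrow> 'a::field mat" where
  "B1_on_unit n i j =
    (if i \<ge> j then \<Oplus>\<^bsub>matrix_space n\<^esub> r\<in>{1..int n}. matrix_unit n (i + r) (j + r)
     else - (\<Oplus>\<^bsub>matrix_space n\<^esub> r\<in>{0..int n}. matrix_unit n (i - r) (j - r)))"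

definition B0 :: "nat \<Rightarrow> 'a::field mat \<Rightarrow> 'a mat" where
  "B0 n = linear_extension n (B0_on_unit n)"

definition B1 :: "nat \<Rightarrow> 'a::field mat \<Rightarrow> 'a mat" where
  "B1 n = linear_extension n (B1_on_unit n)"

end

theory Submission
  imports Defs
begin

text \<open>Let \<open>a = R(1)\<close> and let \<open>L\<close> be left multiplication by \<open>a\<close>. The Rota-Baxter identity gives
  \<open>[L, R] = R (R + \<lambda>)\<close>, hence \<open>[L, q(R)] = (q' \<cdot> x (x + \<lambda>))(R)\<close> for every polynomial \<open>q\<close>; so the minimal
  polynomial of \<open>R\<close> is \<open>x\<^sup>k (x + \<lambda>)\<^sup>m\<close> with \<open>k + m = 2n - 1\<close>.

  If \<open>\<lambda> \<noteq> 0\<close>, one may assume \<open>k \<ge> n\<close> after passing to \<open>- R - \<lambda>\<close>. A chain of \<open>k\<close> eigenvectors of \<open>L\<close> shows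
  \<open>k = n\<close> and makes \<open>a\<close> conjugate to the diagonal matrix with entries \<open>c + i \<lambda>\<close>, so \<open>R\<close> respects the
  diagonals. Counting the orders of vanishing on the main diagonal forces \<open>c = 0\<close>, and \<open>R\<close> is then
  known on that diagonal. The top power of \<open>R + \<lambda>\<close> lives on the first superdiagonal (up to transposition),
  where a diagonal conjugation normalises \<open>R\<close>; the Rota-Baxter identity propagates this to the upper and then
  to the lower triangle.

  If \<open>\<lambda> = 0\<close>, then \<open>a\<close> is a nilpotent Jordan block up to conjugation, and \<open>R\<close> raises the filtration of
  \<open>M\<^sub>n(F)\<close> by diagonals, since it commutes with \<open>[a, \<cdot>]\<close>. Following the powers \<open>R\<^sup>m(e\<^sub>n\<^sub>1)\<close> shows that, up to
  reflection in the antidiagonal, the image of \<open>R\<close> consists of the matrices with zero last row, and that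
  its kernel lies in the last column. Hence \<open>[w, R(Y)] = Y\<close> up to the last column for some
  matrix \<open>w\<close>; conjugating \<open>w\<close> to a shift leaves \<open>B\<^sub>0\<close> as the only solution.\<close>

section \<open>Operators with a commutation relation\<close>

text \<open>The relation \<open>[L, R] = R (R + \<lambda>)\<close> is the Rota-Baxter identity with
  one factor equal to 1. It holds for right multiplication too, and the difference of the two says
  that \<open>R\<close> commutes with the commutator by \<open>a\<close>. For \<lambda> \<noteq> 0
  this suffices to preserve the diagonals, which are the eigenspaces of that commutator. For
  \<lambda> = 0 the commutator \<open>d\<close> is nilpotent, and commuting with it does not by
  itself force \<open>R\<close> to raise the filtration (the identity commutes as well). Two facts
  supply the rest: on powers of \<open>a\<close>, \<open>R\<close> acts as integration, and
  \<open>d^(2m)\<close> maps the \<open>m\<close>-th subdiagonal bijectively to the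
  \<open>m\<close>-th superdiagonal. The latter is the hard Lefschetz property; since
  \<open>d\<close> multiplies generating polynomials of diagonals by \<open>1 - x\<close>, it
  reduces to the fact that a nonzero polynomial with at most \<open>N\<close> terms has no zero of
  order \<open>N\<close> at 1. The degree \<open>2n - 1\<close> is extremal. One exponent is at
  least \<open>n\<close>, while \<open>a\<close> has at most \<open>n\<close> eigenvalues; in weight
  zero \<open>2n - 1\<close> is the number of diagonals, so \<open>R\<close> moves the bottom left
  corner up by exactly one diagonal at each step.\<close>

text \<open>For a Rota-Baxter operator \<open>R\<close> the relation \<open>L_R\<close> below holds for left as well as for right
  multiplication by \<open>R(1)\<close>.\<close>

locale commutator_pair = vector_space scale
  for scale :: "'a::field_char_0 \<Rightarrow> 'v::ab_group_add \<Rightarrow> 'v" (infixr "*s" 75) +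
  fixes l :: 'a and R L :: "'v \<Rightarrow> 'v"
  assumes R_add: "R (x + y) = R x + R y" and R_scale: "R (c *s x) = c *s R x"
    and L_add: "L (x + y) = L x + L y" and L_scale: "L (c *s x) = c *s L x"
    and L_R: "L (R x) = R (L x) + R (R x) + l *s R x"
begin

text \<open>\<open>R\<close> and \<open>S\<close> are the factors belonging to the roots 0 and
  \<open>- l\<close>; up to sign, passing to \<open>-R - l id\<close> exchanges them. Hence
  everything is phrased in the products \<open>RS k m\<close>, that is
  \<open>R^k S^m\<close>.\<close>

definition S :: "'v \<Rightarrow> 'v" where "S x = R x + l *s x"

definition RS :: "nat \<Rightarrow> nat \<Rightarrow> 'v \<Rightarrow> 'v" where "RS k m x = (R ^^ k) ((S ^^ m) x)"

definition ev :: "'a poly \<Rightarrow> 'v \<Rightarrow> 'v" where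
  "ev q x = (\<Sum>i\<le>degree q. coeff q i *s (R ^^ i) x)"

lemma R_zero [simp]: "R 0 = 0"
  using R_add[of 0 0] by simp

lemma R_minus: "R (- x) = - R x"
  using R_add[of x "- x"] by (simp add: eq_neg_iff_add_eq_0 add.commute)

lemma R_diff: "R (x - y) = R x - R y"
  using R_add[of x "- y"] by (simp add: R_minus)

lemma R_sum: "R (sum f A) = (\<Sum>i\<in>A. R (f i))"
  by (induction A rule: infinite_finite_induct) (simp_all add: R_add)

lemma L_zero [simp]: "L 0 = 0"
  using L_add[of 0 0] by simp

lemma L_sum: "L (sum f A) = (\<Sum>i\<in>A. L (f i))"
  by (induction A rule: infinite_finite_induct) (simp_all add: L_add)

lemma S_add: "S (x + y) = S x + S y" and S_scale: "S (c *s x) = c *s S x"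
  by (simp_all add: S_def R_add R_scale algebra_simps scale_left_commute)

lemma S_zero [simp]: "S 0 = 0"
  by (simp add: S_def)

lemma Rpow_add: "(R ^^ k) (x + y) = (R ^^ k) x + (R ^^ k) y"
  and Rpow_scale: "(R ^^ k) (c *s x) = c *s (R ^^ k) x"
  by (induction k) (simp_all add: R_add R_scale)

lemma Rpow_zero [simp]: "(R ^^ k) 0 = 0"
  by (induction k) simp_all

lemma Rpow_diff: "(R ^^ k) (x - y) = (R ^^ k) x - (R ^^ k) y"
  by (induction k) (simp_all add: R_diff)

lemma Rpow_sum: "(R ^^ k) (sum f A) = (\<Sum>i\<in>A. (R ^^ k) (f i))"
  by (induction k) (simp_all add: R_sum)

lemma Spow_add: "(S ^^ k) (x + y) = (S ^^ k) x + (S ^^ k) y"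
  and Spow_scale: "(S ^^ k) (c *s x) = c *s (S ^^ k) x"
  by (induction k) (simp_all add: S_add S_scale)

lemma S_R: "S (R x) = R (S x)"
  by (simp add: S_def R_add R_scale)

lemma S_Rpow: "S ((R ^^ k) x) = (R ^^ k) (S x)"
  by (induction k) (simp_all add: S_R)

lemma RS_add: "RS k m (x + y) = RS k m x + RS k m y"
  and RS_scale: "RS k m (c *s x) = c *s RS k m x"
  by (simp_all add: RS_def Spow_add Spow_scale Rpow_add Rpow_scale)

lemma RS_zero [simp]: "RS k m 0 = 0"
  using RS_scale[of k m 0 0] by simp

lemma RS_diff: "RS k m (x - y) = RS k m x - RS k m y"
  using RS_add[of k m "x - y" y] by (simp add: algebra_simps)

lemma RS_sum: "RS k m (sum f A) = (\<Sum>i\<in>A. RS k m (f i))"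
  by (induction A rule: infinite_finite_induct) (simp_all add: RS_add)

lemma R_RS: "R (RS k m x) = RS (Suc k) m x"
  by (simp add: RS_def)

lemma S_RS: "S (RS k m x) = RS k (Suc m) x"
  by (simp add: RS_def S_Rpow)

lemma RS_R: "RS k m (R x) = RS (Suc k) m x"
proof -
  have "(S ^^ m) (R x) = R ((S ^^ m) x)"
    by (induction m) (simp_all add: S_R)
  then show ?thesis by (simp add: RS_def funpow_swap1)
qed

lemma RS_RS: "RS k m (RS k' m' x) = RS (k + k') (m + m') x"
proof (induction k')
  case 0
  show ?case by (simp add: RS_def funpow_add)
next
  case (Suc k')
  then show ?case
    by (metis R_RS RS_R add_Suc_right)
qed

lemma RS_0_0 [simp]: "RS 0 0 x = x"
  by (simp add: RS_def)

lemma RS_Suc_right: "RS k (Suc m) x = RS (Suc k) m x + l *s RS k m x"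
  using S_RS[of k m x] by (simp add: S_def R_RS)

text \<open>The commutator with \<open>L\<close> acts on polynomials in \<open>R\<close> as the
  derivation \<open>x (x + l) d/dx\<close>, here applied to \<open>x^k (x + l)^m\<close>.\<close>

lemma L_RS: "L (RS k m x) =
    RS k m (L x) + of_nat k *s RS k (Suc m) x + of_nat m *s RS (Suc k) m x"
proof (induction k)
  case 0
  show ?case
  proof (induction m)
    case 0
    then show ?case by simp
  next
    case (Suc m)
    have "L (RS 0 (Suc m) x) = L (S (RS 0 m x))" by (simp add: S_RS)
    also have "\<dots> = S (L (RS 0 m x)) + R (S (RS 0 m x))"
      by (simp add: S_def L_add L_R L_scale R_add R_scale algebra_simps)
    also have "\<dots> = RS 0 (Suc m) (L x) + of_nat m *s RS 1 (Suc m) x + RS 1 (Suc m) x"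
      by (simp add: Suc S_add S_scale S_RS R_RS)
    finally show ?case by (simp add: algebra_simps)
  qed
next
  case (Suc k)
  have "L (RS (Suc k) m x) = L (R (RS k m x))" by (simp add: R_RS)
  also have "\<dots> = R (L (RS k m x)) + R (S (RS k m x))"
    by (simp add: S_def L_R R_add R_scale algebra_simps)
  also have "\<dots> = RS (Suc k) m (L x) + of_nat k *s RS (Suc k) (Suc m) x
      + of_nat m *s RS (Suc (Suc k)) m x + RS (Suc k) (Suc m) x"
    by (simp add: Suc R_add R_scale S_RS R_RS)
  finally show ?case by (simp add: algebra_simps)
qed

text \<open>Substituting \<open>S = R + l\<close> merges the two correction terms into one. When
  \<open>RS (Suc k) m w\<close> or \<open>RS k (Suc m) w\<close> vanishes, \<open>RS k m w\<close>
  is an eigenvector of \<open>L\<close> with a known eigenvalue; this is how extremal products are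
  located in particular rows.\<close>

lemma L_RS_eigen:
  assumes "L w = c *s w"
  shows "L (RS k m w) = (c + of_nat k * l) *s RS k m w + of_nat (k + m) *s RS (Suc k) m w"
    and "L (RS k m w) = (c - of_nat m * l) *s RS k m w + of_nat (k + m) *s RS k (Suc m) w"
proof -
  show 1: "L (RS k m w) = (c + of_nat k * l) *s RS k m w + of_nat (k + m) *s RS (Suc k) m w"
    by (simp add: L_RS assms RS_scale RS_Suc_right algebra_simps)
  show "L (RS k m w) = (c - of_nat m * l) *s RS k m w + of_nat (k + m) *s RS k (Suc m) w"
    by (simp add: 1 RS_Suc_right algebra_simps)
qed

lemma ev_atMost:
  assumes "degree q \<le> N"
  shows "ev q x = (\<Sum>i\<le>N. coeff q i *s (R ^^ i) x)"
  unfolding ev_def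
  by (rule sum.mono_neutral_left) (use assms in \<open>auto simp: coeff_eq_0\<close>)

lemma ev_0 [simp]: "ev 0 x = 0"
  by (simp add: ev_def)

lemma ev_add: "ev (p + q) x = ev p x + ev q x"
proof -
  define N where "N = max (degree p) (degree q)"
  have "degree (p + q) \<le> N" "degree p \<le> N" "degree q \<le> N"
    by (auto simp: N_def degree_add_le_max)
  then show ?thesis
    by (simp add: ev_atMost[of _ N] sum.distrib scale_left_distrib)
qed

lemma ev_smult: "ev (Polynomial.smult c q) x = c *s ev q x"
proof -
  have "degree (Polynomial.smult c q) \<le> degree q" by (rule degree_smult_le)
  then show ?thesis
    by (simp add: ev_atMost[of _ "degree q"] scale_sum_right)
qed

lemma ev_pCons: "ev (pCons c q) x = c *s x + R (ev q x)"
proof -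
  have "degree (pCons c q) \<le> Suc (degree q)" by (simp add: degree_pCons_le)
  then have "ev (pCons c q) x = (\<Sum>i\<le>Suc (degree q). coeff (pCons c q) i *s (R ^^ i) x)"
    by (rule ev_atMost)
  also have "\<dots> = c *s x + (\<Sum>i\<le>degree q. coeff q i *s R ((R ^^ i) x))"
    by (subst sum.atMost_Suc_shift) simp
  also have "(\<Sum>i\<le>degree q. coeff q i *s R ((R ^^ i) x)) = R (ev q x)"
    by (simp add: ev_def R_sum R_scale)
  finally show ?thesis .
qed

lemma ev_mult: "ev (p * q) x = ev p (ev q x)"
  by (induction p)
    (simp_all add: ev_pCons ev_add ev_smult R_add R_scale mult_pCons_left)

text \<open>In other words \<open>[L, q(R)] = (q' \<cdot> x (x + l))(R)\<close>, so the minimal polynomial \<open>p\<close> of \<open>R\<close> divides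
  \<open>p' \<cdot> x (x + l)\<close>.\<close>

lemma ev_L: "L (ev q x) = ev q (L x) + ev (pderiv q * [:0, l, 1:]) x"
proof (induction q)
  case 0
  then show ?case by simp
next
  case (pCons c q)
  have R_f: "ev [:0, l, 1:] y = R (R y) + l *s R y" for y
    by (simp add: ev_pCons R_add R_scale algebra_simps)
  have "L (ev (pCons c q) x) = c *s L x + R (L (ev q x)) + R (R (ev q x)) + l *s R (ev q x)"
    by (simp add: ev_pCons L_add L_scale L_R algebra_simps)
  also have "\<dots> = ev (pCons c q) (L x) + R (ev (pderiv q * [:0, l, 1:]) x)
      + ev ([:0, l, 1:] * q) x"
    by (simp add: pCons.IH R_f[symmetric] ev_mult ev_pCons[of c] R_add add.assoc del: mult_pCons_left mult_pCons_right)
  also have "\<dots> = ev (pCons c q) (L x) + ev (pderiv (pCons c q) * [:0, l, 1:]) x"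
    by (simp add: pderiv_pCons distrib_right ev_add ev_pCons mult.commute[of q] add.assoc add.commute del: mult_pCons_left mult_pCons_right)
      (simp add: ev_pCons ev_add ev_smult R_add R_scale add.commute)
  finally show ?case .
qed

lemma ev_power_linear: "ev ([:0, 1:] ^ k * [:l, 1:] ^ m) x = RS k m x"
proof -
  have 1: "ev ([:0, 1:] ^ k) y = (R ^^ k) y" for y
    by (induction k) (simp_all add: ev_mult ev_pCons one_pCons del: mult_pCons_left)
  have 2: "ev ([:l, 1:] ^ m) y = (S ^^ m) y" for y
    by (induction m) (simp_all add: ev_mult ev_pCons one_pCons S_def del: mult_pCons_left)
  show ?thesis by (simp add: ev_mult 1 2 RS_def)
qed

end

section \<open>Polynomials dividing their derivative times x (x + l)\<close>

lemma root_multiplicity_split: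
  fixes p :: "'a::field poly"
  assumes "p \<noteq> 0"
  obtains k m r where "p = [:0, 1:] ^ k * [:l, 1:] ^ m * r" "poly r 0 \<noteq> 0" "poly r (- l) \<noteq> 0"
    "l = 0 \<longrightarrow> m = 0"
proof -
  obtain q where q: "p = [:- 0, 1:] ^ order 0 p * q" "\<not> [:- 0, 1:] dvd q"
    using order_decomp[OF assms] by blast
  from q(1) assms have "q \<noteq> 0" by auto
  then obtain r where r: "q = [:- (- l), 1:] ^ order (- l) q * r" "\<not> [:- (- l), 1:] dvd r"
    using order_decomp by blast
  have q0: "poly q 0 \<noteq> 0" using q(2) by (simp add: poly_eq_0_iff_dvd)
  show thesis
  proof (cases "l = 0")
    case True
    \<comment> \<open>For \<open>l = 0\<close> the two roots coincide, and the whole multiplicity is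
      booked under \<open>k\<close>.\<close>
    show thesis by (rule that[of "order 0 p" 0 q]) (use q(1) q0 True in auto)
  next
    case False
    have "poly r 0 \<noteq> 0" using q0 by (subst (asm) r(1)) auto
    moreover have "poly r (- l) \<noteq> 0" using r(2) by (metis poly_eq_0_iff_dvd)
    moreover have "p = [:0, 1:] ^ order 0 p * [:l, 1:] ^ order (- l) q * r"
      using q(1) r(1) by (simp add: mult.assoc)
    ultimately show thesis using that False by blast
  qed
qed

lemma cancel_linear_dvd:
  fixes r s :: "'a::field poly"
  assumes "r dvd [:- c, 1:] * s" "poly r c \<noteq> 0"
  shows "r dvd s"
proof -
  obtain t where t: "[:- c, 1:] * s = r * t" using assms(1) by (rule dvdE)
  have "poly ([:- c, 1:] * s) c = 0" by simp
  then have "poly t c = 0" using assms(2) unfolding t by simp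
  then obtain t' where "t = [:- c, 1:] * t'" by (auto simp: poly_eq_0_iff_dvd elim: dvdE)
  then have "[:- c, 1:] * s = [:- c, 1:] * (r * t')" using t by (simp only: mult.left_commute)
  then have "s = r * t'" by (simp only: mult_cancel_left) auto
  then show ?thesis by simp
qed

text \<open>Multiplication by \<open>x (x + l)\<close> after differentiation fixes the multiplicity of the roots
  \<open>0\<close> and \<open>-l\<close> from below and lowers every other multiplicity.\<close>

lemma dvd_pderiv_times_quadratic:
  fixes p :: "'a::field_char_0 poly"
  assumes p: "p \<noteq> 0" and dvd: "p dvd pderiv p * [:0, l, 1:]"
  obtains k m c where "p = Polynomial.smult c ([:0, 1:] ^ k * [:l, 1:] ^ m)" "c \<noteq> 0" "l = 0 \<longrightarrow> m = 0"
proof -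
  obtain k m r where pr: "p = [:0, 1:] ^ k * [:l, 1:] ^ m * r"
    and r0: "poly r 0 \<noteq> 0" and rl: "poly r (- l) \<noteq> 0" and m: "l = 0 \<longrightarrow> m = 0"
    using root_multiplicity_split[OF p] by metis
  define h where "h = [:0, 1:] ^ k * [:l, 1:] ^ m"
  have h: "h \<noteq> 0" unfolding h_def by simp
  have f: "[:0, l, 1:] = [:0, 1:] * [:l, 1:]" by simp
  have X': "pderiv (q ^ j) * q = of_nat j * q ^ j" if "pderiv q = 1" for q :: "'a poly" and j
  proof (cases j)
    case (Suc i)
    show ?thesis unfolding Suc pderiv_power_Suc that of_nat_poly by (simp add: mult.commute)
  qed simp
  have X: "pderiv ([:c, 1:] ^ j) * [:c, 1:] = of_nat j * [:c, 1:] ^ j" for c :: 'a and j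
    by (rule X') (simp add: pderiv_pCons)
  have h': "pderiv h * [:0, l, 1:] = h * (of_nat k * [:l, 1:] + of_nat m * [:0, 1:])"
  proof -
    have "pderiv h * [:0, l, 1:]
        = (pderiv ([:0, 1:] ^ k) * [:0, 1:]) * [:l, 1:] ^ m * [:l, 1:]
        + (pderiv ([:l, 1:] ^ m) * [:l, 1:]) * [:0, 1:] ^ k * [:0, 1:]"
      unfolding h_def f pderiv_mult by (simp only: distrib_left distrib_right ac_simps)
    also have "\<dots> = h * (of_nat k * [:l, 1:] + of_nat m * [:0, 1:])"
      unfolding X h_def by (simp only: distrib_left ac_simps)
    finally show ?thesis .
  qed
  have "pderiv p * [:0, l, 1:] = pderiv h * [:0, l, 1:] * r + h * pderiv r * [:0, l, 1:]"
    unfolding pr h_def[symmetric] pderiv_mult by (simp only: distrib_left distrib_right ac_simps)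
  also have "\<dots> = h * ((of_nat k * [:l, 1:] + of_nat m * [:0, 1:]) * r + pderiv r * [:0, l, 1:])"
    unfolding h' by (simp only: distrib_left distrib_right ac_simps)
  finally have "h * r dvd h * ((of_nat k * [:l, 1:] + of_nat m * [:0, 1:]) * r + pderiv r * [:0, l, 1:])"
    using dvd pr h_def by simp
  then have "r dvd (of_nat k * [:l, 1:] + of_nat m * [:0, 1:]) * r + pderiv r * [:0, l, 1:]"
    using h by (simp only: dvd_mult_cancel_left) simp
  then have "r dvd pderiv r * [:0, l, 1:]"
    by (simp only: dvd_add_right_iff dvd_triv_right)
  then have "r dvd [:- 0, 1:] * ([:- (- l), 1:] * pderiv r)"
    unfolding f by (simp only: ac_simps minus_zero minus_minus)
  then have "r dvd pderiv r"
    using r0 rl cancel_linear_dvd by blast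
  \<comment> \<open>In characteristic zero a nonconstant \<open>r\<close> cannot divide its
    derivative, which is nonzero of smaller degree.\<close>
  have "degree r = 0"
  proof (rule ccontr)
    assume r: "degree r \<noteq> 0"
    then have "pderiv r \<noteq> 0" by (simp add: pderiv_eq_0_iff)
    with \<open>r dvd pderiv r\<close> have "degree r \<le> degree (pderiv r)" by (rule dvd_imp_degree_le)
    with r show False by (simp add: degree_pderiv)
  qed
  then obtain c where c: "r = [:c:]" by (rule degree_eq_zeroE)
  with r0 have "c \<noteq> 0" by simp
  moreover have "p = Polynomial.smult c h" using pr c h_def by simp
  ultimately show thesis using that m h_def by blast
qed

context commutator_pair
begin

text \<open>\<open>D\<close> will single out the genuine n by n matrices inside a larger space. The
  remainder of \<open>p' x (x + l)\<close> modulo \<open>p\<close> annihilates them too, so it is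
  zero by minimality. Lowering one of the resulting exponents leaves a nonzero polynomial of smaller
  degree, which cannot annihilate.\<close>

lemma minimal_polynomial_exponents:
  assumes d: "d \<ge> 1" "degree p = d" and D: "\<And>x. D x \<Longrightarrow> D (L x)"
    and ann: "\<And>x. D x \<Longrightarrow> ev p x = 0"
    and min: "\<And>q. q \<noteq> 0 \<Longrightarrow> (\<And>x. D x \<Longrightarrow> ev q x = 0) \<Longrightarrow> d \<le> degree q"
  obtains k m where "k + m = d" "l = 0 \<longrightarrow> m = 0" "\<And>x. D x \<Longrightarrow> RS k m x = 0"
    "k > 0 \<Longrightarrow> \<exists>x. D x \<and> RS (k - 1) m x \<noteq> 0" "m > 0 \<Longrightarrow> \<exists>x. D x \<and> RS k (m - 1) x \<noteq> 0"
proof -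
  have p: "p \<noteq> 0" using d by auto
  have ann': "ev (pderiv p * [:0, l, 1:]) x = 0" if "D x" for x
    using ev_L[of p x] ann[OF that] ann[OF D[OF that]] by simp
  define t where "t = (pderiv p * [:0, l, 1:]) mod p"
  have "ev t x = 0" if "D x" for x
  proof -
    have "ev ((pderiv p * [:0, l, 1:]) div p * p + t) x = 0"
      unfolding t_def by (simp only: div_mult_mod_eq ann'[OF that])
    then show ?thesis by (simp add: ev_add ev_mult ann[OF that]) (simp add: ev_def)
  qed
  then have "t = 0"
    using min[of t] degree_mod_less'[OF p, of "pderiv p * [:0, l, 1:]"] d t_def by fastforce
  then have "p dvd pderiv p * [:0, l, 1:]" unfolding t_def by (simp only: mod_eq_0_iff_dvd)
  then obtain k m c where pc: "p = Polynomial.smult c ([:0, 1:] ^ k * [:l, 1:] ^ m)" "c \<noteq> 0" "l = 0 \<longrightarrow> m = 0"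
    using dvd_pderiv_times_quadratic[OF p] by metis
  have deg: "degree ([:0, 1:] ^ i * [:l, 1:] ^ j :: 'a poly) = i + j" for i j
    by (simp add: degree_mult_eq degree_linear_power)
  have km: "k + m = d" using d pc by (simp add: deg)
  have zero: "RS k m x = 0" if "D x" for x
    using ann[OF that] pc(2) unfolding pc(1) ev_smult ev_power_linear by simp
  have ex: "\<exists>x. D x \<and> RS i j x \<noteq> 0" if "i + j < d" for i j
  proof (rule ccontr)
    assume "\<nexists>x. D x \<and> RS i j x \<noteq> 0"
    then have "ev ([:0, 1:] ^ i * [:l, 1:] ^ j) x = 0" if "D x" for x
      using that by (auto simp: ev_power_linear)
    moreover have "[:0, 1:] ^ i * [:l, 1:] ^ j \<noteq> (0 :: 'a poly)" by simp
    ultimately have "d \<le> degree ([:0, 1:] ^ i * [:l, 1:] ^ j :: 'a poly)" using min by blast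
    then show False using that by (simp add: deg)
  qed
  show thesis
    by (rule that[OF km pc(3) zero]) (use ex[of "k - 1" m] ex[of k "m - 1"] km in auto)
qed

end

section \<open>Matrices with total entry functions\<close>

text \<open>With total entry functions the ring and vector space laws hold without carrier conditions. An
  element of \<open>M\<^sub>n(F)\<close> is an \<open>X\<close> with \<open>cut n X = X\<close>, and operators are extended by \<open>R X = R (cut n X)\<close>.
  Indices start from 0.\<close>

datatype 'a imat = IMat (ent: "nat \<Rightarrow> nat \<Rightarrow> 'a")

lemma imat_eq_iff: "X = Y \<longleftrightarrow> (\<forall>i j. ent X i j = ent Y i j)"
  by (cases X; cases Y) auto

lemma imat_eqI: "(\<And>i j. ent X i j = ent Y i j) \<Longrightarrow> X = Y"
  by (simp add: imat_eq_iff)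

instantiation imat :: (ab_group_add) ab_group_add
begin

definition "0 = IMat (\<lambda>i j. 0)"
definition "X + Y = IMat (\<lambda>i j. ent X i j + ent Y i j)"
definition "X - Y = IMat (\<lambda>i j. ent X i j - ent Y i j)"
definition "- X = IMat (\<lambda>i j. - ent X i j)"

instance
  by standard (simp_all add: imat_eq_iff zero_imat_def plus_imat_def minus_imat_def uminus_imat_def)

end

lemma ent_arith [simp]:
  "ent 0 i j = 0" "ent (X + Y) i j = ent X i j + ent Y i j"
  "ent (X - Y) i j = ent X i j - ent Y i j" "ent (- X) i j = - ent X i j"
  by (simp_all add: zero_imat_def plus_imat_def minus_imat_def uminus_imat_def)

lemma ent_sum [simp]: "ent (sum f A) i j = (\<Sum>a\<in>A. ent (f a) i j)"
  by (induction A rule: infinite_finite_induct) simp_all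

definition sc :: "'a::field \<Rightarrow> 'a imat \<Rightarrow> 'a imat" where
  "sc c X = IMat (\<lambda>i j. c * ent X i j)"

text \<open>Only the summation index is bounded, not the rows and columns of the product.
  Associativity and bilinearity therefore hold without side conditions, but \<open>idm n\<close> is
  neutral only for \<open>X\<close> with \<open>cut n X = X\<close>.\<close>

definition mm :: "nat \<Rightarrow> 'a::field imat \<Rightarrow> 'a imat \<Rightarrow> 'a imat" where
  "mm n X Y = IMat (\<lambda>i j. \<Sum>k<n. ent X i k * ent Y k j)"

definition cut :: "nat \<Rightarrow> 'a::field imat \<Rightarrow> 'a imat" where
  "cut n X = IMat (\<lambda>i j. if i < n \<and> j < n then ent X i j else 0)"

definition idm :: "nat \<Rightarrow> 'a::field imat" where
  "idm n = IMat (\<lambda>i j. if i = j \<and> i < n then 1 else 0)"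

definition eu :: "nat \<Rightarrow> nat \<Rightarrow> 'a::field imat" where
  "eu p q = IMat (\<lambda>i j. if i = p \<and> j = q then 1 else 0)"

lemma sc_apply [simp]: "ent (sc c X) i j = c * ent X i j"
  by (simp add: sc_def)

lemma cut_apply: "ent (cut n X) i j = (if i < n \<and> j < n then ent X i j else 0)"
  by (simp add: cut_def)

lemma idm_apply: "ent (idm n) i j = (if i = j \<and> i < n then 1 else 0)"
  by (simp add: idm_def)

lemma eu_apply: "ent (eu p q) i j = (if i = p \<and> j = q then 1 else 0)"
  by (simp add: eu_def)

lemma mm_apply: "ent (mm n X Y) i j = (\<Sum>k<n. ent X i k * ent Y k j)"
  by (simp add: mm_def)

interpretation sc: vector_space sc
  by unfold_locales (simp_all add: imat_eq_iff algebra_simps)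

lemma mm_assoc: "mm n (mm n X Y) Z = mm n X (mm n Y Z)"
proof (intro imat_eqI)
  fix i j
  have "ent (mm n (mm n X Y) Z) i j = (\<Sum>k<n. \<Sum>m<n. ent X i m * ent Y m k * ent Z k j)"
    by (simp add: mm_apply sum_distrib_right)
  also have "\<dots> = (\<Sum>m<n. \<Sum>k<n. ent X i m * ent Y m k * ent Z k j)"
    by (rule sum.swap)
  also have "\<dots> = ent (mm n X (mm n Y Z)) i j"
    by (simp add: mm_apply sum_distrib_left mult.assoc)
  finally show "ent (mm n (mm n X Y) Z) i j = ent (mm n X (mm n Y Z)) i j" .
qed

lemma mm_add_left: "mm n (X + Y) Z = mm n X Z + mm n Y Z"
  and mm_add_right: "mm n X (Y + Z) = mm n X Y + mm n X Z"
  and mm_diff_left: "mm n (X - Y) Z = mm n X Z - mm n Y Z"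
  and mm_diff_right: "mm n X (Y - Z) = mm n X Y - mm n X Z"
  and mm_minus_left: "mm n (- X) Z = - mm n X Z"
  and mm_minus_right: "mm n X (- Z) = - mm n X Z"
  and mm_sc_left: "mm n (sc c X) Z = sc c (mm n X Z)"
  and mm_sc_right: "mm n X (sc c Z) = sc c (mm n X Z)"
  by (simp_all add: imat_eq_iff mm_apply algebra_simps sum.distrib sum_subtractf sum_negf
      sum_distrib_left)

lemma mm_zero_left [simp]: "mm n 0 X = 0" and mm_zero_right [simp]: "mm n X 0 = 0"
  by (simp_all add: imat_eq_iff mm_apply)

lemma mm_sum_right: "mm n Z (sum f A) = (\<Sum>a\<in>A. mm n Z (f a))"
  by (induction A rule: infinite_finite_induct) (simp_all add: mm_add_right)

lemmas mm_simps = mm_add_left mm_add_right mm_diff_left mm_diff_right mm_minus_left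
  mm_minus_right mm_sc_left mm_sc_right

lemma cut_add: "cut n (X + Y) = cut n X + cut n Y"
  and cut_diff: "cut n (X - Y) = cut n X - cut n Y"
  and cut_minus: "cut n (- X) = - cut n X"
  and cut_sc: "cut n (sc c X) = sc c (cut n X)"
  and cut_0 [simp]: "cut n 0 = 0"
  and cut_cut [simp]: "cut n (cut n X) = cut n X"
  and cut_idm [simp]: "cut n (idm n) = idm n"
  by (auto simp: imat_eq_iff cut_apply idm_apply)

lemma cut_eu [simp]: "p < n \<Longrightarrow> q < n \<Longrightarrow> cut n (eu p q) = eu p q"
  by (auto simp: imat_eq_iff cut_apply eu_apply)

lemma cut_sum: "cut n (sum f A) = (\<Sum>a\<in>A. cut n (f a))"
  by (induction A rule: infinite_finite_induct) (simp_all add: cut_add)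

lemma cut_mm: "cut n (mm n X Y) = mm n (cut n X) (cut n Y)"
  by (auto simp: imat_eq_iff cut_apply mm_apply intro!: sum.cong)

lemma mm_idm_left: "ent (mm n (idm n) X) i j = (if i < n then ent X i j else 0)"
  by (auto simp: imat_eq_iff mm_apply idm_apply if_distrib if_distribR sum.delta' cong: if_cong)

lemma mm_idm_right: "ent (mm n X (idm n)) i j = (if j < n then ent X i j else 0)"
  by (auto simp: imat_eq_iff mm_apply idm_apply if_distrib if_distribR sum.delta' cong: if_cong)

lemma mm_idm [simp]:
  assumes "cut n X = X"
  shows "mm n (idm n) X = X" "mm n X (idm n) = X"
  using assms by (auto simp: mm_idm_left mm_idm_right imat_eq_iff cut_apply split: if_splits)

lemma cut_mm_idm: "cut n (mm n (idm n) X) = cut n X" "cut n (mm n X (idm n)) = cut n X"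
  by (auto simp: mm_idm_left mm_idm_right imat_eq_iff cut_apply)

lemma mm_eu_left: "ent (mm n (eu p q) X) i j = (if i = p \<and> q < n then ent X q j else 0)"
  by (auto simp: mm_apply eu_apply if_distrib if_distribR sum.delta' cong: if_cong)

lemma mm_eu_right: "ent (mm n X (eu p q)) i j = (if j = q \<and> p < n then ent X i p else 0)"
  by (auto simp: mm_apply eu_apply if_distrib if_distribR sum.delta' cong: if_cong)

lemma cut_expand: "cut n X = (\<Sum>p<n. \<Sum>q<n. sc (ent X p q) (eu p q))"
proof (intro imat_eqI)
  fix i j
  have "(\<Sum>p<n. \<Sum>q<n. ent X p q * ent (eu p q) i j)
      = (\<Sum>p<n. \<Sum>q<n. if p = i then if q = j then ent X i j else 0 else 0)"
    by (intro sum.cong refl) (auto simp: eu_apply)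
  also have "\<dots> = (\<Sum>p<n. if p = i then if j < n then ent X i j else 0 else 0)"
    by (intro sum.cong refl) simp
  also have "\<dots> = ent (cut n X) i j" by (simp add: cut_apply)
  finally show "ent (cut n X) i j = ent (\<Sum>p<n. \<Sum>q<n. sc (ent X p q) (eu p q)) i j" by simp
qed

section \<open>Rota-Baxter operators on matrices and their duals\<close>

locale rb_matrix =
  fixes n :: nat and l :: "'a::field_char_0" and R :: "'a imat \<Rightarrow> 'a imat"
  assumes R_add: "R (X + Y) = R X + R Y" and R_sc: "R (sc c X) = sc c (R X)"
    and R_cut: "R (cut n X) = R X" and cut_R: "cut n (R X) = R X"
    and RB: "mm n (R X) (R Y) = R (mm n (R X) Y + mm n X (R Y) + sc l (mm n X Y))"
begin

abbreviation mmn :: "'a imat \<Rightarrow> 'a imat \<Rightarrow> 'a imat" (infixl "\<odot>" 70) where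
  "X \<odot> Y \<equiv> mm n X Y"

definition a :: "'a imat" where "a = R (idm n)"

lemma cut_a [simp]: "cut n a = a"
  by (simp add: a_def cut_R)

lemma R_idm: "R (idm n \<odot> X) = R X" "R (X \<odot> idm n) = R X"
  by (metis R_cut cut_mm_idm(1)) (metis R_cut cut_mm_idm(2))

lemma mm_a_R: "a \<odot> R X = R (a \<odot> X) + R (R X) + sc l (R X)"
  using RB[of "idm n" X] by (simp add: a_def[symmetric] R_add R_sc R_idm cut_R)

lemma R_mm_a: "R X \<odot> a = R (X \<odot> a) + R (R X) + sc l (R X)"
  using RB[of X "idm n"] by (simp add: a_def[symmetric] R_add R_sc R_idm cut_R add_ac)

sublocale left: commutator_pair sc l R "\<lambda>X. a \<odot> X"
  by unfold_locales (simp_all add: R_add R_sc mm_simps mm_a_R)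

sublocale right: commutator_pair sc l R "\<lambda>X. X \<odot> a"
  by unfold_locales (simp_all add: R_add R_sc mm_simps R_mm_a)

abbreviation "RS \<equiv> left.RS"
abbreviation "S \<equiv> left.S"

text \<open>The terms \<open>R (R X)\<close> and \<open>sc l (R X)\<close> occur in both one-sided
  relations and cancel.\<close>

lemma R_ad: "a \<odot> R X - R X \<odot> a = R (a \<odot> X - X \<odot> a)"
  by (simp add: mm_a_R R_mm_a left.R_diff)

lemma R_expand: "R X = (\<Sum>p<n. \<Sum>q<n. sc (ent X p q) (R (eu p q)))"
  by (subst R_cut[symmetric]) (simp add: cut_expand left.R_sum R_sc)

lemma cut_S: "cut n X = X \<Longrightarrow> cut n (S X) = S X"
  by (simp add: left.S_def cut_add cut_R cut_sc)

lemma cut_RS: "cut n X = X \<Longrightarrow> cut n (RS k m X) = RS k m X"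
proof (induction k)
  case 0
  then show ?case by (induction m) (simp_all add: left.S_RS[symmetric] cut_S)
next
  case (Suc k)
  then show ?case by (simp add: left.R_RS[symmetric] cut_R)
qed

lemma RS_expand:
  assumes "cut n X = X"
  shows "RS k m X = (\<Sum>p<n. \<Sum>q<n. sc (ent X p q) (RS k m (eu p q)))"
  by (subst assms[symmetric]) (simp add: cut_expand left.RS_sum left.RS_scale)

lemma RS_nonzero_unit:
  assumes "cut n X = X" "RS k m X \<noteq> 0"
  obtains p q where "p < n" "q < n" "RS k m (eu p q) \<noteq> 0"
proof -
  have "\<exists>p<n. \<exists>q<n. RS k m (eu p q) \<noteq> 0"
  proof (rule ccontr)
    assume "\<not> ?thesis"
    then have "(\<Sum>p<n. \<Sum>q<n. sc (ent X p q) (RS k m (eu p q))) = 0"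
      by (intro sum.neutral ballI) auto
    then show False using assms RS_expand[of X k m] by simp
  qed
  then show thesis using that by blast
qed

lemma dual_rb_matrix: "rb_matrix n l (\<lambda>X. - R X - sc l (cut n X))"
proof
  fix X Y :: "'a imat" and c :: 'a
  let ?D = "\<lambda>X. - R X - sc l (cut n X)"
  show "?D (X + Y) = ?D X + ?D Y" by (simp add: R_add cut_add sc.scale_right_distrib)
  show "?D (sc c X) = sc c (?D X)"
    by (simp add: R_sc cut_sc sc.scale_right_diff_distrib sc.scale_left_commute[of c])
  show "?D (cut n X) = ?D X" by (simp add: R_cut)
  show "cut n (?D X) = ?D X" by (simp add: cut_diff cut_minus cut_sc cut_R)
  have c: "R (cut n X \<odot> Z) = R (X \<odot> Z)" "R (Z \<odot> cut n X) = R (Z \<odot> X)" for X Z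
    by (metis R_cut cut_cut cut_mm)+
  let ?Z = "?D X \<odot> Y + X \<odot> ?D Y + sc l (X \<odot> Y)"
  have "R ?Z = - R (R X \<odot> Y) - R (X \<odot> R Y) - sc l (R (X \<odot> Y))"
    by (simp add: mm_simps R_add left.R_diff left.R_minus R_sc c)
  moreover have "cut n ?Z = - (R X \<odot> cut n Y) - (cut n X \<odot> R Y) - sc l (cut n X \<odot> cut n Y)"
    by (simp add: mm_simps cut_add cut_diff cut_minus cut_sc) (simp add: cut_mm cut_R)
  ultimately show "?D X \<odot> ?D Y = ?D ?Z"
    by (simp only:) (simp add: mm_simps RB R_add R_sc sc.scale_right_diff_distrib)
qed

text \<open>The dual operator is \<open>- S\<close>, and adding \<open>l\<close> to it gives
  \<open>- R\<close>; so the exponents change places and each factor contributes a sign. This allows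
  the larger exponent to be assumed to belong to \<open>R\<close>.\<close>

lemma dual_RS:
  assumes "cut n X = X"
  shows "commutator_pair.RS sc l (\<lambda>X. - R X - sc l (cut n X)) k m X = sc ((- 1) ^ (k + m)) (RS m k X)"
proof -
  interpret D: rb_matrix n l "\<lambda>X. - R X - sc l (cut n X)" by (rule dual_rb_matrix)
  have c: "cut n (RS i j X) = RS i j X" for i j using assms by (rule cut_RS)
  show ?thesis
  proof (induction k)
    case 0
    show ?case
    proof (induction m)
      case 0
      show ?case by simp
    next
      case (Suc m)
      have "D.RS 0 (Suc m) X = D.S (D.RS 0 m X)" by (simp add: D.left.S_RS)
      also have "\<dots> = - R (D.RS 0 m X)"
        using Suc c by (simp add: D.left.S_def cut_sc)
      finally show ?case using Suc by (simp add: R_sc left.R_RS sc.scale_minus_left)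
    qed
  next
    case (Suc k)
    have "D.RS (Suc k) m X = - R (D.RS k m X) - sc l (cut n (D.RS k m X))"
      by (simp add: D.left.R_RS[symmetric])
    also have "\<dots> = - S (D.RS k m X)"
      using Suc c by (simp add: left.S_def cut_sc)
    finally show ?case using Suc by (simp add: left.S_scale left.S_RS sc.scale_minus_left)
  qed
qed

end

text \<open>Automorphisms and antiautomorphisms are treated together, and the inverse is carried
  along as \<open>g\<close>. Both maps ignore entries outside the block, so the composites are
  \<open>cut n\<close> instead of the identity.\<close>

definition mat_iso :: "nat \<Rightarrow> ('a::field imat \<Rightarrow> 'a imat) \<Rightarrow> ('a imat \<Rightarrow> 'a imat) \<Rightarrow> bool" where
  "mat_iso n f g \<longleftrightarrow>
    (\<forall>X Y. f (X + Y) = f X + f Y) \<and> (\<forall>c X. f (sc c X) = sc c (f X)) \<and>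
    (\<forall>X Y. g (X + Y) = g X + g Y) \<and> (\<forall>c X. g (sc c X) = sc c (g X)) \<and>
    (\<forall>X. f (cut n X) = f X) \<and> (\<forall>X. g (cut n X) = g X) \<and>
    (\<forall>X. f (g X) = cut n X) \<and> (\<forall>X. g (f X) = cut n X) \<and>
    ((\<forall>X Y. f (mm n X Y) = mm n (f X) (f Y)) \<or> (\<forall>X Y. f (mm n X Y) = mm n (f Y) (f X)))"

lemma mat_isoD:
  assumes "mat_iso n f g"
  shows "f (X + Y) = f X + f Y" "f (sc c X) = sc c (f X)"
    "g (X + Y) = g X + g Y" "g (sc c X) = sc c (g X)"
    "f (cut n X) = f X" "g (cut n X) = g X" "cut n (f X) = f X" "cut n (g X) = g X"
    "f (g X) = cut n X" "g (f X) = cut n X"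
proof -
  show 1: "f (X + Y) = f X + f Y" "f (sc c X) = sc c (f X)"
    "g (X + Y) = g X + g Y" "g (sc c X) = sc c (g X)"
    "f (cut n X) = f X" "g (cut n X) = g X" "f (g X) = cut n X" "g (f X) = cut n X" for X Y c
    using assms unfolding mat_iso_def by blast+
  show "cut n (f X) = f X" using 1(7)[of "f X"] by (simp add: 1(5,8))
  show "cut n (g X) = g X" using 1(8)[of "g X"] by (simp add: 1(6,7))
qed

lemma mat_iso_trans:
  assumes "mat_iso n f g" "mat_iso n h k"
  shows "mat_iso n (\<lambda>X. h (f X)) (\<lambda>X. g (k X))"
proof -
  note D = mat_isoD[OF assms(1)] mat_isoD[OF assms(2)]
  have "(\<forall>X Y. f (mm n X Y) = mm n (f X) (f Y)) \<or> (\<forall>X Y. f (mm n X Y) = mm n (f Y) (f X))"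
    and "(\<forall>X Y. h (mm n X Y) = mm n (h X) (h Y)) \<or> (\<forall>X Y. h (mm n X Y) = mm n (h Y) (h X))"
    using assms unfolding mat_iso_def by blast+
  then have "(\<forall>X Y. h (f (mm n X Y)) = mm n (h (f X)) (h (f Y))) \<or>
      (\<forall>X Y. h (f (mm n X Y)) = mm n (h (f Y)) (h (f X)))"
    by (elim disjE) simp_all
  with D show ?thesis unfolding mat_iso_def by simp
qed

lemma mat_iso_id: "mat_iso n (cut n) (cut n)"
  by (simp add: mat_iso_def cut_add cut_sc cut_mm)

lemma mat_iso_inverse_mult:
  assumes "mat_iso n f g"
  shows "(\<forall>X Y. f (mm n X Y) = mm n (f X) (f Y)) \<and> (\<forall>X Y. g (mm n X Y) = mm n (g X) (g Y))
    \<or> (\<forall>X Y. f (mm n X Y) = mm n (f Y) (f X)) \<and> (\<forall>X Y. g (mm n X Y) = mm n (g Y) (g X))"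
proof -
  note D = mat_isoD[OF assms]
  have g: "g (mm n X Y) = g (mm n (f (g X)) (f (g Y)))" for X Y
    by (metis D(6) D(9) cut_mm)
  have "(\<forall>X Y. f (mm n X Y) = mm n (f X) (f Y)) \<or> (\<forall>X Y. f (mm n X Y) = mm n (f Y) (f X))"
    using assms by (simp add: mat_iso_def)
  then show ?thesis
  proof
    assume f: "\<forall>X Y. f (mm n X Y) = mm n (f X) (f Y)"
    have "g (mm n X Y) = mm n (g X) (g Y)" for X Y
      by (subst g) (simp only: f[rule_format, symmetric] D(10), simp only: cut_mm D(8))
    with f show ?thesis by blast
  next
    assume f: "\<forall>X Y. f (mm n X Y) = mm n (f Y) (f X)"
    have "g (mm n X Y) = mm n (g Y) (g X)" for X Y
      by (subst g) (simp only: f[rule_format, symmetric] D(10), simp only: cut_mm D(8))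
    with f show ?thesis by blast
  qed
qed

lemma mat_iso_sym:
  assumes "mat_iso n f g"
  shows "mat_iso n g f"
  using mat_isoD[OF assms] mat_iso_inverse_mult[OF assms] unfolding mat_iso_def by simp blast

lemma mat_iso_conj:
  assumes "mm n P Q = idm n" "mm n Q P = idm n" "cut n P = P" "cut n Q = Q"
  shows "mat_iso n (\<lambda>X. mm n Q (mm n (cut n X) P)) (\<lambda>X. mm n P (mm n (cut n X) Q))"
proof -
  have c: "cut n (mm n (cut n X) (cut n Y)) = mm n (cut n X) (cut n Y)" for X Y :: "'a imat"
    by (simp add: cut_mm)
  have 1: "mm n Q (mm n (cut n (mm n P (mm n (cut n X) Q))) P) = cut n X"
    and 2: "mm n P (mm n (cut n (mm n Q (mm n (cut n X) P))) Q) = cut n X" for X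
    using assms
    by (simp_all add: cut_mm mm_assoc) (simp_all add: mm_assoc[symmetric] cut_mm)
  have 3: "mm n Q (mm n (cut n (mm n X Y)) P)
      = mm n (mm n Q (mm n (cut n X) P)) (mm n Q (mm n (cut n Y) P))" for X Y
  proof -
    have "mm n (mm n Q (mm n (cut n X) P)) (mm n Q (mm n (cut n Y) P))
        = mm n Q (mm n (cut n X) (mm n (mm n P Q) (mm n (cut n Y) P)))"
      by (simp add: mm_assoc)
    also have "\<dots> = mm n Q (mm n (cut n (mm n X Y)) P)"
      using assms(3) by (simp add: assms(1) cut_mm mm_assoc)
    finally show ?thesis by simp
  qed
  show ?thesis
    unfolding mat_iso_def
    by (intro conjI allI disjI1; (rule 1 | rule 2 | rule 3)?) (simp_all add: cut_add cut_sc mm_simps)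
qed

lemma (in rb_matrix) conj_rb_matrix:
  assumes "mat_iso n f g"
  shows "rb_matrix n l (\<lambda>X. f (R (g X)))"
proof
  note D = mat_isoD[OF assms]
  fix X Y :: "'a imat" and c :: 'a
  show "f (R (g (X + Y))) = f (R (g X)) + f (R (g Y))" by (simp add: D R_add)
  show "f (R (g (sc c X))) = sc c (f (R (g X)))" by (simp add: D R_sc)
  show "f (R (g (cut n X))) = f (R (g X))" by (simp add: D)
  show "cut n (f (R (g X))) = f (R (g X))" by (simp add: D)
  show "mm n (f (R (g X))) (f (R (g Y))) = f (R (g (mm n (f (R (g X))) Y
      + mm n X (f (R (g Y))) + sc l (mm n X Y))))"
    using mat_iso_inverse_mult[OF assms]
  proof (elim disjE conjE)
    assume f: "\<forall>X Y. f (mm n X Y) = mm n (f X) (f Y)" and g: "\<forall>X Y. g (mm n X Y) = mm n (g X) (g Y)"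
    show ?thesis by (simp add: D f[rule_format, symmetric] g RB cut_R)
  next
    assume f: "\<forall>X Y. f (mm n X Y) = mm n (f Y) (f X)" and g: "\<forall>X Y. g (mm n X Y) = mm n (g Y) (g X)"
    show ?thesis by (simp add: D f[rule_format, symmetric] g RB cut_R add_ac)
  qed
qed

lemma (in rb_matrix) conj_RS:
  assumes "mat_iso n f g" "cut n X = X"
  shows "commutator_pair.RS sc l (\<lambda>X. f (R (g X))) k m X = f (RS k m (g X))"
proof -
  interpret D: rb_matrix n l "\<lambda>X. f (R (g X))" using assms(1) by (rule conj_rb_matrix)
  note D = mat_isoD[OF assms(1)]
  have c: "cut n (RS i j (g X)) = RS i j (g X)" for i j by (rule cut_RS) (simp add: D)
  show ?thesis
  proof (induction k)
    case 0
    show ?case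
    proof (induction m)
      case 0
      show ?case by (simp add: D assms(2))
    next
      case (Suc m)
      have "D.RS 0 (Suc m) X = D.S (D.RS 0 m X)" by (simp add: D.left.S_RS)
      also have "\<dots> = f (R (RS 0 m (g X))) + sc l (f (RS 0 m (g X)))"
        using Suc c by (simp add: D.left.S_def D R_cut)
      also have "\<dots> = f (S (RS 0 m (g X)))" by (simp add: left.S_def D)
      finally show ?case by (simp add: left.S_RS)
    qed
  next
    case (Suc k)
    have "D.RS (Suc k) m X = f (R (g (D.RS k m X)))"
      by (simp add: D.left.R_RS[symmetric])
    then show ?case using Suc c by (simp add: D R_cut left.R_RS)
  qed
qed

section \<open>Diagonalising the image of the identity\<close>

lemma independent_eigenvectors:
  fixes w :: "'i \<Rightarrow> 'a::field imat"
  assumes "finite J" "inj_on c J" "\<And>j. j \<in> J \<Longrightarrow> mm n A (w j) = sc (c j) (w j)" "(\<Sum>j\<in>J. w j) = 0"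
    and "j \<in> J"
  shows "w j = 0"
  using assms
proof (induction J arbitrary: w j rule: finite_induct)
  case empty
  then show ?case by simp
next
  case (insert i J)
  have w: "mm n A (w j) = sc (c j) (w j)" if "j \<in> insert i J" for j
    using insert.prems that by blast
  define u where "u j = sc (c j - c i) (w j)" for j
  have "(\<Sum>j\<in>insert i J. u j) = (\<Sum>j\<in>insert i J. mm n A (w j) - sc (c i) (w j))"
    by (intro sum.cong refl) (simp add: w u_def sc.scale_left_diff_distrib)
  also have "\<dots> = mm n A (\<Sum>j\<in>insert i J. w j) - sc (c i) (\<Sum>j\<in>insert i J. w j)"
    by (simp only: sum_subtractf mm_sum_right sc.scale_sum_right)
  also have "\<dots> = 0" unfolding insert.prems(3) by simp
  finally have "(\<Sum>j\<in>insert i J. u j) = 0" .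
  then have "(\<Sum>j\<in>J. u j) = 0" using insert.hyps by (simp add: u_def)
  moreover have "mm n A (u j) = sc (c j) (u j)" if "j \<in> J" for j
    using w[of j] that by (simp add: u_def mm_sc_right mult.commute)
  ultimately have "u j = 0" if "j \<in> J" for j
    using insert.IH[of u j] insert.prems that by (simp add: inj_on_insert)
  moreover have "c j - c i \<noteq> 0" if "j \<in> J" for j
    using insert.prems(1) insert.hyps that inj_onD[of c "insert i J" j i] by auto
  ultimately have J: "w j = 0" if "j \<in> J" for j
    using that by (auto simp: u_def)
  then have "w i = 0" using insert.prems(3) insert.hyps by simp
  then show ?case using J insert.prems(4) by blast
qed

lemma imat_inverse:
  fixes M :: "'a::field imat"
  assumes M: "cut n M = M"
    and ker: "\<And>v. (\<And>i. i < n \<Longrightarrow> (\<Sum>k<n. ent M i k * v k) = 0) \<Longrightarrow> (\<And>k. k < n \<Longrightarrow> v k = 0)"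
  obtains N where "cut n N = N" "mm n M N = idm n" "mm n N M = idm n"
proof -
  define A where "A = mat n n (\<lambda>(i, j). ent M i j)"
  have A: "A \<in> carrier_mat n n" by (simp add: A_def)
  have "det A \<noteq> 0"
  proof
    assume "det A = 0"
    then obtain v where v: "v \<in> carrier_vec n" "v \<noteq> 0\<^sub>v n" "A *\<^sub>v v = 0\<^sub>v n"
      using det_0_iff_vec_prod_zero_field[OF A] by blast
    have "(\<Sum>k<n. ent M i k * v $ k) = 0" if "i < n" for i
    proof -
      have "(A *\<^sub>v v) $ i = (\<Sum>k<n. ent M i k * v $ k)"
        using that v(1) by (simp add: A_def scalar_prod_def atLeast0LessThan)
      then show ?thesis using v(3) that by simp
    qed
    then have "v $ k = 0" if "k < n" for k using ker[of "\<lambda>k. v $ k" k] that by blast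
    then have "v = 0\<^sub>v n" using v(1) by (intro eq_vecI) auto
    with v(2) show False by simp
  qed
  then have "A \<in> Units (ring_mat TYPE('a) n ())"
    using det_non_zero_imp_unit[OF A] by simp
  then obtain B where B: "B \<in> carrier_mat n n" "B * A = 1\<^sub>m n" "A * B = 1\<^sub>m n"
    unfolding Units_def ring_mat_def by auto
  define N where "N = cut n (IMat (\<lambda>i j. B $$ (i, j)))"
  have 1: "ent (mm n M N) i j = ent (idm n) i j" for i j
  proof (cases "i < n \<and> j < n")
    case True
    then have "ent (mm n M N) i j = (A * B) $$ (i, j)"
      using B(1) by (simp add: mm_apply N_def cut_apply A_def scalar_prod_def atLeast0LessThan)
    then show ?thesis using True by (simp add: B idm_apply)
  next
    case False
    have "ent (mm n M N) i j = ent (cut n (mm n M N)) i j" by (simp add: cut_mm M N_def)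
    then show ?thesis using False by (auto simp: cut_apply idm_apply)
  qed
  have 2: "ent (mm n N M) i j = ent (idm n) i j" for i j
  proof (cases "i < n \<and> j < n")
    case True
    then have "ent (mm n N M) i j = (B * A) $$ (i, j)"
      using B(1) by (simp add: mm_apply N_def cut_apply A_def scalar_prod_def atLeast0LessThan)
    then show ?thesis using True by (simp add: B idm_apply)
  next
    case False
    have "ent (mm n N M) i j = ent (cut n (mm n N M)) i j" by (simp add: cut_mm M N_def)
    then show ?thesis using False by (auto simp: cut_apply idm_apply)
  qed
  show thesis by (rule that[of N]) (simp_all add: N_def[symmetric] 1 2 imat_eqI, simp add: N_def)
qed

context commutator_pair
begin

text \<open>A chain \<open>u\<^sub>j = R\<^sup>j S\<^sup>m w\<close> is triangular for \<open>L\<close>; the coefficients \<open>b\<close> diagonalise it.\<close>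

lemma eigenvector_chain:
  assumes l: "l \<noteq> 0" and w: "L w = c *s w" and top: "RS (k - 1) m w \<noteq> 0" and zero: "RS k m w = 0"
    and j: "j < k"
  obtains b where "L (\<Sum>t<k - j. b t *s RS (j + t) m w) = (c + of_nat j * l) *s (\<Sum>t<k - j. b t *s RS (j + t) m w)"
    "(\<Sum>t<k - j. b t *s RS (j + t) m w) \<noteq> 0"
proof -
  \<comment> \<open>The recursion is the comparison of coefficients of
    \<open>RS (j + t + 1) m w\<close> in the eigenvector equation for \<open>c + j l\<close>: it
    demands \<open>b (t + 1) (t + 1) l = - b t (j + t + m)\<close>.\<close>
  define b where "b = rec_nat (1 :: 'a) (\<lambda>t x. - x * of_nat (j + t + m) / (of_nat (Suc t) * l))"
  have b0: "b 0 = 1" and bS: "b (Suc t) * (of_nat (Suc t) * l) = - b t * of_nat (j + t + m)" for t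
    using l by (simp_all add: b_def del: of_nat_Suc)
  define x where "x = (\<Sum>t<k - j. b t *s RS (j + t) m w)"
  \<comment> \<open>The deviation from the eigenvector equation telescopes through \<open>g\<close>;
    both boundary terms vanish, one by its factor 0 and the other by \<open>zero\<close>.\<close>
  define g where "g t = (b t * of_nat t * l) *s RS (j + t) m w" for t
  have "L (b t *s RS (j + t) m w) = (c + of_nat j * l) *s (b t *s RS (j + t) m w) + (g t - g (Suc t))" for t
  proof -
    have gS: "g (Suc t) = (- b t * of_nat (j + t + m)) *s RS (j + Suc t) m w"
      unfolding g_def using bS[of t] by (simp add: mult.assoc)
    show ?thesis
      unfolding L_scale L_RS_eigen(1)[OF w] gS g_def[of t]
      by (simp add: algebra_simps)
  qed
  then have "L x = (\<Sum>t<k - j. (c + of_nat j * l) *s (b t *s RS (j + t) m w) + (g t - g (Suc t)))"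
    by (simp add: x_def L_sum)
  also have "\<dots> = (c + of_nat j * l) *s x + (g 0 - g (k - j))"
    by (simp only: sum.distrib sum_lessThan_telescope' x_def scale_sum_right)
  also have "g 0 - g (k - j) = 0" using zero j by (simp add: g_def)
  finally have 1: "L x = (c + of_nat j * l) *s x" by simp
  \<comment> \<open>Applying \<open>R^(k - 1 - j)\<close> leaves only the first summand, the top of
    the chain, so \<open>x\<close> is nonzero.\<close>
  have "RS (k - 1 - j) 0 x = (\<Sum>t<k - j. b t *s RS (k - 1 + t) m w)"
    using j by (simp add: x_def RS_sum RS_scale RS_RS add.commute)
  also have "\<dots> = (\<Sum>t\<in>{0}. b t *s RS (k - 1 + t) m w)"
  proof (rule sum.mono_neutral_right)
    show "\<forall>t\<in>{..<k - j} - {0}. b t *s RS (k - 1 + t) m w = 0"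
    proof
      fix t assume "t \<in> {..<k - j} - {0}"
      then have "RS (k - 1 + t) m w = RS (t - 1) 0 (RS k m w)" using j by (simp add: RS_RS add.commute)
      then show "b t *s RS (k - 1 + t) m w = 0" by (simp add: zero)
    qed
  qed (use j in auto)
  finally have "RS (k - 1 - j) 0 x \<noteq> 0" using top b0 by simp
  then have "x \<noteq> 0" by auto
  with 1 show thesis using that[of b] by (simp add: x_def)
qed

text \<open>Both correction terms in \<open>L_RS\<close> are images of
  \<open>RS k m x\<close>.\<close>

lemma RS_kernel_L: "RS k m x = 0 \<Longrightarrow> RS k m (L x) = 0"
  using L_RS[of k m x] R_RS[of k m x] S_RS[of k m x] by simp

end

section \<open>Matrices annihilated by a product of distinct linear factors\<close>

definition linear_factors :: "nat \<Rightarrow> 'a::field imat \<Rightarrow> 'a list \<Rightarrow> 'a imat \<Rightarrow> 'a imat" where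
  "linear_factors n A cs = fold (\<lambda>c X. mm n A X - sc c X) cs"

lemma linear_factors_simps [simp]:
  "linear_factors n A [] X = X"
  "linear_factors n A (c # cs) X = linear_factors n A cs (mm n A X - sc c X)"
  "linear_factors n A (cs @ ds) X = linear_factors n A ds (linear_factors n A cs X)"
  by (simp_all add: linear_factors_def)

lemma linear_factors_mm: "linear_factors n A cs (mm n X Y) = mm n (linear_factors n A cs X) Y"
proof (induction cs arbitrary: X)
  case (Cons d cs)
  have "mm n A (mm n X Y) - sc d (mm n X Y) = mm n (mm n A X - sc d X) Y"
    by (simp add: mm_simps mm_assoc)
  then show ?case by (simp only: linear_factors_simps Cons.IH)
qed simp

text \<open>Partial fractions: decompose \<open>(A - c) X\<close> into eigenvectors, divide the one
  for \<open>d\<close> by \<open>d - c\<close>, and subtract their sum from \<open>X\<close>; what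
  remains is an eigenvector for \<open>c\<close>.\<close>

lemma eigenvector_decomposition:
  fixes A :: "'a::field imat"
  assumes "distinct cs" "linear_factors n A cs X = 0"
  shows "\<exists>w. (\<forall>c\<in>set cs. mm n A (w c) = sc c (w c)) \<and> X = (\<Sum>c\<in>set cs. w c)"
  using assms
proof (induction cs arbitrary: X)
  case Nil
  then show ?case by simp
next
  case (Cons c cs)
  then obtain w where w: "\<forall>d\<in>set cs. mm n A (w d) = sc d (w d)" "mm n A X - sc c X = (\<Sum>d\<in>set cs. w d)"
    by auto
  define v where "v d = (if d = c then X - (\<Sum>d\<in>set cs. sc (1 / (d - c)) (w d)) else sc (1 / (d - c)) (w d))" for d
  have eig: "mm n A (v d) = sc d (v d)" if "d \<in> set cs" for d
    using w(1) that Cons.prems(1) by (auto simp: v_def mm_simps sc.scale_left_commute[of d])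
  have X: "X = (\<Sum>d\<in>set (c # cs). v d)"
  proof -
    have "(\<Sum>d\<in>set cs. v d) = (\<Sum>d\<in>set cs. sc (1 / (d - c)) (w d))"
      using Cons.prems(1) by (intro sum.cong) (auto simp: v_def)
    then show ?thesis using Cons.prems(1) by (simp add: v_def)
  qed
  have "mm n A (v c) = sc c (v c)"
  proof -
    have "mm n A (v c) = mm n A X - (\<Sum>d\<in>set cs. sc (d / (d - c)) (w d))"
      using w(1) by (simp add: v_def mm_simps mm_sum_right)
    also have "(\<Sum>d\<in>set cs. sc (d / (d - c)) (w d)) = (\<Sum>d\<in>set cs. sc (c / (d - c)) (w d) + w d)"
    proof (intro sum.cong refl)
      fix d assume "d \<in> set cs"
      then have "d \<noteq> c" using Cons.prems(1) by auto
      then have "d / (d - c) = c / (d - c) + 1" by (simp add: field_simps)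
      then show "sc (d / (d - c)) (w d) = sc (c / (d - c)) (w d) + w d"
        by (simp only: sc.scale_left_distrib sc.scale_one)
    qed
    also have "\<dots> = sc c (\<Sum>d\<in>set cs. sc (1 / (d - c)) (w d)) + (mm n A X - sc c X)"
      by (simp add: sum.distrib w(2) sc.scale_sum_right)
    finally show ?thesis by (simp add: v_def sc.scale_right_diff_distrib algebra_simps)
  qed
  with eig X show ?case by (intro exI[of _ v]) auto
qed

definition diag_mat :: "nat \<Rightarrow> (nat \<Rightarrow> 'a::field) \<Rightarrow> 'a imat" where
  "diag_mat n d = IMat (\<lambda>i j. if i = j \<and> i < n then d i else 0)"

lemma diag_mat_apply: "ent (diag_mat n d) i j = (if i = j \<and> i < n then d i else 0)"
  by (simp add: diag_mat_def)

lemma cut_diag_mat [simp]: "cut n (diag_mat n d) = diag_mat n d"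
  by (auto simp: imat_eq_iff cut_apply diag_mat_apply)

lemma mm_diag_mat_left: "ent (mm n (diag_mat n d) X) i j = (if i < n then d i * ent X i j else 0)"
  by (auto simp: mm_apply diag_mat_apply if_distrib if_distribR sum.delta' cong: if_cong)

lemma mm_diag_mat_right: "ent (mm n X (diag_mat n d)) i j = (if j < n then ent X i j * d j else 0)"
  by (auto simp: mm_apply diag_mat_apply if_distrib if_distribR sum.delta' cong: if_cong)

context rb_matrix
begin

text \<open>Because \<open>a\<close> times 1 is \<open>R\<close> of 1, multiplication by
  \<open>a\<close> raises one exponent at a time. Up to the factor \<open>(k + m)!\<close>,
  \<open>R^k S^m\<close> of 1 is thus the product of all \<open>a - i l\<close> with
  \<open>i < k\<close> and all \<open>a + i l\<close> with \<open>1 \<le> i \<le> m\<close>.\<close>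

lemma a_RS_idm:
  "a \<odot> RS k m (idm n) = sc (of_nat k * l) (RS k m (idm n)) + sc (of_nat (k + m + 1)) (RS (Suc k) m (idm n))"
  "a \<odot> RS k m (idm n) = sc (- (of_nat (Suc m) * l)) (RS k m (idm n)) + sc (of_nat (k + m + 1)) (RS k (Suc m) (idm n))"
proof -
  have "RS k m (a \<odot> idm n) = RS (Suc k) m (idm n)"
    by (simp add: a_def left.RS_R[symmetric] cut_R)
  then have *: "a \<odot> RS k m (idm n) = RS (Suc k) m (idm n) + sc (of_nat k) (RS k (Suc m) (idm n))
      + sc (of_nat m) (RS (Suc k) m (idm n))"
    using left.L_RS[of k m "idm n"] by simp
  show 1: "a \<odot> RS k m (idm n) = sc (of_nat k * l) (RS k m (idm n)) + sc (of_nat (k + m + 1)) (RS (Suc k) m (idm n))"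
    by (simp add: * left.RS_Suc_right sc.scale_left_distrib sc.scale_right_distrib algebra_simps)
  show "a \<odot> RS k m (idm n) = sc (- (of_nat (Suc m) * l)) (RS k m (idm n)) + sc (of_nat (k + m + 1)) (RS k (Suc m) (idm n))"
    by (simp add: * left.RS_Suc_right sc.scale_left_distrib sc.scale_right_distrib algebra_simps)
qed

definition roots_list :: "nat \<Rightarrow> nat \<Rightarrow> 'a list" where
  "roots_list k m = map (\<lambda>i. of_nat i * l) [0..<k] @ map (\<lambda>i. - (of_nat (Suc i) * l)) [0..<m]"

lemma linear_factors_roots_list:
  "\<exists>c. linear_factors n a (roots_list k m) (idm n) = sc c (RS k m (idm n))"
proof -
  have 1: "\<exists>c. linear_factors n a (map (\<lambda>i. of_nat i * l) [0..<k]) (idm n) = sc c (RS k 0 (idm n))"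
  proof (induction k)
    case 0
    show ?case by (rule exI[of _ 1]) simp
  next
    case (Suc k)
    then obtain c where "linear_factors n a (map (\<lambda>i. of_nat i * l) [0..<k]) (idm n) = sc c (RS k 0 (idm n))"
      by blast
    then have "linear_factors n a (map (\<lambda>i. of_nat i * l) [0..<Suc k]) (idm n)
        = sc c (a \<odot> RS k 0 (idm n) - sc (of_nat k * l) (RS k 0 (idm n)))"
      by (simp add: mm_simps sc.scale_right_diff_distrib sc.scale_left_commute[of c])
    also have "\<dots> = sc (c * of_nat (k + 1)) (RS (Suc k) 0 (idm n))"
      by (simp add: a_RS_idm(1))
    finally show ?case by blast
  qed
  show ?thesis
  proof (induction m)
    case 0
    show ?case using 1 by (simp add: roots_list_def)
  next
    case (Suc m)
    then obtain c where "linear_factors n a (roots_list k m) (idm n) = sc c (RS k m (idm n))" by blast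
    then have "linear_factors n a (roots_list k (Suc m)) (idm n)
        = sc c (a \<odot> RS k m (idm n) - sc (- (of_nat (Suc m) * l)) (RS k m (idm n)))"
      by (simp add: roots_list_def mm_simps sc.scale_right_diff_distrib sc.scale_right_distrib sc.scale_left_commute[of c])
    also have "\<dots> = sc (c * of_nat (k + m + 1)) (RS k (Suc m) (idm n))"
      by (simp add: a_RS_idm(2))
    finally show ?case by blast
  qed
qed

lemma distinct_roots_list:
  assumes "l \<noteq> 0"
  shows "distinct (roots_list k m)"
proof -
  have *: "of_nat i * l \<noteq> - (of_nat (Suc j) * l)" for i j
  proof
    assume "of_nat i * l = - (of_nat (Suc j) * l)"
    then have "of_nat (i + Suc j) * l = 0" by (simp add: distrib_right)
    then show False using assms by (simp del: of_nat_Suc of_nat_add)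
  qed
  have "inj (\<lambda>i. of_nat i * l)" "inj (\<lambda>i. - (of_nat (Suc i) * l))"
    using assms by (auto simp: inj_def)
  then show ?thesis
    using * by (auto simp: roots_list_def distinct_map intro: inj_on_subset simp del: of_nat_Suc)
qed

text \<open>The vanishing of \<open>RS k m (idm n)\<close> is a polynomial equation for
  \<open>a\<close>, with distinct roots since \<open>l\<close> is nonzero. Every matrix is then a
  sum of eigenvectors of left multiplication by \<open>a\<close>, and one summand must escape the
  kernel.\<close>

lemma eigenvector_not_in_kernel:
  assumes l: "l \<noteq> 0" and zero: "RS k m (idm n) = 0" and X: "cut n X = X" "RS i j X \<noteq> 0"
  obtains w c where "cut n w = w" "a \<odot> w = sc c w" "RS i j w \<noteq> 0"
proof -
  obtain c where "linear_factors n a (roots_list k m) (idm n) = sc c (RS k m (idm n))"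
    using linear_factors_roots_list by blast
  then have "linear_factors n a (roots_list k m) (idm n) = 0" by (simp add: zero)
  then have "linear_factors n a (roots_list k m) X = 0"
    using linear_factors_mm[of n a "roots_list k m" "idm n" X] X(1) by simp
  then obtain w where w: "\<forall>c\<in>set (roots_list k m). a \<odot> w c = sc c (w c)" "X = (\<Sum>c\<in>set (roots_list k m). w c)"
    using eigenvector_decomposition[OF distinct_roots_list[OF l]] by blast
  have "RS i j X = (\<Sum>c\<in>set (roots_list k m). RS i j (cut n (w c)))"
    by (subst X(1)[symmetric], subst w(2)) (simp add: cut_sum left.RS_sum)
  with X(2) obtain c where c: "c \<in> set (roots_list k m)" "RS i j (cut n (w c)) \<noteq> 0"
    by (metis (no_types, lifting) sum.neutral)
  have "a \<odot> cut n (w c) = cut n (a \<odot> w c)" by (simp add: cut_mm)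
  also have "\<dots> = sc c (cut n (w c))" using w(1) c(1) by (simp add: cut_sc)
  finally show thesis using that[of "cut n (w c)" c] c by simp
qed

lemma diagonalise:
  assumes l: "l \<noteq> 0" and n: "n \<le> k" and zero: "\<And>X. cut n X = X \<Longrightarrow> RS k m X = 0"
    and top: "\<exists>X. cut n X = X \<and> RS (k - 1) m X \<noteq> 0" and "n \<ge> 1"
  obtains c P Q where "k = n" "cut n P = P" "cut n Q = Q" "P \<odot> Q = idm n" "Q \<odot> P = idm n"
    "a \<odot> P = P \<odot> diag_mat n (\<lambda>i. c + of_nat i * l)"
proof -
  obtain X where X: "cut n X = X" "RS (k - 1) m X \<noteq> 0" using top by blast
  obtain w c where w: "cut n w = w" "a \<odot> w = sc c w" "RS (k - 1) m w \<noteq> 0"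
    using eigenvector_not_in_kernel[OF l zero[OF cut_idm] X] by blast
  have "\<exists>x. cut n x = x \<and> x \<noteq> 0 \<and> a \<odot> x = sc (c + of_nat j * l) x" if j: "j < k" for j
  proof -
    obtain b where b: "a \<odot> (\<Sum>t<k - j. sc (b t) (RS (j + t) m w)) = sc (c + of_nat j * l) (\<Sum>t<k - j. sc (b t) (RS (j + t) m w))"
      "(\<Sum>t<k - j. sc (b t) (RS (j + t) m w)) \<noteq> 0"
      using left.eigenvector_chain[OF l w(2,3) zero[OF w(1)] j] by blast
    show ?thesis
      by (rule exI[of _ "\<Sum>t<k - j. sc (b t) (RS (j + t) m w)"])
        (use b w(1) in \<open>simp add: cut_sum cut_sc cut_RS\<close>)
  qed
  then obtain x where x: "\<And>j. j < k \<Longrightarrow> cut n (x j) = x j" "\<And>j. j < k \<Longrightarrow> x j \<noteq> 0"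
    "\<And>j. j < k \<Longrightarrow> a \<odot> x j = sc (c + of_nat j * l) (x j)"
    by metis
  have "\<exists>s. \<exists>r<n. ent (x j) r s \<noteq> 0" if "j < k" for j
    using x(1,2)[OF that] by (metis cut_apply ent_arith(1) imat_eqI)
  \<comment> \<open>The columns of \<open>x j\<close> are eigenvectors of \<open>a\<close> or zero;
    \<open>s j\<close> selects a nonzero one, which becomes column \<open>j\<close> of the
    conjugating matrix.\<close>
  then obtain s where s: "\<And>j. j < k \<Longrightarrow> \<exists>r<n. ent (x j) r (s j) \<noteq> 0" by metis
  define P where "P = cut n (IMat (\<lambda>r j. ent (x j) r (s j)))"
  have P: "cut n P = P" by (simp add: P_def)
  let ?D = "diag_mat n (\<lambda>i. c + of_nat i * l)"
  have aP: "a \<odot> P = P \<odot> ?D"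
  proof (rule imat_eqI)
    fix i j
    show "ent (a \<odot> P) i j = ent (P \<odot> ?D) i j"
    proof (cases "i < n \<and> j < n")
      case True
      then have "ent (a \<odot> P) i j = ent (a \<odot> x j) i (s j)"
        by (simp add: mm_apply P_def cut_apply)
      also have "\<dots> = (c + of_nat j * l) * ent (x j) i (s j)"
        using x(3)[of j] True n by simp
      finally show ?thesis using True by (simp add: mm_diag_mat_right P_def cut_apply)
    next
      case False
      have "ent (a \<odot> P) i j = ent (cut n (a \<odot> P)) i j" "ent (P \<odot> ?D) i j = ent (cut n (P \<odot> ?D)) i j"
        by (simp_all add: cut_mm P)
      then show ?thesis using False by (auto simp: cut_apply)
    qed
  qed
  have inj: "inj_on (\<lambda>i. c + of_nat i * l) {..<n}"
    using l by (auto simp: inj_on_def)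
  have ker: "v j = 0" if v: "\<And>i. i < n \<Longrightarrow> (\<Sum>k<n. ent P i k * v k) = 0" and j: "j < n" for v j
  proof -
    \<comment> \<open>The column \<open>s j\<close> scaled by \<open>v j\<close> is stored in column
      0 of a matrix, so that a linear relation between columns becomes one between the matrix
      eigenvectors of \<open>independent_eigenvectors\<close>.\<close>
    define y where "y j = IMat (\<lambda>r q. if r < n \<and> q = 0 then ent (x j) r (s j) * v j else 0)" for j
    have "a \<odot> y j = sc (c + of_nat j * l) (y j)" if "j < n" for j
    proof (rule imat_eqI)
      fix r q
      have "ent (a \<odot> x j) r (s j) = (c + of_nat j * l) * ent (x j) r (s j)"
        using x(3)[of j] that n by simp
      moreover have "ent (a \<odot> y j) r q = (if q = 0 then ent (a \<odot> x j) r (s j) * v j else 0)"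
        by (simp add: mm_apply y_def sum_distrib_right mult.assoc)
      moreover have "ent (a \<odot> x j) r (s j) = 0" if "\<not> r < n"
        using that by (subst cut_a[symmetric]) (simp add: mm_apply cut_apply del: cut_a)
      ultimately show "ent (a \<odot> y j) r q = ent (sc (c + of_nat j * l) (y j)) r q"
        by (auto simp: y_def)
    qed
    note y_eigen = this
    have y_sum: "(\<Sum>j<n. y j) = 0"
    proof (rule imat_eqI)
      fix r q
      have "(\<Sum>j<n. ent (y j) r q) = (if r < n \<and> q = 0 then \<Sum>j<n. ent P r j * v j else 0)"
        by (auto simp: y_def P_def cut_apply)
      then show "ent (\<Sum>j<n. y j) r q = ent 0 r q" using v by simp
    qed
    have "y j = 0"
      by (rule independent_eigenvectors[OF finite_lessThan inj y_eigen y_sum]) (use j in auto)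
    moreover obtain r where "r < n" "ent (x j) r (s j) \<noteq> 0" using s[of j] j n by auto
    ultimately have "ent (y j) r 0 = 0" by simp
    then show ?thesis using \<open>r < n\<close> \<open>ent (x j) r (s j) \<noteq> 0\<close> by (simp add: y_def)
  qed
  obtain Q where Q: "cut n Q = Q" "P \<odot> Q = idm n" "Q \<odot> P = idm n"
    by (rule imat_inverse[OF P]) (rule ker, assumption+)
  \<comment> \<open>A longer chain would provide the further eigenvalue \<open>c + n l\<close>,
    which is not among the diagonal entries of the conjugate of \<open>a\<close>.\<close>
  have "k = n"
  proof (rule ccontr)
    assume "k \<noteq> n"
    with n have "n < k" by simp
    have "?D \<odot> (Q \<odot> x n) = (Q \<odot> (P \<odot> ?D)) \<odot> (Q \<odot> x n)"
      by (simp add: mm_assoc[symmetric] Q)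
    also have "\<dots> = Q \<odot> (a \<odot> ((P \<odot> Q) \<odot> x n))" by (simp add: aP[symmetric] mm_assoc)
    also have "\<dots> = sc (c + of_nat n * l) (Q \<odot> x n)"
      using x(1,3)[OF \<open>n < k\<close>] by (simp add: Q mm_simps)
    finally have *: "?D \<odot> (Q \<odot> x n) = sc (c + of_nat n * l) (Q \<odot> x n)" .
    have "Q \<odot> x n = 0"
    proof (rule imat_eqI)
      fix i j
      show "ent (Q \<odot> x n) i j = ent 0 i j"
      proof (cases "i < n")
        case True
        have "ent (?D \<odot> (Q \<odot> x n)) i j = ent (sc (c + of_nat n * l) (Q \<odot> x n)) i j" by (simp add: *)
        then show ?thesis using True l by (simp add: mm_diag_mat_left)
      next
        case False
        then show ?thesis by (subst Q(1)[symmetric]) (simp add: mm_apply cut_apply)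
      qed
    qed
    then have "(P \<odot> Q) \<odot> x n = 0" by (simp add: mm_assoc)
    then show False using x(1,2)[OF \<open>n < k\<close>] by (simp add: Q)
  qed
  then show thesis using that P Q aP by blast
qed

end

section \<open>Nonzero weight: the main diagonal\<close>

lemma binomial_triangular:
  fixes e :: "nat \<Rightarrow> 'a::field_char_0"
  assumes "\<And>k. k < n \<Longrightarrow> (\<Sum>j<n. of_nat (j choose k) * e j) = 0" and "j < n"
  shows "e j = 0"
  using assms(2)
proof (induction "n - j" arbitrary: j rule: less_induct)
  case less
  have "(\<Sum>i<n. of_nat (i choose j) * e i) = (\<Sum>i\<in>{j}. of_nat (i choose j) * e i)"
  proof (rule sum.mono_neutral_right)
    show "\<forall>i\<in>{..<n} - {j}. of_nat (i choose j) * e i = 0"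
    proof
      fix i assume i: "i \<in> {..<n} - {j}"
      show "of_nat (i choose j) * e i = 0"
      proof (cases "i < j")
        case False
        then have "e i = 0" using i less by (intro less.hyps) auto
        then show ?thesis by simp
      qed simp
    qed
  qed (use less in auto)
  then show ?case using assms(1)[OF less.prems] by simp
qed

definition on_diagonal :: "nat \<Rightarrow> nat \<Rightarrow> 'a::field imat \<Rightarrow> bool" where
  "on_diagonal p q X \<longleftrightarrow> (\<forall>i j. ent X i j \<noteq> 0 \<longrightarrow> i + q = j + p)"

text \<open>The last three assumptions say that the minimal polynomial is
  \<open>x^n (x + l)^(n-1)\<close>.\<close>

locale rb_diag = rb_matrix n l R for n and l :: "'a::field_char_0" and R +
  fixes c :: 'a
  assumes l_nonzero: "l \<noteq> 0" and n_pos: "n \<ge> 1"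
    and a_diag: "a = diag_mat n (\<lambda>i. c + of_nat i * l)"
    and RS_zero: "cut n X = X \<Longrightarrow> RS n (n - 1) X = 0"
    and RS_top: "\<exists>X. cut n X = X \<and> RS (n - 1) (n - 1) X \<noteq> 0"
    and RS_top': "n \<ge> 2 \<Longrightarrow> \<exists>X. cut n X = X \<and> RS n (n - 2) X \<noteq> 0"
begin

lemma ent_outside: "cut n X = X \<Longrightarrow> ent X i j \<noteq> 0 \<Longrightarrow> i < n \<and> j < n"
  by (metis cut_apply)

lemma a_left: "ent (a \<odot> X) i j = (if i < n then (c + of_nat i * l) * ent X i j else 0)"
  by (simp add: a_diag mm_diag_mat_left)

lemma a_right: "ent (X \<odot> a) i j = (if j < n then ent X i j * (c + of_nat j * l) else 0)"
  by (simp add: a_diag mm_diag_mat_right)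

text \<open>The unit is an eigenvector of the commutator with \<open>a\<close> for
  \<open>(p - q) l\<close>, and \<open>R\<close> commutes with that commutator; in characteristic
  zero its eigenspaces are exactly the diagonals.\<close>

lemma R_eu_diagonal: "p < n \<Longrightarrow> q < n \<Longrightarrow> on_diagonal p q (R (eu p q))"
  unfolding on_diagonal_def
proof (intro allI impI)
  fix i j
  assume pq: "p < n" "q < n" and nz: "ent (R (eu p q)) i j \<noteq> 0"
  then have ij: "i < n" "j < n" using ent_outside[OF cut_R] by auto
  have "a \<odot> eu p q - eu p q \<odot> a = sc ((of_nat p - of_nat q) * l) (eu p q)"
    using pq by (auto simp: imat_eq_iff a_left a_right eu_apply algebra_simps)
  then have "ent (a \<odot> R (eu p q) - R (eu p q) \<odot> a) i j
      = ent (sc ((of_nat p - of_nat q) * l) (R (eu p q))) i j"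
    by (simp add: R_ad R_sc)
  then have "((of_nat i - of_nat j) * l) * ent (R (eu p q)) i j
      = ((of_nat p - of_nat q) * l) * ent (R (eu p q)) i j"
    using ij by (simp add: a_left a_right algebra_simps)
  then have "(of_nat i - of_nat j :: 'a) = of_nat p - of_nat q" using nz l_nonzero by simp
  then have "(of_nat (i + q) :: 'a) = of_nat (j + p)" by (simp add: algebra_simps)
  then show "i + q = j + p" by (simp only: of_nat_eq_iff)
qed

lemma R_diagonal:
  assumes "on_diagonal p q X"
  shows "on_diagonal p q (R X)"
  unfolding on_diagonal_def
proof (intro allI impI)
  fix i j assume "ent (R X) i j \<noteq> 0"
  then have "(\<Sum>r<n. \<Sum>s<n. ent X r s * ent (R (eu r s)) i j) \<noteq> 0"
    by (subst (asm) R_expand) simp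
  then obtain r where r: "r < n" "(\<Sum>s<n. ent X r s * ent (R (eu r s)) i j) \<noteq> 0"
    by (metis (no_types, lifting) lessThan_iff sum.neutral)
  then obtain s where s: "s < n" "ent X r s * ent (R (eu r s)) i j \<noteq> 0"
    by (metis (no_types, lifting) lessThan_iff sum.neutral)
  then have "r + q = s + p" "i + s = j + r"
    using assms R_eu_diagonal[OF r(1) s(1)] by (auto simp: on_diagonal_def)
  then show "i + q = j + p" by linarith
qed

lemma S_diagonal:
  assumes "on_diagonal p q X"
  shows "on_diagonal p q (S X)"
  unfolding on_diagonal_def
proof (intro allI impI)
  fix i j assume "ent (S X) i j \<noteq> 0"
  then have "ent (R X) i j \<noteq> 0 \<or> ent X i j \<noteq> 0" by (auto simp: left.S_def)
  then show "i + q = j + p" using assms R_diagonal[OF assms] by (auto simp: on_diagonal_def)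
qed

lemma RS_diagonal: "on_diagonal p q X \<Longrightarrow> on_diagonal p q (RS k m X)"
proof (induction k)
  case 0
  show ?case
  proof (induction m)
    case 0
    then show ?case using \<open>on_diagonal p q X\<close> by simp
  next
    case (Suc m)
    then show ?case using S_diagonal by (simp add: left.S_RS[symmetric])
  qed
next
  case (Suc k)
  then show ?case using R_diagonal by (simp add: left.R_RS[symmetric])
qed

lemma eu_diagonal: "on_diagonal p q (eu p q)"
  by (auto simp: on_diagonal_def eu_apply)

lemma idm_diagonal: "on_diagonal i i (idm n)"
  by (auto simp: on_diagonal_def idm_apply)

lemma eu_eigen: "p < n \<Longrightarrow> a \<odot> eu p q = sc (c + of_nat p * l) (eu p q)"
  by (auto simp: imat_eq_iff a_left eu_apply)

lemma shift_cancel: "c + of_nat i * l = c + of_nat j * l \<longleftrightarrow> i = j"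
  using l_nonzero by simp

text \<open>Since \<open>R^n S^(n-1)\<close> vanishes, a nonzero value of
  \<open>R^(n-1) S^(n-1)\<close> at the unit \<open>(p, q)\<close> is an eigenvector, which lives in
  row \<open>p + n - 1\<close>. So \<open>p = 0\<close>, and preservation of the diagonal leaves
  only \<open>q = 0\<close>.\<close>

lemma RS_top_eu: "RS (n - 1) (n - 1) (eu 0 0) \<noteq> 0"
proof -
  obtain p q where pq: "p < n" "q < n" "RS (n - 1) (n - 1) (eu p q) \<noteq> 0"
    using RS_top RS_nonzero_unit by metis
  define u where "u = RS (n - 1) (n - 1) (eu p q)"
  obtain i j where ij: "ent u i j \<noteq> 0" using pq(3) by (auto simp: imat_eq_iff u_def)
  then have lt: "i < n" "j < n"
    using ent_outside[of u i j] pq by (auto simp: u_def cut_RS)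
  have "RS (Suc (n - 1)) (n - 1) (eu p q) = 0" using RS_zero[of "eu p q"] pq n_pos by simp
  then have "a \<odot> u = sc (c + of_nat p * l + of_nat (n - 1) * l) u"
    using left.L_RS_eigen(1)[OF eu_eigen[OF pq(1)], of "n - 1" "n - 1" q] by (simp add: u_def)
  then have "(c + of_nat i * l) * ent u i j = (c + of_nat p * l + of_nat (n - 1) * l) * ent u i j"
    using lt by (metis a_left sc_apply)
  then have "c + of_nat i * l = c + of_nat p * l + of_nat (n - 1) * l"
    using ij by (metis mult_right_cancel)
  then have "c + of_nat i * l = c + of_nat (p + (n - 1)) * l"
    by (simp only: of_nat_add distrib_right add.assoc)
  then have "i = p + (n - 1)" by (simp only: shift_cancel)
  moreover have "i + q = j + p"
    using RS_diagonal[OF eu_diagonal] ij by (auto simp: u_def on_diagonal_def)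
  ultimately have "p = 0" "q = 0" using lt by auto
  then show ?thesis using pq(3) by simp
qed

lemma RS_idm_ent:
  assumes "i < n"
  shows "(c + of_nat i * l - of_nat k * l) * ent (RS k m (idm n)) i i
      = of_nat (k + m + 1) * ent (RS (Suc k) m (idm n)) i i"
    and "(c + of_nat i * l + of_nat (Suc m) * l) * ent (RS k m (idm n)) i i
      = of_nat (k + m + 1) * ent (RS k (Suc m) (idm n)) i i"
  subgoal using arg_cong[OF a_RS_idm(1), of "\<lambda>X. ent X i i" k m] assms
    by (simp add: a_left algebra_simps del: of_nat_Suc of_nat_add)
  subgoal using arg_cong[OF a_RS_idm(2), of "\<lambda>X. ent X i i" k m] assms
    by (simp add: a_left algebra_simps del: of_nat_Suc of_nat_add)
  done

lemma RS_idm_persist: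
  assumes "i < n" "ent (RS k m (idm n)) i i = 0" "k \<le> k'" "m \<le> m'"
  shows "ent (RS k' m' (idm n)) i i = 0"
proof -
  have nz: "(of_nat (k + m + 1) :: 'a) \<noteq> 0" for k m
    by (metis Suc_eq_plus1 of_nat_eq_0_iff nat.simps(3))
  have "ent (RS k' m (idm n)) i i = 0"
    using assms(3,2)
  proof (induction k' rule: dec_induct)
    case (step k')
    then have "of_nat (k' + m + 1) * ent (RS (Suc k') m (idm n)) i i = 0"
      using RS_idm_ent(1)[OF assms(1), of k' m] by simp
    then show ?case using nz[of k' m] by (simp del: of_nat_Suc of_nat_add)
  qed simp
  with assms(4) show ?thesis
  proof (induction m' rule: dec_induct)
    case (step m')
    then have "of_nat (k' + m' + 1) * ent (RS k' (Suc m') (idm n)) i i = 0"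
      using RS_idm_ent(2)[OF assms(1), of m' k'] by simp
    then show ?case using nz[of k' m'] by (simp del: of_nat_Suc of_nat_add)
  qed simp
qed

text \<open>Starting from 1, each step of the recursions multiplies the diagonal entry, up to a
  nonzero constant, by \<open>c + i l\<close> minus one of the roots; it can only become zero when
  such a factor does.\<close>

lemma RS_idm_root:
  assumes "i < n" "ent (RS k m (idm n)) i i = 0"
  shows "(\<exists>k'<k. c + of_nat i * l = of_nat k' * l) \<or> (\<exists>m'<m. c + of_nat i * l = - (of_nat (Suc m') * l))"
proof (rule ccontr)
  assume neg: "\<not> ?thesis"
  have nz: "(of_nat (k + m + 1) :: 'a) \<noteq> 0" for k m
    by (metis Suc_eq_plus1 of_nat_eq_0_iff nat.simps(3))
  have 1: "ent (RS k' 0 (idm n)) i i \<noteq> 0" if "k' \<le> k" for k'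
    using that
  proof (induction k')
    case 0
    then show ?case using assms(1) by (simp add: idm_apply)
  next
    case (Suc k')
    have "c + of_nat i * l - of_nat k' * l \<noteq> 0" using neg Suc.prems by auto
    then show ?case using RS_idm_ent(1)[OF assms(1), of k' 0] Suc by auto
  qed
  have "ent (RS k m' (idm n)) i i \<noteq> 0" if "m' \<le> m" for m'
    using that
  proof (induction m')
    case 0
    then show ?case using 1 by simp
  next
    case (Suc m')
    have "c + of_nat i * l + of_nat (Suc m') * l \<noteq> 0"
      using neg Suc.prems by (auto simp: add_eq_0_iff2 simp del: of_nat_Suc)
    then show ?case using RS_idm_ent(2)[OF assms(1), of m' k] Suc by auto
  qed
  then show False using assms(2) by blast
qed

text \<open>The kernel of \<open>R\<^sup>k S\<^sup>m\<close> is closed under multiplication by \<open>a\<close>, and every \<open>e\<^sub>i\<^sub>i\<close> is a polynomial in \<open>a\<close>.\<close>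

lemma RS_kernel_eu:
  assumes "RS k m (idm n) = 0" "i < n"
  shows "RS k m (eu i i) = 0"
proof -
  define cs where "cs = map (\<lambda>j. c + of_nat j * l) (filter (\<lambda>j. j \<noteq> i) [0..<n])"
  have ker: "RS k m (linear_factors n a ds X) = 0" if "RS k m X = 0" for ds X
    using that
    by (induction ds arbitrary: X) (simp_all add: left.RS_diff left.RS_scale left.RS_kernel_L)
  have ent: "ent (linear_factors n a ds X) r s = prod_list (map (\<lambda>d. c + of_nat r * l - d) ds) * ent X r s"
    if "r < n" for ds X r s
    using that by (induction ds arbitrary: X) (simp_all add: a_left algebra_simps)
  have out: "ent (linear_factors n a ds X) r s = 0" if "\<not> r < n" "ent X r s = 0" for ds X r s
    using that(2) by (induction ds arbitrary: X) (simp_all add: a_left that(1))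
  have "linear_factors n a cs (idm n) = sc (prod_list (map (\<lambda>d. c + of_nat i * l - d) cs)) (eu i i)"
  proof (rule imat_eqI)
    fix r s
    show "ent (linear_factors n a cs (idm n)) r s
        = ent (sc (prod_list (map (\<lambda>d. c + of_nat i * l - d) cs)) (eu i i)) r s"
    proof (cases "r < n")
      case True
      have "prod_list (map (\<lambda>d. c + of_nat r * l - d) cs) = 0" if "r \<noteq> i"
        using that True unfolding prod_list_zero_iff by (auto simp: cs_def)
      then show ?thesis using True assms(2) by (auto simp: ent idm_apply eu_apply)
    next
      case False
      then show ?thesis using assms(2) by (auto simp: out idm_apply eu_apply)
    qed
  qed
  moreover have "prod_list (map (\<lambda>d. c + of_nat i * l - d) cs) \<noteq> 0"
    unfolding prod_list_zero_iff using l_nonzero by (auto simp: cs_def)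
  ultimately show ?thesis using ker[OF assms(1), of cs] by (simp add: left.RS_scale)
qed

text \<open>Because \<open>R^n S^(n-1)\<close> kills 1, each \<open>c + i l\<close> is one of
  \<open>-(n-1) l, ..., (n-1) l\<close>. Rows 0 and \<open>n - 1\<close> give
  \<open>c = - s l\<close> with \<open>0 \<le> s < n\<close>. For \<open>s > 0\<close> already
  \<open>R^(n-s) S^s\<close> kills 1, hence every diagonal unit, against
  \<open>RS_top_eu\<close>.\<close>

lemma c_zero: "c = 0"
proof -
  have "RS n (n - 1) (idm n) = 0" by (rule RS_zero) simp
  then have z: "ent (RS n (n - 1) (idm n)) i i = 0" for i by simp
  have "0 < n" using n_pos by simp
  from RS_idm_root[OF this z] have "\<exists>s<n. c = - (of_nat s * l)"
  proof (elim disjE exE conjE)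
    fix k assume k: "k < n" "c + of_nat 0 * l = of_nat k * l"
    have "n - 1 < n" using n_pos by simp
    from RS_idm_root[OF this z] have "k = 0"
    proof (elim disjE exE conjE)
      fix k' assume "k' < n" "c + of_nat (n - 1) * l = of_nat k' * l"
      moreover have "c = of_nat k * l" using k by simp
      ultimately have "of_nat (k + (n - 1)) * l = of_nat k' * l"
        by (simp only: of_nat_add distrib_right)
      then have "k + (n - 1) = k'" using l_nonzero by (metis mult_right_cancel of_nat_eq_iff)
      then show ?thesis using \<open>k' < n\<close> by simp
    next
      fix m' assume "c + of_nat (n - 1) * l = - (of_nat (Suc m') * l)"
      moreover have "c = of_nat k * l" using k by simp
      ultimately have "of_nat (k + (n - 1) + Suc m') * l = 0"
        by (simp only: of_nat_add distrib_right left_minus)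
      then show ?thesis using l_nonzero by (simp del: of_nat_Suc of_nat_add)
    qed
    with k show ?thesis using n_pos by (intro exI[of _ 0]) simp
  next
    fix m assume "m < n - 1" "c + of_nat 0 * l = - (of_nat (Suc m) * l)"
    then show ?thesis by (intro exI[of _ "Suc m"]) auto
  qed
  then obtain s where s: "s < n" "c = - (of_nat s * l)" by blast
  \<comment> \<open>Now \<open>c + i l = (i - s) l\<close>. For \<open>i \<ge> s\<close> the factor
    \<open>a - (i - s) l\<close> coming from \<open>R^(n-s)\<close> vanishes in row
    \<open>i\<close>, otherwise the factor \<open>a + (s - i) l\<close> coming from
    \<open>S^s\<close>.\<close>
  have "ent (RS (n - s) s (idm n)) i i = 0" if i: "i < n" for i
  proof (cases "s \<le> i")
    case True
    then have "c + of_nat i * l = of_nat (i - s) * l" using s by (simp add: of_nat_diff algebra_simps)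
    then have "ent (RS (Suc (i - s)) 0 (idm n)) i i = 0"
      using RS_idm_ent(1)[OF i, of "i - s" 0] by (simp del: of_nat_Suc of_nat_add)
    then show ?thesis by (rule RS_idm_persist[OF i]) (use True i s in auto)
  next
    case False
    then obtain t where t: "s = i + Suc t" using less_imp_Suc_add[of i s] by auto
    have "c + of_nat i * l + of_nat (Suc t) * l = 0" using s(2) t by (simp add: algebra_simps)
    then have "ent (RS 0 (Suc t) (idm n)) i i = 0"
      using RS_idm_ent(2)[OF i, of t 0] by (simp del: of_nat_Suc of_nat_add)
    then show ?thesis by (rule RS_idm_persist[OF i]) (use t in auto)
  qed
  moreover have "on_diagonal 0 0 (RS (n - s) s (idm n))" by (intro RS_diagonal idm_diagonal)
  moreover have "cut n (RS (n - s) s (idm n)) = RS (n - s) s (idm n)" by (simp add: cut_RS)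
  ultimately have "RS (n - s) s (idm n) = 0"
    by (intro imat_eqI) (metis add_0_right ent_arith(1) ent_outside on_diagonal_def)
  then have *: "RS (n - s) s (eu 0 0) = 0" using RS_kernel_eu n_pos by simp
  have "s = 0"
  proof (rule ccontr)
    assume "s \<noteq> 0"
    then have "RS (n - 1) (n - 1) (eu 0 0) = RS (s - 1) (n - 1 - s) (RS (n - s) s (eu 0 0))"
      using s by (simp add: left.RS_RS)
    then show False using RS_top_eu * by simp
  qed
  then show ?thesis using s by simp
qed

lemma RS_n_diag: "i < n \<Longrightarrow> RS n m (eu i i) = 0"
proof -
  assume i: "i < n"
  have "ent (RS n 0 (idm n)) j j = 0" if "j < n" for j
  proof -
    have "ent (RS (Suc j) 0 (idm n)) j j = 0"
      using RS_idm_ent(1)[OF that, of j 0] by (simp add: c_zero del: of_nat_Suc of_nat_add)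
    then show ?thesis by (rule RS_idm_persist[OF that]) (use that in auto)
  qed
  moreover have "on_diagonal 0 0 (RS n 0 (idm n))" by (intro RS_diagonal idm_diagonal)
  moreover have "cut n (RS n 0 (idm n)) = RS n 0 (idm n)" by (simp add: cut_RS)
  ultimately have "RS n 0 (idm n) = 0"
    by (intro imat_eqI) (metis add_0_right ent_arith(1) ent_outside on_diagonal_def)
  then have "RS 0 m (RS n 0 (eu i i)) = 0" using RS_kernel_eu i by simp
  then show ?thesis by (simp add: left.RS_RS)
qed

text \<open>For \<open>c = 0\<close> the product of the factors \<open>a - i l\<close> becomes a
  falling factorial in each diagonal entry.\<close>

lemma RS_power_idm: "i < n \<Longrightarrow> ent (RS k 0 (idm n)) i i = l ^ k * of_nat (i choose k)"
proof (induction k)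
  case 0
  then show ?case by (simp add: idm_apply)
next
  case (Suc k)
  have *: "(of_nat i - of_nat k) * of_nat (i choose k) = (of_nat (Suc k) * of_nat (i choose Suc k) :: 'a)"
  proof (cases "k \<le> i")
    case True
    have "(i - k) * (i choose k) = Suc k * (i choose Suc k)"
      using binomial_absorb_comp[of i k] binomial_absorption[of k "i"] True
      by (metis Suc_times_binomial_eq binomial_absorption mult.commute)
    then show ?thesis using True by (metis of_nat_diff of_nat_mult)
  qed (simp add: binomial_eq_0)
  have "of_nat (Suc k) * ent (RS (Suc k) 0 (idm n)) i i = (of_nat i * l - of_nat k * l) * (l ^ k * of_nat (i choose k))"
    using RS_idm_ent(1)[OF Suc.prems, of k 0] Suc by (simp add: c_zero del: of_nat_Suc)
  also have "\<dots> = l ^ Suc k * ((of_nat i - of_nat k) * of_nat (i choose k))"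
    by (simp add: algebra_simps)
  also have "\<dots> = of_nat (Suc k) * (l ^ Suc k * of_nat (i choose Suc k))"
    unfolding * by (simp only: ac_simps)
  finally show ?case by (simp only: mult_cancel_left of_nat_eq_0_iff) simp
qed

text \<open>Applying \<open>R\<close> to the diagonal matrix \<open>R^k(1)\<close>, whose entries
  are binomial coefficients times \<open>l^k\<close>, gives one equation for each
  \<open>k < n\<close>. By the hockey-stick identity the claimed values satisfy the same equations,
  and the binomial system has only one solution.\<close>

lemma R_eu_diag:
  assumes "j < n" "i < n"
  shows "ent (R (eu j j)) i i = (if j < i then l else 0)"
proof -
  define e where "e j = ent (R (eu j j)) i i - (if j < i then l else 0)" for j
  have "(\<Sum>j<n. of_nat (j choose k) * e j) = 0" if k: "k < n" for k
  proof -
    define X where "X = RS k 0 (idm n)"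
    have X: "on_diagonal 0 0 X" by (simp add: X_def RS_diagonal idm_diagonal)
    have "l ^ Suc k * of_nat (i choose Suc k) = ent (R X) i i"
      unfolding X_def left.R_RS using RS_power_idm[OF assms(2)] by simp
    also have "\<dots> = (\<Sum>p<n. \<Sum>q<n. ent X p q * ent (R (eu p q)) i i)"
      by (subst R_expand) simp
    also have "\<dots> = (\<Sum>p<n. \<Sum>q<n. if q = p then ent X p p * ent (R (eu p p)) i i else 0)"
      using X by (intro sum.cong refl) (auto simp: on_diagonal_def)
    also have "\<dots> = (\<Sum>p<n. ent X p p * ent (R (eu p p)) i i)" by simp
    also have "\<dots> = l ^ k * (\<Sum>p<n. of_nat (p choose k) * ent (R (eu p p)) i i)"
      by (simp add: X_def RS_power_idm sum_distrib_left mult.assoc)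
    finally have 1: "l * of_nat (i choose Suc k) = (\<Sum>p<n. of_nat (p choose k) * ent (R (eu p p)) i i)"
      using l_nonzero by simp
    have "(\<Sum>p<i. p choose k) = i choose Suc k"
      using sum_choose_upper[of k "i - 1"] by (cases i) (simp_all add: lessThan_Suc_atMost)
    then have "l * of_nat (i choose Suc k) = l * of_nat (\<Sum>p<i. p choose k)" by simp
    also have "\<dots> = (\<Sum>p<i. of_nat (p choose k) * l)"
      by (simp add: sum_distrib_left mult.commute)
    also have "\<dots> = (\<Sum>p<n. of_nat (p choose k) * (if p < i then l else 0))"
      using assms(2) by (intro sum.mono_neutral_cong_left) auto
    finally show ?thesis using 1 by (simp add: e_def right_diff_distrib sum_subtractf)
  qed
  then have "e j = 0" using binomial_triangular assms(1) by blast
  then show ?thesis by (simp add: e_def)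
qed

text \<open>A nonzero value of \<open>R^n S^(n-2)\<close> is killed by \<open>S\<close>, which fixes
  its row as \<open>p - (n - 2)\<close>. Hence \<open>p\<close> and, along the diagonal,
  \<open>q\<close> are at least \<open>n - 2\<close>; \<open>p = q\<close> is excluded because
  \<open>R^n\<close> kills the diagonal units.\<close>

lemma superdiagonal_or_subdiagonal:
  assumes n: "n \<ge> 2"
  shows "RS n (n - 2) (eu (n - 2) (n - 1)) \<noteq> 0 \<or> RS n (n - 2) (eu (n - 1) (n - 2)) \<noteq> 0"
proof -
  obtain p q where pq: "p < n" "q < n" "RS n (n - 2) (eu p q) \<noteq> 0"
    using RS_top'[OF n] RS_nonzero_unit by metis
  define u where "u = RS n (n - 2) (eu p q)"
  obtain i j where ij: "ent u i j \<noteq> 0" using pq(3) by (auto simp: imat_eq_iff u_def)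
  then have lt: "i < n" "j < n"
    using ent_outside[of u i j] pq by (auto simp: u_def cut_RS)
  have "RS n (Suc (n - 2)) (eu p q) = 0"
  proof -
    have "Suc (n - 2) = n - 1" using n by simp
    then show ?thesis using RS_zero[of "eu p q"] pq by simp
  qed
  then have "a \<odot> u = sc (c + of_nat p * l - of_nat (n - 2) * l) u"
    using left.L_RS_eigen(2)[OF eu_eigen[OF pq(1)], of n "n - 2" q] by (simp add: u_def)
  then have "(c + of_nat i * l) * ent u i j = (c + of_nat p * l - of_nat (n - 2) * l) * ent u i j"
    using lt by (metis a_left sc_apply)
  then have "c + of_nat i * l = c + of_nat p * l - of_nat (n - 2) * l"
    using ij by (metis mult_right_cancel)
  then have "c + of_nat (i + (n - 2)) * l = c + of_nat p * l"
    by (simp only: of_nat_add distrib_right add.assoc[symmetric] diff_add_cancel)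
  then have "i + (n - 2) = p" by (simp only: shift_cancel)
  moreover have "i + q = j + p"
    using RS_diagonal[OF eu_diagonal] ij by (auto simp: u_def on_diagonal_def)
  ultimately have "p = n - 2 \<or> p = n - 1" "q = n - 2 \<or> q = n - 1" using lt pq by auto
  moreover have "p \<noteq> q" using pq RS_n_diag by metis
  ultimately show ?thesis using pq(3) n by auto
qed

end

section \<open>Nonzero weight: the other diagonals\<close>

lemma mat_iso_idm:
  assumes "mat_iso n f g"
  shows "f (idm n) = idm n" "g (idm n) = idm n"
proof -
  have *: "g (idm n) = idm n" if "mat_iso n f g" for f g :: "'a imat \<Rightarrow> 'a imat"
  proof -
    note D = mat_isoD[OF that]
    have e: "g (mm n (f (idm n)) (idm n)) = idm n" by (simp add: D)
    from mat_iso_inverse_mult[OF that] show ?thesis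
    proof (elim disjE conjE)
      assume "\<forall>X Y. g (mm n X Y) = mm n (g X) (g Y)"
      then have "mm n (g (f (idm n))) (g (idm n)) = idm n" using e by metis
      then show ?thesis by (simp add: D)
    next
      assume "\<forall>X Y. g (mm n X Y) = mm n (g Y) (g X)"
      then have "mm n (g (idm n)) (g (f (idm n))) = idm n" using e by metis
      then show ?thesis by (simp add: D)
    qed
  qed
  show "g (idm n) = idm n" using *[OF assms] .
  show "f (idm n) = idm n" using *[OF mat_iso_sym[OF assms]] .
qed

lemma (in rb_matrix) conj_rb_diag:
  assumes iso: "mat_iso n f g" and "l \<noteq> 0" "n \<ge> 1" "f a = diag_mat n (\<lambda>i. c + of_nat i * l)"
    and zero: "\<And>X. cut n X = X \<Longrightarrow> RS n (n - 1) X = 0"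
    and top: "\<exists>X. cut n X = X \<and> RS (n - 1) (n - 1) X \<noteq> 0"
    and top': "n \<ge> 2 \<Longrightarrow> \<exists>X. cut n X = X \<and> RS n (n - 2) X \<noteq> 0"
  shows "rb_diag n l (\<lambda>X. f (R (g X))) c"
proof -
  note D = mat_isoD[OF iso]
  interpret C: rb_matrix n l "\<lambda>X. f (R (g X))" by (rule conj_rb_matrix[OF iso])
  have f0: "f 0 = 0" using D(1)[of 0 0] by simp
  have f_eq: "f X \<noteq> 0" if "cut n X = X" "X \<noteq> 0" for X
  proof
    assume "f X = 0"
    then have "g (f X) = g 0" by simp
    moreover have "g 0 = 0" using D(3)[of 0 0] by simp
    ultimately show False using that by (simp add: D)
  qed
  have ex: "\<exists>X. cut n X = X \<and> C.RS k m X \<noteq> 0" if "\<exists>X. cut n X = X \<and> RS k m X \<noteq> 0" for k m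
  proof -
    obtain X where X: "cut n X = X" "RS k m X \<noteq> 0" using \<open>\<exists>X. cut n X = X \<and> RS k m X \<noteq> 0\<close> by blast
    have "C.RS k m (f X) = f (RS k m X)" using conj_RS[OF iso, of "f X"] X(1) by (simp add: D)
    then show ?thesis using f_eq[OF cut_RS[OF X(1)] X(2)] by (intro exI[of _ "f X"]) (simp add: D)
  qed
  show ?thesis
    by unfold_locales
      (use assms(2,3,4) ex[OF top] ex[OF top'] zero in
        \<open>simp_all add: C.a_def a_def mat_iso_idm[OF iso] conj_RS[OF iso] D f0\<close>)
qed

definition transpose_imat :: "nat \<Rightarrow> 'a::field imat \<Rightarrow> 'a imat" where
  "transpose_imat n X = IMat (\<lambda>i j. if i < n \<and> j < n then ent X j i else 0)"

lemma transpose_imat_apply: "ent (transpose_imat n X) i j = (if i < n \<and> j < n then ent X j i else 0)"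
  by (simp add: transpose_imat_def)

lemma mat_iso_transpose: "mat_iso n (transpose_imat n) (transpose_imat n)"
  unfolding mat_iso_def
  by (auto simp: imat_eq_iff transpose_imat_apply cut_apply mm_apply mult.commute intro!: sum.cong)

lemma mat_iso_diag:
  assumes "\<And>i. d i \<noteq> 0"
  shows "mat_iso n (\<lambda>X. IMat (\<lambda>i j. if i < n \<and> j < n then ent X i j * d j / d i else 0))
    (\<lambda>X. IMat (\<lambda>i j. if i < n \<and> j < n then ent X i j * d i / d j else 0))"
proof -
  let ?f = "\<lambda>X. IMat (\<lambda>i j. if i < n \<and> j < n then ent X i j * d j / d i else 0)"
  have mult: "?f (mm n X Y) = mm n (?f X) (?f Y)" for X Y
  proof (rule imat_eqI)
    fix i j
    have "(\<Sum>k<n. ent X i k * ent Y k j) * d j / d i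
        = (\<Sum>k<n. (ent X i k * d k / d i) * (ent Y k j * d j / d k))"
      unfolding sum_distrib_right sum_divide_distrib using assms by (intro sum.cong) auto
    then show "ent (?f (mm n X Y)) i j = ent (mm n (?f X) (?f Y)) i j"
      by (auto simp: mm_apply)
  qed
  show ?thesis
    unfolding mat_iso_def
    by (intro conjI allI disjI1 mult)
      (use assms in \<open>auto simp: imat_eq_iff cut_apply algebra_simps add_divide_distrib\<close>)
qed

text \<open>\<open>b1_kernel p q i j\<close> is the coefficient of \<open>e\<^sub>i\<^sub>j\<close> in \<open>B\<^sub>1(e\<^sub>p\<^sub>q)\<close>.\<close>

definition b1_kernel :: "nat \<Rightarrow> nat \<Rightarrow> nat \<Rightarrow> nat \<Rightarrow> 'a::field" where
  "b1_kernel p q i j = (if j + p = i + q then if q \<le> p then if p < i then 1 else 0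
    else if i \<le> p then - 1 else 0 else 0)"

definition kernel_operator ::
  "nat \<Rightarrow> (nat \<Rightarrow> nat \<Rightarrow> nat \<Rightarrow> nat \<Rightarrow> 'a) \<Rightarrow> 'a::field imat \<Rightarrow> 'a imat" where
  "kernel_operator n b X = cut n (IMat (\<lambda>i j. \<Sum>p<n. \<Sum>q<n. ent X p q * b p q i j))"

section \<open>The first superdiagonal as a single Jordan chain of S\<close>

definition superdiagonal_below :: "nat \<Rightarrow> 'a::field imat \<Rightarrow> bool" where
  "superdiagonal_below m X \<longleftrightarrow> (\<forall>i j. ent X i j \<noteq> 0 \<longrightarrow> i < m \<and> j = Suc i)"

lemma superdiagonal_below_expand:
  assumes "superdiagonal_below m X"
  shows "X = (\<Sum>i<m. sc (ent X i (Suc i)) (eu i (Suc i)))"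
proof (rule imat_eqI)
  fix r s
  have "(\<Sum>i<m. ent X i (Suc i) * ent (eu i (Suc i)) r s)
      = (\<Sum>i<m. if i = r then if s = Suc r then ent X r s else 0 else 0)"
    by (intro sum.cong refl) (auto simp: eu_apply)
  also have "\<dots> = ent X r s" using assms by (auto simp: superdiagonal_below_def)
  finally show "ent X r s = ent (\<Sum>i<m. sc (ent X i (Suc i)) (eu i (Suc i))) r s" by simp
qed

lemma superdiagonal_below_sum:
  assumes "\<And>i. i \<in> A \<Longrightarrow> superdiagonal_below m (f i)"
  shows "superdiagonal_below m (sum f A)"
  unfolding superdiagonal_below_def
proof (intro allI impI)
  fix r s assume "ent (sum f A) r s \<noteq> 0"
  then have "(\<Sum>i\<in>A. ent (f i) r s) \<noteq> 0" by simp
  then obtain i where "i \<in> A" "ent (f i) r s \<noteq> 0" by (rule sum.not_neutral_contains_not_neutral)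
  then show "r < m \<and> s = Suc r" using assms by (auto simp: superdiagonal_below_def)
qed

lemma superdiagonal_below_sc: "superdiagonal_below m X \<Longrightarrow> superdiagonal_below m (sc c X)"
  by (auto simp: superdiagonal_below_def)

lemma superdiagonal_below_diff:
  "superdiagonal_below m X \<Longrightarrow> superdiagonal_below m Y \<Longrightarrow> superdiagonal_below m (X - Y)"
  unfolding superdiagonal_below_def by (metis ent_arith(3) diff_zero diff_self)

lemma superdiagonal_below_mono: "superdiagonal_below m X \<Longrightarrow> m \<le> m' \<Longrightarrow> superdiagonal_below m' X"
  unfolding superdiagonal_below_def by (meson less_le_trans)

locale rb_upper = rb_diag +
  assumes top_upper: "n \<ge> 2 \<Longrightarrow> RS n (n - 2) (eu (n - 2) (n - 1)) \<noteq> 0"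
begin

lemma S_sum: "S (sum f A) = (\<Sum>i\<in>A. S (f i))"
  by (induction A rule: infinite_finite_induct) (simp_all add: left.S_add)

lemma S_power_zero:
  assumes "\<And>i. i < m \<Longrightarrow> superdiagonal_below i (S (eu i (Suc i)))" "superdiagonal_below m X"
  shows "(S ^^ m) X = 0"
  using assms
proof (induction m arbitrary: X)
  case 0
  then show ?case by (auto simp: superdiagonal_below_def imat_eq_iff)
next
  case (Suc m)
  have "S X = (\<Sum>i<Suc m. sc (ent X i (Suc i)) (S (eu i (Suc i))))"
    by (subst superdiagonal_below_expand[OF Suc.prems(2)]) (simp only: S_sum left.S_scale)
  moreover have "superdiagonal_below m \<dots>"
    by (intro superdiagonal_below_sum superdiagonal_below_sc superdiagonal_below_mono[OF Suc.prems(1)]) auto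
  ultimately have "superdiagonal_below m (S X)" by simp
  then show ?case using Suc by (simp add: funpow_swap1)
qed

text \<open>\<open>S\<close> maps \<open>chain (Suc m)\<close> to \<open>chain m\<close> and kills
  \<open>chain 0\<close>; as \<open>m\<close> runs up to \<open>n - 2\<close>, the length
  \<open>n - 1\<close> of this chain is the dimension of the first superdiagonal.\<close>

definition chain :: "nat \<Rightarrow> 'a imat" where "chain m = RS n (n - 2 - m) (eu (n - 2) (n - 1))"

context
  assumes n2: "n \<ge> 2"
begin

lemma eu_corner: "cut n (eu (n - 2) (n - 1)) = eu (n - 2) (n - 1)"
  using n2 by simp

lemma chain_ent: "ent (chain m) i j \<noteq> 0 \<Longrightarrow> i < n - 1 \<and> j = Suc i"
proof -
  assume nz: "ent (chain m) i j \<noteq> 0"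
  have "on_diagonal (n - 2) (n - 1) (chain m)" unfolding chain_def by (intro RS_diagonal eu_diagonal)
  then have "i + (n - 1) = j + (n - 2)" using nz by (auto simp: on_diagonal_def)
  moreover have "cut n (chain m) = chain m" unfolding chain_def by (rule cut_RS[OF eu_corner])
  ultimately show ?thesis using ent_outside[of "chain m" i j] nz n2 by auto
qed

lemma S_chain_0: "S (chain 0) = 0"
proof -
  have "S (chain 0) = RS n (Suc (n - 2)) (eu (n - 2) (n - 1))"
    unfolding chain_def left.S_RS by simp
  moreover have "Suc (n - 2) = n - 1" using n2 by simp
  ultimately show ?thesis using RS_zero[OF eu_corner] by simp
qed

lemma S_chain_Suc: "Suc m \<le> n - 2 \<Longrightarrow> S (chain (Suc m)) = chain m"
  unfolding chain_def left.S_RS by (simp add: Suc_diff_Suc)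

lemma S_power_chain: "m \<le> n - 2 \<Longrightarrow> (S ^^ m) (chain m) = chain 0"
  by (induction m) (simp_all add: funpow_swap1 S_chain_Suc)

lemma chain_0_nonzero: "chain 0 \<noteq> 0"
proof
  assume "chain 0 = 0"
  then show False using top_upper n2 by (simp add: chain_def)
qed

text \<open>In row \<open>i\<close> left multiplication by \<open>a\<close> is the factor
  \<open>i l\<close>, while the relation for the chain supplies the eigenvalue \<open>m l\<close>.
  So outside the support of \<open>S (chain m)\<close> the matrix \<open>chain m\<close> can be
  nonzero only in row \<open>m\<close>.\<close>

lemma chain_eigen:
  assumes "m \<le> n - 2" "i < n"
  shows "(of_nat i - of_nat m) * l * ent (chain m) i j = of_nat (n + (n - 2 - m)) * ent (S (chain m)) i j"
proof -
  have "a \<odot> eu (n - 2) (n - 1) = sc (of_nat (n - 2) * l) (eu (n - 2) (n - 1))"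
    using eu_eigen[of "n - 2" "n - 1"] n2 by (simp add: c_zero)
  from left.L_RS_eigen(2)[OF this, of n "n - 2 - m"]
  have "a \<odot> chain m = sc (of_nat (n - 2) * l - of_nat (n - 2 - m) * l) (chain m)
      + sc (of_nat (n + (n - 2 - m))) (S (chain m))"
    by (simp add: chain_def left.S_RS)
  moreover have "of_nat (n - 2) * l - of_nat (n - 2 - m) * l = of_nat m * l"
  proof -
    have "n - 2 = (n - 2 - m) + m" using assms by simp
    then have "(of_nat (n - 2) :: 'a) = of_nat (n - 2 - m) + of_nat m" by (metis of_nat_add)
    then show ?thesis by (simp add: algebra_simps)
  qed
  ultimately have "ent (a \<odot> chain m) i j = of_nat m * l * ent (chain m) i j
      + of_nat (n + (n - 2 - m)) * ent (S (chain m)) i j" by simp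
  then show ?thesis using assms(2) by (simp add: a_left c_zero algebra_simps)
qed

text \<open>By \<open>chain_eigen\<close>, \<open>chain (Suc m)\<close> can leave the support of
  \<open>chain m\<close> only in row \<open>Suc m\<close>. If that entry is nonzero,
  \<open>S\<close> of the new unit can be solved for, and \<open>S\<close> turns out strictly
  triangular with nonzero entries next to the diagonal.\<close>

lemma chain_triangular:
  assumes "m \<le> n - 2"
  shows "superdiagonal_below (Suc m) (chain m) \<and> ent (chain m) m (Suc m) \<noteq> 0
    \<and> (\<forall>i\<le>m. superdiagonal_below i (S (eu i (Suc i))))
    \<and> (\<forall>i<m. ent (S (eu (Suc i) (Suc (Suc i)))) i (Suc i) \<noteq> 0)"
  using assms
proof (induction m)
  case 0
  have "superdiagonal_below 1 (chain 0)"
    unfolding superdiagonal_below_def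
  proof (intro allI impI)
    fix i j assume nz: "ent (chain 0) i j \<noteq> 0"
    then have ij: "i < n - 1" "j = Suc i" using chain_ent by blast+
    have "of_nat i * l * ent (chain 0) i j = 0"
      using chain_eigen[of 0 i j] ij by (simp add: S_chain_0)
    then show "i < 1 \<and> j = Suc i" using nz l_nonzero ij by simp
  qed
  then have A: "superdiagonal_below (Suc 0) (chain 0)" by simp
  then have eq: "chain 0 = sc (ent (chain 0) 0 (Suc 0)) (eu 0 (Suc 0))"
    using superdiagonal_below_expand[OF A] by simp
  then have B: "ent (chain 0) 0 (Suc 0) \<noteq> 0" using chain_0_nonzero by (metis sc.scale_zero_left)
  have "sc (ent (chain 0) 0 (Suc 0)) (S (eu 0 (Suc 0))) = 0"
    using S_chain_0 eq by (metis left.S_scale)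
  then have "S (eu 0 (Suc 0)) = 0" using B by simp
  then have "superdiagonal_below 0 (S (eu 0 (Suc 0)))" by (simp add: superdiagonal_below_def)
  then show ?case using A B by simp
next
  case (Suc m)
  define y where "y = chain (Suc m)"
  have IH: "superdiagonal_below (Suc m) (chain m)" "ent (chain m) m (Suc m) \<noteq> 0"
    "\<And>i. i \<le> m \<Longrightarrow> superdiagonal_below i (S (eu i (Suc i)))"
    "\<And>i. i < m \<Longrightarrow> ent (S (eu (Suc i) (Suc (Suc i)))) i (Suc i) \<noteq> 0"
    using Suc by auto
  have Sy: "S y = chain m" using S_chain_Suc Suc.prems by (simp add: y_def)
  have A: "superdiagonal_below (Suc (Suc m)) y"
    unfolding superdiagonal_below_def
  proof (intro allI impI)
    fix i j assume nz: "ent y i j \<noteq> 0"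
    then have ij: "i < n - 1" "j = Suc i" using chain_ent unfolding y_def by blast+
    have e: "(of_nat i - of_nat (Suc m)) * l * ent y i j = of_nat (n + (n - 2 - Suc m)) * ent (chain m) i j"
      using chain_eigen[of "Suc m" i j] Suc.prems ij Sy by (simp add: y_def)
    have "i < Suc (Suc m)"
    proof (rule ccontr)
      assume "\<not> i < Suc (Suc m)"
      moreover from this have "ent (chain m) i j = 0"
        using IH(1) unfolding superdiagonal_below_def by (metis less_SucI)
      ultimately have "ent (chain m) i j = 0" "i \<noteq> Suc m" by auto
      with e nz l_nonzero show False by (simp del: of_nat_Suc)
    qed
    with ij show "i < Suc (Suc m) \<and> j = Suc i" by blast
  qed
  \<comment> \<open>Otherwise \<open>y\<close> would lie in the span on which
    \<open>S ^^ Suc m\<close> vanishes, while \<open>S ^^ Suc m\<close> takes \<open>y\<close> to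
    the nonzero \<open>chain 0\<close>.\<close>
  have B: "ent y (Suc m) (Suc (Suc m)) \<noteq> 0"
  proof
    assume z: "ent y (Suc m) (Suc (Suc m)) = 0"
    have "superdiagonal_below (Suc m) y"
      unfolding superdiagonal_below_def
    proof (intro allI impI)
      fix i j assume "ent y i j \<noteq> 0"
      then show "i < Suc m \<and> j = Suc i" using A z unfolding superdiagonal_below_def
        by (metis less_SucE)
    qed
    then have "(S ^^ Suc m) y = 0" by (rule S_power_zero[rotated]) (use IH(3) in auto)
    then show False using S_power_chain[OF Suc.prems] chain_0_nonzero by (simp add: y_def)
  qed
  define z where "z = (\<Sum>i<Suc m. sc (ent y i (Suc i)) (S (eu i (Suc i))))"
  have "chain m = z + sc (ent y (Suc m) (Suc (Suc m))) (S (eu (Suc m) (Suc (Suc m))))"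
    unfolding Sy[symmetric] z_def
    by (subst superdiagonal_below_expand[OF A])
      (simp add: S_sum left.S_add left.S_scale)
  then have eq: "S (eu (Suc m) (Suc (Suc m))) = sc (1 / ent y (Suc m) (Suc (Suc m))) (chain m - z)"
    using B by simp
  have z: "superdiagonal_below m z"
    unfolding z_def
    by (intro superdiagonal_below_sum superdiagonal_below_sc superdiagonal_below_mono[OF IH(3)]) auto
  have C: "superdiagonal_below (Suc m) (S (eu (Suc m) (Suc (Suc m))))"
    unfolding eq by (intro superdiagonal_below_sc superdiagonal_below_diff IH(1)
        superdiagonal_below_mono[OF z]) simp
  have "ent z m (Suc m) = 0" using z by (auto simp: superdiagonal_below_def)
  then have "ent (S (eu (Suc m) (Suc (Suc m)))) m (Suc m) \<noteq> 0"
    unfolding eq using IH(2) B by simp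
  then show ?case using A B C IH(3,4) unfolding y_def by (auto simp: le_Suc_eq less_Suc_eq)
qed

end

lemma S_eu_below: "Suc i < n \<Longrightarrow> superdiagonal_below i (S (eu i (Suc i)))"
  using chain_triangular[of i] by auto

lemma S_eu_subdiagonal: "Suc (Suc i) < n \<Longrightarrow> ent (S (eu (Suc i) (Suc (Suc i)))) i (Suc i) \<noteq> 0"
  using chain_triangular[of "Suc i"] by auto

end

text \<open>\<open>- l\<close> is the value of \<open>l B_1\<close> at these entries. They lie off
  the position of the unit itself, so \<open>S\<close> and \<open>R\<close> agree there.\<close>

locale rb_normalised = rb_upper +
  assumes normalised: "Suc (Suc i) < n \<Longrightarrow> ent (S (eu (Suc i) (Suc (Suc i)))) i (Suc i) = - l"
begin

text \<open>With the entries for smaller \<open>i - j\<close> known, \<open>[L, S] = R S\<close>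
  gives \<open>(j - i + 1) l t = (i - j - 1) l^2\<close> for the entry \<open>t\<close>. The
  coefficient vanishes only for \<open>i = Suc j\<close>, which is the normalised case.\<close>

lemma S_eu_ent:
  assumes "Suc i < n" "j < i"
  shows "ent (S (eu i (Suc i))) j (Suc j) = - l"
  using assms
proof (induction "i - j" arbitrary: i j rule: less_induct)
  case less
  show ?case
  proof (cases "i = Suc j")
    case True
    then show ?thesis using normalised less.prems by simp
  next
    case False
    define T where "T i = S (eu i (Suc i))" for i
    have "a \<odot> eu i (Suc i) = sc (of_nat i * l) (eu i (Suc i))"
      using eu_eigen[of i "Suc i"] less.prems by (simp add: c_zero)
    then have "a \<odot> T i = sc (of_nat i * l) (T i) + R (T i)"
      using left.L_RS[of 0 1 "eu i (Suc i)"]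
      by (simp add: T_def left.RS_def left.S_scale)
    then have "a \<odot> T i = sc (of_nat i * l) (T i) + (S (T i) - sc l (T i))"
      by (simp add: left.S_def)
    then have "ent (a \<odot> T i) j (Suc j) = of_nat i * l * ent (T i) j (Suc j)
        + (ent (S (T i)) j (Suc j) - l * ent (T i) j (Suc j))" by simp
    then have 1: "(of_nat j - of_nat i + 1) * l * ent (T i) j (Suc j) = ent (S (T i)) j (Suc j)"
      using less.prems by (simp add: a_left c_zero algebra_simps)
    have "S (T i) = (\<Sum>s<i. sc (ent (T i) s (Suc s)) (T s))"
      by (subst superdiagonal_below_expand[OF S_eu_below[OF less.prems(1)], folded T_def])
        (simp only: S_sum left.S_scale T_def)
    then have "ent (S (T i)) j (Suc j) = (\<Sum>s<i. ent (T i) s (Suc s) * ent (T s) j (Suc j))" by simp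
    also have "\<dots> = (\<Sum>s\<in>{j<..<i}. ent (T i) s (Suc s) * ent (T s) j (Suc j))"
    proof (rule sum.mono_neutral_right)
      show "\<forall>s\<in>{..<i} - {j<..<i}. ent (T i) s (Suc s) * ent (T s) j (Suc j) = 0"
      proof
        fix s assume "s \<in> {..<i} - {j<..<i}"
        then have "s \<le> j" "Suc s < n" using less.prems by auto
        then have "ent (T s) j (Suc j) = 0"
          using S_eu_below[of s] unfolding superdiagonal_below_def T_def by (meson leD)
        then show "ent (T i) s (Suc s) * ent (T s) j (Suc j) = 0" by simp
      qed
    qed auto
    also have "\<dots> = (\<Sum>s\<in>{j<..<i}. l * l)"
    proof (rule sum.cong[OF refl])
      fix s assume s: "s \<in> {j<..<i}"
      then have "ent (T i) s (Suc s) = - l" "ent (T s) j (Suc j) = - l"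
        unfolding T_def using less.prems by (auto intro!: less.hyps)
      then show "ent (T i) s (Suc s) * ent (T s) j (Suc j) = l * l" by simp
    qed
    also have "\<dots> = of_nat (i - Suc j) * (l * l)" by simp
    also have "(of_nat (i - Suc j) :: 'a) = - (of_nat j - of_nat i + 1)"
      using less.prems by (simp add: of_nat_diff)
    finally have "(of_nat j - of_nat i + 1) * l * ent (T i) j (Suc j) = (of_nat j - of_nat i + 1) * l * (- l)"
      using 1 by (simp add: algebra_simps)
    moreover have "(of_nat j - of_nat i + 1 :: 'a) \<noteq> 0"
    proof
      assume "(of_nat j - of_nat i + 1 :: 'a) = 0"
      then have "(of_nat (Suc j) :: 'a) = of_nat i" by (simp add: algebra_simps)
      then show False using False by (simp only: of_nat_eq_iff)
    qed
    ultimately have "ent (T i) j (Suc j) = - l"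
      using l_nonzero by (metis mult_eq_0_iff mult_left_cancel)
    then show ?thesis by (simp add: T_def)
  qed
qed

section \<open>Propagation from the superdiagonal to both triangles\<close>

definition upper_band :: "nat \<Rightarrow> nat \<Rightarrow> 'a imat" where
  "upper_band d i = IMat (\<lambda>p q. if p \<le> i \<and> q = p + d then 1 else 0)"

lemma upper_band_apply: "ent (upper_band d i) p q = (if p \<le> i \<and> q = p + d then 1 else 0)"
  by (simp add: upper_band_def)

lemma R_superdiagonal:
  assumes "Suc i < n"
  shows "R (eu i (Suc i)) = sc (- l) (upper_band 1 i)"
proof (rule imat_eqI)
  fix p q
  have R: "R X = S X - sc l X" for X by (simp add: left.S_def)
  have "ent (S (eu i (Suc i))) p q = (if p < i \<and> q = Suc p then - l else 0)"
    using S_eu_below[OF assms] S_eu_ent[OF assms, of p] by (auto simp: superdiagonal_below_def)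
  then show "ent (R (eu i (Suc i))) p q = ent (sc (- l) (upper_band 1 i)) p q"
    by (auto simp: R eu_apply upper_band_apply)
qed

text \<open>A unit further up is the product of one on the previous diagonal and one on the
  superdiagonal. For these factors the three terms inside \<open>R\<close> are \<open>- l\<close>,
  \<open>- l\<close> and \<open>l\<close> times that unit, so the identity determines
  \<open>R\<close> on it.\<close>

lemma R_upper:
  assumes "i + Suc d < n"
  shows "R (eu i (i + Suc d)) = sc (- l) (upper_band (Suc d) i)"
  using assms
proof (induction d)
  case 0
  then show ?case using R_superdiagonal by simp
next
  case (Suc d)
  let ?X = "eu i (i + Suc d)" and ?Y = "eu (i + Suc d) (Suc (i + Suc d))"
  have X: "R ?X = sc (- l) (upper_band (Suc d) i)" using Suc by simp
  have Y: "R ?Y = sc (- l) (upper_band 1 (i + Suc d))" using R_superdiagonal Suc.prems by simp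
  have 1: "R ?X \<odot> ?Y = sc (- l) (eu i (i + Suc (Suc d)))"
    unfolding X using Suc.prems by (auto simp: mm_simps imat_eq_iff mm_eu_right upper_band_apply eu_apply)
  have 2: "?X \<odot> R ?Y = sc (- l) (eu i (i + Suc (Suc d)))"
    unfolding Y using Suc.prems by (auto simp: mm_simps imat_eq_iff mm_eu_left upper_band_apply eu_apply)
  have 3: "?X \<odot> ?Y = eu i (i + Suc (Suc d))"
    using Suc.prems by (auto simp: imat_eq_iff mm_eu_left eu_apply)
  have "sc (l * l) (upper_band (Suc d) i \<odot> upper_band 1 (i + Suc d)) = R ?X \<odot> R ?Y"
    unfolding X Y by (simp add: mm_simps)
  also have "\<dots> = sc (- l) (R (eu i (i + Suc (Suc d))))"
    unfolding RB 1 2 3 by (simp add: R_add R_sc left.R_minus sc.scale_minus_left)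
  also have "upper_band (Suc d) i \<odot> upper_band 1 (i + Suc d) = upper_band (Suc (Suc d)) i"
  proof (rule imat_eqI)
    fix p q
    have "(\<Sum>k<n. ent (upper_band (Suc d) i) p k * ent (upper_band 1 (i + Suc d)) k q)
        = (\<Sum>k<n. if k = p + Suc d then if p \<le> i \<and> q = p + Suc (Suc d) then 1 else 0 else 0)"
      by (intro sum.cong refl) (auto simp: upper_band_apply)
    also have "\<dots> = ent (upper_band (Suc (Suc d)) i) p q"
      using Suc.prems by (auto simp: upper_band_apply)
    finally show "ent (upper_band (Suc d) i \<odot> upper_band 1 (i + Suc d)) p q
        = ent (upper_band (Suc (Suc d)) i) p q" by (simp only: mm_apply)
  qed
  finally have "sc (- l) (R (eu i (i + Suc (Suc d)))) = sc (- l) (sc (- l) (upper_band (Suc (Suc d)) i))"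
    by simp
  then show ?case using l_nonzero by (simp only: sc.scale_cancel_left) simp
qed

text \<open>Multiplication by a unit on the opposite diagonal leads to the main diagonal, where
  \<open>R\<close> is known. The unknown entry \<open>rho\<close> appears on the left with factor
  \<open>- l\<close>; on the right it drops out, since \<open>R\<close> of a diagonal unit vanishes
  at the position of that unit.\<close>

lemma R_lower:
  assumes "0 < m" "j + m < n" "p + m < n"
  shows "ent (R (eu (j + m) j)) (p + m) p = (if j < p then l else 0)"
proof -
  let ?X = "eu (j + m) j :: 'a imat" and ?Y = "eu p (p + m) :: 'a imat"
  define rho where "rho = ent (R ?X) (p + m) p"
  have X: "on_diagonal (j + m) j (R ?X)" by (rule R_eu_diagonal) (use assms in auto)
  have Y: "R ?Y = sc (- l) (upper_band m p)"
    using R_upper[of p "m - 1"] assms by simp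
  have 1: "R ?X \<odot> ?Y = sc rho (eu (p + m) (p + m))"
    using X assms by (auto simp: imat_eq_iff mm_eu_right eu_apply rho_def on_diagonal_def)
  have 2: "?X \<odot> R ?Y + sc l (?X \<odot> ?Y) = sc (if j < p then - l else 0) (eu (j + m) (j + m))"
    using assms by (auto simp: Y mm_simps imat_eq_iff mm_eu_left upper_band_apply eu_apply)
  have "ent (R ?X \<odot> R ?Y) (p + m) (p + m) = - l * rho"
  proof -
    have "ent (R ?X \<odot> R ?Y) (p + m) (p + m) = (\<Sum>k<n. if k = p then - l * rho else 0)"
      unfolding mm_apply Y
      by (intro sum.cong refl) (auto simp: upper_band_apply rho_def)
    then show ?thesis using assms by simp
  qed
  moreover have "ent (R ?X \<odot> R ?Y) (p + m) (p + m) = (if j < p then - l else 0) * (if j < p then l else 0)"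
    using assms unfolding RB 1 add.assoc 2 by (simp add: R_add R_sc R_eu_diag)
  ultimately show ?thesis using l_nonzero by (auto simp: rho_def split: if_splits)
qed

lemma R_eu:
  assumes "p < n" "q < n" "i < n" "j < n"
  shows "ent (R (eu p q)) i j = l * b1_kernel p q i j"
proof (cases "j + p = i + q")
  case False
  then show ?thesis
    using R_eu_diagonal[OF assms(1,2)] unfolding on_diagonal_def b1_kernel_def by (metis mult_zero_right)
next
  case diag: True
  show ?thesis
  proof (cases p q rule: linorder_cases)
    case less
    then obtain d where "q = p + Suc d" using less_imp_Suc_add by auto
    then show ?thesis using R_upper[of p d] assms diag by (auto simp: b1_kernel_def upper_band_apply)
  next
    case equal
    then show ?thesis using R_eu_diag[of p i] assms diag by (auto simp: b1_kernel_def)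
  next
    case greater
    define m where "m = p - q"
    then have "p = q + m" "i = j + m" "0 < m" using greater diag by auto
    then show ?thesis using R_lower[of m q j] assms by (auto simp: b1_kernel_def)
  qed
qed

lemma R_eq_kernel_operator: "R X = sc l (kernel_operator n b1_kernel X)"
proof (rule imat_eqI)
  fix i j
  show "ent (R X) i j = ent (sc l (kernel_operator n b1_kernel X)) i j"
  proof (cases "i < n \<and> j < n")
    case True
    have "ent (R X) i j = (\<Sum>p<n. \<Sum>q<n. ent X p q * ent (R (eu p q)) i j)"
      by (subst R_expand) simp
    also have "\<dots> = (\<Sum>p<n. \<Sum>q<n. l * (ent X p q * b1_kernel p q i j))"
      using True by (intro sum.cong refl) (simp add: R_eu)
    finally show ?thesis
      using True by (simp add: kernel_operator_def cut_apply sum_distrib_left)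
  next
    case False
    then show ?thesis using ent_outside[OF cut_R, of X i j]
      by (auto simp: kernel_operator_def cut_apply)
  qed
qed

end

context rb_upper
begin

lemma normalise: "\<exists>f g. mat_iso n f g \<and> rb_normalised n l (\<lambda>X. f (R (g X))) 0"
proof -
  define t where "t i = ent (S (eu (Suc i) (Suc (Suc i)))) i (Suc i)" for i
  \<comment> \<open>Conjugation multiplies \<open>t i\<close> by
    \<open>d (i+1)^2 / (d i d (i+2))\<close>, and the result has to be \<open>- l\<close>. This is a
    second-order recursion for \<open>d\<close>, so \<open>d2\<close> carries two consecutive
    values; \<open>t'\<close> replaces 0 by 1 to keep every \<open>d i\<close> nonzero, also beyond
    the range that matters.\<close>
  define t' where "t' i = (if t i = 0 then 1 else t i)" for i
  define d2 where "d2 = rec_nat (1 :: 'a, 1) (\<lambda>i (x, y). (y, - t' i * y * y / (l * x)))"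
  define d where "d i = fst (d2 i)" for i
  have d2: "d2 (Suc i) = (snd (d2 i), - t' i * snd (d2 i) * snd (d2 i) / (l * fst (d2 i)))" for i
    by (simp add: d2_def split: prod.splits)
  have nz2: "fst (d2 i) \<noteq> 0 \<and> snd (d2 i) \<noteq> 0" for i
  proof (induction i)
    case 0
    show ?case by (simp add: d2_def)
  next
    case (Suc i)
    then show ?case using l_nonzero by (simp add: d2 t'_def)
  qed
  then have nz: "d i \<noteq> 0" for i by (simp add: d_def)
  have dS: "d (Suc (Suc i)) = - t' i * d (Suc i) * d (Suc i) / (l * d i)" for i
    by (simp add: d_def d2)
  define f where "f X = IMat (\<lambda>i j. if i < n \<and> j < n then ent X i j * d j / d i else 0)" for X
  define g where "g X = IMat (\<lambda>i j. if i < n \<and> j < n then ent X i j * d i / d j else 0)" for X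
  have iso: "mat_iso n f g"
    using mat_iso_diag[of d n] nz unfolding f_def g_def by blast
  have fa: "f a = diag_mat n (\<lambda>i. 0 + of_nat i * l)"
    using nz by (auto simp: imat_eq_iff f_def a_diag diag_mat_apply c_zero)
  interpret C: rb_diag n l "\<lambda>X. f (R (g X))" 0
    by (rule conj_rb_diag[OF iso l_nonzero n_pos fa RS_zero RS_top RS_top'])
  have g_eu: "g (eu p q) = sc (d p / d q) (eu p q)" if "p < n" "q < n" for p q
    using that by (auto simp: imat_eq_iff g_def eu_apply)
  have C_RS: "C.RS k m (eu p q) = sc (d p / d q) (f (RS k m (eu p q)))" if "p < n" "q < n" for k m p q
    using conj_RS[OF iso, of "eu p q" k m] that
    by (simp add: g_eu left.RS_scale mat_isoD[OF iso])
  have "rb_normalised n l (\<lambda>X. f (R (g X))) 0"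
  proof unfold_locales
    assume n2: "n \<ge> 2"
    define u where "u = RS n (n - 2) (eu (n - 2) (n - 1))"
    have cu: "cut n u = u" unfolding u_def using n2 by (intro cut_RS) simp
    obtain i j where ij: "ent u i j \<noteq> 0" using top_upper[OF n2] by (auto simp: imat_eq_iff u_def)
    then have "i < n" "j < n" using ent_outside[OF cu] by auto
    then have "ent (f u) i j \<noteq> 0" using ij nz by (simp add: f_def)
    then have "ent (C.RS n (n - 2) (eu (n - 2) (n - 1))) i j \<noteq> 0"
      using n2 nz by (simp add: C_RS u_def)
    then show "C.RS n (n - 2) (eu (n - 2) (n - 1)) \<noteq> 0" by auto
  next
    fix i assume i: "Suc (Suc i) < n"
    have S1: "S X = RS 0 1 X" "C.S X = C.RS 0 1 X" for X by (simp_all add: left.RS_def C.left.RS_def)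
    have ti: "t' i = t i" using S_eu_subdiagonal[OF i] by (simp add: t'_def t_def)
    have "C.S (eu (Suc i) (Suc (Suc i))) = sc (d (Suc i) / d (Suc (Suc i))) (f (S (eu (Suc i) (Suc (Suc i)))))"
      unfolding S1 using i by (intro C_RS) auto
    then have "ent (C.S (eu (Suc i) (Suc (Suc i)))) i (Suc i)
        = d (Suc i) / d (Suc (Suc i)) * (t i * d (Suc i) / d i)"
      using i by (simp add: f_def t_def)
    also have "\<dots> = - l"
      using nz[of "Suc (Suc i)"] nz[of i] nz[of "Suc i"] l_nonzero unfolding dS ti
      by (simp add: field_simps)
    finally show "ent (C.S (eu (Suc i) (Suc (Suc i)))) i (Suc i) = - l" .
  qed
  with iso show ?thesis by blast
qed

end

text \<open>Transposition fixes the diagonal matrix \<open>a\<close> and exchanges the two cases of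
  \<open>superdiagonal_or_subdiagonal\<close>.\<close>

lemma (in rb_diag) conj_upper: "\<exists>f g. mat_iso n f g \<and> rb_upper n l (\<lambda>X. f (R (g X))) c"
proof (cases "n \<ge> 2 \<longrightarrow> RS n (n - 2) (eu (n - 2) (n - 1)) \<noteq> 0")
  case True
  have eq: "(\<lambda>X. cut n (R (cut n X))) = R" by (simp add: fun_eq_iff cut_R R_cut)
  have "rb_upper n l R c" by unfold_locales (use True in blast)
  then show ?thesis using mat_iso_id by (intro exI[of _ "cut n"]) (simp add: eq)
next
  case False
  then have n2: "n \<ge> 2" and nz: "RS n (n - 2) (eu (n - 1) (n - 2)) \<noteq> 0"
    using superdiagonal_or_subdiagonal by auto
  let ?f = "transpose_imat n"
  have fa: "?f a = diag_mat n (\<lambda>i. c + of_nat i * l)"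
    by (auto simp: imat_eq_iff transpose_imat_apply a_diag diag_mat_apply)
  interpret C: rb_diag n l "\<lambda>X. ?f (R (?f X))" c
    by (rule conj_rb_diag[OF mat_iso_transpose l_nonzero n_pos fa RS_zero RS_top RS_top'])
  have f_eu: "?f (eu (n - 2) (n - 1)) = eu (n - 1) (n - 2)"
    using n2 by (auto simp: imat_eq_iff transpose_imat_apply eu_apply)
  have "cut n (eu (n - 2) (n - 1)) = eu (n - 2) (n - 1)" using n2 by simp
  from conj_RS[OF mat_iso_transpose this, of n "n - 2"]
  have *: "C.RS n (n - 2) (eu (n - 2) (n - 1)) = ?f (RS n (n - 2) (eu (n - 1) (n - 2)))"
    unfolding f_eu .
  have "?f (RS n (n - 2) (eu (n - 1) (n - 2))) \<noteq> 0"
  proof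
    assume "?f (RS n (n - 2) (eu (n - 1) (n - 2))) = 0"
    then have "?f (?f (RS n (n - 2) (eu (n - 1) (n - 2)))) = ?f 0" by (rule arg_cong)
    moreover have "?f 0 = 0" by (simp add: imat_eq_iff transpose_imat_apply)
    moreover have "cut n (RS n (n - 2) (eu (n - 1) (n - 2))) = RS n (n - 2) (eu (n - 1) (n - 2))"
      using n2 by (intro cut_RS) simp
    ultimately show False using nz mat_isoD(9)[OF mat_iso_transpose] by metis
  qed
  then have "rb_upper n l (\<lambda>X. ?f (R (?f X))) c"
    by unfold_locales (simp only: * not_False_eq_True)
  then show ?thesis using mat_iso_transpose by blast
qed

theorem (in rb_matrix) classification_nonzero_weight:
  assumes l: "l \<noteq> 0" and n: "n \<ge> 1" and k: "n \<le> k" "k + m = 2 * n - 1"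
    and zero: "\<And>X. cut n X = X \<Longrightarrow> RS k m X = 0"
    and top: "k > 0 \<Longrightarrow> \<exists>X. cut n X = X \<and> RS (k - 1) m X \<noteq> 0"
    and top': "m > 0 \<Longrightarrow> \<exists>X. cut n X = X \<and> RS k (m - 1) X \<noteq> 0"
  obtains f g where "mat_iso n f g" "\<And>X. f (R (g X)) = sc l (kernel_operator n b1_kernel X)"
proof -
  obtain c P Q where PQ: "k = n" "cut n P = P" "cut n Q = Q" "P \<odot> Q = idm n" "Q \<odot> P = idm n"
    "a \<odot> P = P \<odot> diag_mat n (\<lambda>i. c + of_nat i * l)"
  proof -
    have "k > 0" using k n by simp
    then show thesis using diagonalise[OF l k(1) zero top n] that by blast
  qed
  have m: "m = n - 1" using PQ(1) k by simp
  define f1 where "f1 X = Q \<odot> (cut n X \<odot> P)" for X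
  define g1 where "g1 X = P \<odot> (cut n X \<odot> Q)" for X
  have iso1: "mat_iso n f1 g1"
    unfolding f1_def g1_def by (rule mat_iso_conj[OF PQ(4,5,2,3)])
  have fa: "f1 a = diag_mat n (\<lambda>i. c + of_nat i * l)"
    by (simp add: f1_def PQ(6)) (simp add: mm_assoc[symmetric] PQ(5))
  have "rb_diag n l (\<lambda>X. f1 (R (g1 X))) c"
    by (rule conj_rb_diag[OF iso1 l n fa])
      (use zero top top' n PQ(1) m in \<open>simp_all add: numeral_2_eq_2\<close>)
  then obtain f2 g2 where iso2: "mat_iso n f2 g2" and "rb_upper n l (\<lambda>X. f2 (f1 (R (g1 (g2 X))))) c"
    using rb_diag.conj_upper by blast
  then obtain f3 g3 where iso3: "mat_iso n f3 g3"
    and N: "rb_normalised n l (\<lambda>X. f3 (f2 (f1 (R (g1 (g2 (g3 X))))))) 0"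
    using rb_upper.normalise by blast
  have eq: "f3 (f2 (f1 (R (g1 (g2 (g3 X)))))) = sc l (kernel_operator n b1_kernel X)" for X
    by (rule rb_normalised.R_eq_kernel_operator[OF N])
  show thesis
    by (rule that[OF mat_iso_trans[OF mat_iso_trans[OF iso1 iso2] iso3]]) (rule eq)
qed

section \<open>Weight zero: the diagonal filtration\<close>

lemma finite_coeff_support: "finite {i. coeff p i \<noteq> 0}"
  by (rule finite_subset[of _ "{..degree p}"]) (auto intro: le_degree)

text \<open>The operator \<open>x d/dx - i\<close> removes the monomial of degree \<open>i\<close> and lowers the order of
  vanishing at \<open>1\<close> by at most one.\<close>

lemma sparse_polynomial_order_at_1:
  fixes p :: "'a::field_char_0 poly"
  assumes "[:- 1, 1:] ^ N dvd p" "card {i. coeff p i \<noteq> 0} \<le> N"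
  shows "p = 0"
  using assms
proof (induction N arbitrary: p)
  case 0
  then show ?case using finite_coeff_support[of p] by (auto simp: poly_eq_iff)
next
  case (Suc N)
  show ?case
  proof (rule ccontr)
    assume p: "p \<noteq> 0"
    define i0 where "i0 = degree p"
    define t where "t = [:0, 1:] * pderiv p - [:of_nat i0:] * p"
    have coeff_t: "coeff t i = (of_nat i - of_nat i0) * coeff p i" for i
      by (cases i) (simp_all add: t_def coeff_pderiv algebra_simps)
    have supp: "{i. coeff t i \<noteq> 0} = {i. coeff p i \<noteq> 0} - {i0}"
      by (auto simp: coeff_t)
    have "i0 \<in> {i. coeff p i \<noteq> 0}" using p by (simp add: i0_def)
    then have card: "card {i. coeff t i \<noteq> 0} \<le> N"
      using Suc.prems(2) finite_coeff_support[of p] by (simp add: supp card_Diff_singleton)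
    obtain q where q: "p = [:- 1, 1:] ^ Suc N * q" using Suc.prems(1) by (rule dvdE)
    have "[:- 1, 1:] ^ N dvd pderiv p"
      unfolding q pderiv_mult pderiv_power_Suc
      by (intro dvd_add)
        (simp_all only: power_Suc2 mult.commute[of q] mult_smult_left dvd_smult mult.assoc dvd_triv_left)
    moreover have "[:- 1, 1:] ^ N dvd p" unfolding q by (simp only: power_Suc2 mult.assoc dvd_triv_left)
    ultimately have "[:- 1, 1:] ^ N dvd t" unfolding t_def by (intro dvd_diff dvd_mult)
    then have "t = 0" using Suc.IH card by blast
    then have zero: "coeff p i = 0" if "i \<noteq> i0" for i
      using coeff_t[of i] that by simp
    then have pm: "p = monom (coeff p i0) i0" by (auto simp: poly_eq_iff)
    have "poly p 1 = 0" unfolding q by simp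
    then have "coeff p i0 = 0" by (subst (asm) pm) (simp add: poly_monom)
    then show False using p by (simp add: i0_def)
  qed
qed

section \<open>The Jordan block and the filtration by diagonals\<close>

definition shift_mat :: "nat \<Rightarrow> nat \<Rightarrow> 'a::field imat" where
  "shift_mat n k = IMat (\<lambda>i j. if j = i + k \<and> j < n then 1 else 0)"

lemma shift_mat_apply: "ent (shift_mat n k) i j = (if j = i + k \<and> j < n then 1 else 0)"
  by (simp add: shift_mat_def)

lemma cut_shift_mat [simp]: "cut n (shift_mat n k) = shift_mat n k"
  by (auto simp: imat_eq_iff cut_apply shift_mat_apply)

lemma shift_mat_left: "ent (mm n (shift_mat n k) X) i j = (if i + k < n then ent X (i + k) j else 0)"
proof -
  have "(\<Sum>r<n. ent (shift_mat n k) i r * ent X r j) = (\<Sum>r<n. if r = i + k then ent X (i + k) j else 0)"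
    by (intro sum.cong refl) (auto simp: shift_mat_apply)
  then show ?thesis by (simp add: mm_apply)
qed

lemma shift_mat_right: "ent (mm n X (shift_mat n k)) i j = (if k \<le> j \<and> j < n then ent X i (j - k) else 0)"
proof -
  have "(\<Sum>r<n. ent X i r * ent (shift_mat n k) r j)
      = (\<Sum>r<n. if r = j - k then if k \<le> j \<and> j < n then ent X i (j - k) else 0 else 0)"
    by (intro sum.cong refl) (auto simp: shift_mat_apply)
  then show ?thesis by (auto simp: mm_apply)
qed

lemma shift_mat_mult: "mm n (shift_mat n k) (shift_mat n m) = shift_mat n (k + m)"
  by (auto simp: imat_eq_iff shift_mat_left shift_mat_apply)

text \<open>\<open>F 0\<close> is everything; each step discards one more diagonal, starting from the bottom left corner.\<close>

definition in_filtration :: "nat \<Rightarrow> nat \<Rightarrow> 'a::field imat \<Rightarrow> bool" where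
  "in_filtration n D X \<longleftrightarrow> (\<forall>i j. ent X i j \<noteq> 0 \<longrightarrow> i < n \<and> j < n \<and> D + i < n + j)"

locale rb_jordan = rb_matrix n 0 R for n and R :: "'a::field_char_0 imat \<Rightarrow> 'a imat" +
  assumes n_ge_2: "n \<ge> 2" and a_jordan: "a = shift_mat n 1"
    and R_nilpotent: "cut n X = X \<Longrightarrow> (R ^^ (2 * n - 1)) X = 0"
    and R_top: "\<exists>X. cut n X = X \<and> (R ^^ (2 * n - 2)) X \<noteq> 0"
begin

definition d :: "'a imat \<Rightarrow> 'a imat" where "d X = a \<odot> X - X \<odot> a"

abbreviation "F \<equiv> in_filtration n"

lemma F_0: "F 0 X \<longleftrightarrow> cut n X = X"
  by (auto simp: in_filtration_def imat_eq_iff cut_apply) (metis trans_less_add1)+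

lemma F_zero [simp]: "F D 0"
  by (simp add: in_filtration_def)

lemma F_mono: "F D X \<Longrightarrow> D' \<le> D \<Longrightarrow> F D' X"
  unfolding in_filtration_def by (meson add_mono1 le_trans add_le_mono1 le_less_trans)

lemma F_cut: "F D X \<Longrightarrow> cut n X = X"
  using F_0 F_mono[of D X 0] by blast

lemma F_top: "F (2 * n - 1) X \<Longrightarrow> X = 0"
proof (rule imat_eqI, rule ccontr)
  fix i j assume "F (2 * n - 1) X" "ent X i j \<noteq> ent 0 i j"
  then have "i < n" "j < n" "2 * n - 1 + i < n + j" by (auto simp: in_filtration_def)
  then show False by linarith
qed

lemma F_add: "F D X \<Longrightarrow> F D Y \<Longrightarrow> F D (X + Y)"
  unfolding in_filtration_def by (metis add_0 ent_arith(2))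

lemma F_sc: "F D X \<Longrightarrow> F D (sc c X)"
  by (auto simp: in_filtration_def)

lemma F_minus: "F D X \<Longrightarrow> F D (- X)"
  by (auto simp: in_filtration_def)

lemma F_diff: "F D X \<Longrightarrow> F D Y \<Longrightarrow> F D (X - Y)"
  using F_add[of D X "- Y"] F_minus[of D Y] by simp

lemma F_sum: "(\<And>i. i \<in> A \<Longrightarrow> F D (f i)) \<Longrightarrow> F D (sum f A)"
  by (induction A rule: infinite_finite_induct) (auto intro: F_add)

lemma a_left: "ent (a \<odot> X) i j = (if Suc i < n then ent X (Suc i) j else 0)"
  by (simp add: a_jordan shift_mat_left)

lemma a_right: "ent (X \<odot> a) i j = (if 0 < j \<and> j < n then ent X i (j - 1) else 0)"
  by (auto simp: a_jordan shift_mat_right)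

lemma F_a_left: "F D X \<Longrightarrow> F (Suc D) (a \<odot> X)"
  unfolding in_filtration_def
proof (intro allI impI)
  fix i j
  assume *: "\<forall>i j. ent X i j \<noteq> 0 \<longrightarrow> i < n \<and> j < n \<and> D + i < n + j" and nz: "ent (a \<odot> X) i j \<noteq> 0"
  then have "Suc i < n" "ent X (Suc i) j \<noteq> 0" by (auto simp: a_left split: if_splits)
  with * have "Suc i < n \<and> j < n \<and> D + Suc i < n + j" by blast
  then show "i < n \<and> j < n \<and> Suc D + i < n + j" by auto
qed

lemma F_a_right: "F D X \<Longrightarrow> F (Suc D) (X \<odot> a)"
  unfolding in_filtration_def
proof (intro allI impI)
  fix i j
  assume *: "\<forall>i j. ent X i j \<noteq> 0 \<longrightarrow> i < n \<and> j < n \<and> D + i < n + j" and nz: "ent (X \<odot> a) i j \<noteq> 0"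
  then have j: "0 < j" "j < n" "ent X i (j - 1) \<noteq> 0" by (auto simp: a_right split: if_splits)
  with * have "i < n \<and> D + i < n + (j - 1)" by blast
  with j show "i < n \<and> j < n \<and> Suc D + i < n + j" by auto
qed

lemma ent_d: "ent (d X) i j = (if Suc i < n then ent X (Suc i) j else 0)
    - (if 0 < j \<and> j < n then ent X i (j - 1) else 0)"
  by (simp add: d_def a_left a_right)

lemma F_d: "F D X \<Longrightarrow> F (Suc D) (d X)"
  unfolding d_def by (intro F_diff F_a_left F_a_right)

lemma F_d_power: "F D X \<Longrightarrow> F (D + s) ((d ^^ s) X)"
  by (induction s) (auto intro: F_d)

lemma d_add: "d (X + Y) = d X + d Y" and d_diff: "d (X - Y) = d X - d Y"
  by (simp_all add: d_def mm_simps)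

lemma d_zero [simp]: "d 0 = 0"
  by (simp add: d_def)

lemma d_power_zero [simp]: "(d ^^ s) 0 = 0"
  by (induction s) simp_all

lemma d_power_add: "(d ^^ s) (X + Y) = (d ^^ s) X + (d ^^ s) Y"
  and d_power_diff: "(d ^^ s) (X - Y) = (d ^^ s) X - (d ^^ s) Y"
  by (induction s) (simp_all add: d_add d_diff)

lemma d_power_d: "(d ^^ s) (d X) = (d ^^ Suc s) X"
  by (simp add: funpow_swap1)

lemma d_R: "d (R X) = R (d X)"
  by (simp add: d_def R_ad)

lemma d_power_R: "(d ^^ s) (R X) = R ((d ^^ s) X)"
  by (induction s) (simp_all add: d_R)

text \<open>The generating polynomial of the \<open>m\<close>-th subdiagonal, indexed by columns;
  with this indexing \<open>d\<close> becomes multiplication by \<open>1 - x\<close>.\<close>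

definition diagonal_poly :: "nat \<Rightarrow> 'a imat \<Rightarrow> 'a poly" where
  "diagonal_poly m X = (\<Sum>k<n - m. monom (ent X (k + m) k) k)"

lemma coeff_diagonal_poly: "coeff (diagonal_poly m X) k = (if k < n - m then ent X (k + m) k else 0)"
  by (simp add: diagonal_poly_def coeff_sum)

lemma degree_power_times_diagonal_poly:
  "coeff ([:1, - 1:] ^ s * diagonal_poly m X) j = 0" if "n - m + s \<le> j" for j
proof (cases "diagonal_poly m X = 0")
  case False
  then have "degree (diagonal_poly m X) < n - m"
    by (metis coeff_diagonal_poly leading_coeff_0_iff)
  then have "degree ([:1, - 1:] ^ s * diagonal_poly m X) < n - m + s"
    using degree_mult_le[of "[:1, - 1:] ^ s" "diagonal_poly m X"] degree_power_le[of "[:1, - 1 :: 'a:]" s]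
    by simp
  then show ?thesis using that by (intro coeff_eq_0) simp
qed simp

text \<open>An entry of \<open>d Y\<close> is the difference of two entries on the previous
  diagonal, in columns \<open>j\<close> and \<open>j - 1\<close>. An entry missing below the last
  row corresponds to a coefficient beyond the degree, so the border does no harm.\<close>

lemma d_power_coeff:
  assumes "cut n X = X" "m < n" "i < n" "j < n" "j + m = i + s"
  shows "ent ((d ^^ s) X) i j = coeff ([:1, - 1:] ^ s * diagonal_poly m X) j"
  using assms(3-5)
proof (induction s arbitrary: i j)
  case 0
  then show ?case by (simp add: coeff_diagonal_poly)
next
  case (Suc s)
  let ?q = "[:1, - 1:] ^ s * diagonal_poly m X"
  have 1: "(if Suc i < n then ent ((d ^^ s) X) (Suc i) j else 0) = coeff ?q j"
  proof (cases "Suc i < n")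
    case True
    then show ?thesis using Suc by simp
  next
    case False
    then have "coeff ?q j = 0"
      using Suc.prems assms(2) by (intro degree_power_times_diagonal_poly) simp
    then show ?thesis using False by simp
  qed
  have "coeff ([:1, - 1:] ^ Suc s * diagonal_poly m X) j = coeff ([:1, - 1:] * ?q) j"
    by (simp only: power_Suc mult.assoc)
  also have "\<dots> = coeff ?q j - (if 0 < j then coeff ?q (j - 1) else 0)"
    by (cases j) (simp_all add: mult_pCons_left)
  also have "\<dots> = ent (d ((d ^^ s) X)) i j"
    using 1 Suc.IH[of i "j - 1"] Suc.prems by (auto simp: ent_d)
  finally show ?case by simp
qed

lemma even_power_linear: "[:1, - 1 :: 'a:] ^ (2 * m) = [:- 1, 1:] ^ (2 * m)"
proof -
  have "[:1, - 1 :: 'a:] = - [:- 1, 1:]" by simp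
  show ?thesis unfolding power_mult \<open>[:1, - 1 :: 'a:] = - [:- 1, 1:]\<close> power2_minus ..
qed

text \<open>The product has degree below \<open>n + m\<close>. If its coefficients from
  \<open>m\<close> to \<open>n - 1\<close> vanish, at most \<open>2 m\<close> terms remain, too few
  for a zero of order \<open>2 m\<close> at 1. These middle coefficients are the entries of the
  \<open>m\<close>-th superdiagonal after \<open>2 m\<close> applications of
  \<open>d\<close>.\<close>

lemma diagonal_poly_injective:
  assumes "m < n" "\<And>i. i < n - m \<Longrightarrow> coeff ([:1, - 1:] ^ (2 * m) * h) (i + m) = 0"
    and h: "\<And>k. n - m \<le> k \<Longrightarrow> coeff h k = 0"
  shows "h = (0 :: 'a poly)"
proof -
  let ?p = "[:1, - 1:] ^ (2 * m) * h"
  have big: "coeff ?p j = 0" if "n + m \<le> j" for j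
  proof (cases "h = 0")
    case False
    then have "degree h < n - m" using h by (metis leading_coeff_0_iff not_le)
    then have "degree ?p < n + m"
      using degree_mult_le[of "[:1, - 1:] ^ (2 * m)" h] degree_power_le[of "[:1, - 1 :: 'a:]" "2 * m"] assms(1)
      by simp
    then show ?thesis using that by (intro coeff_eq_0) simp
  qed simp
  have "{i. coeff ?p i \<noteq> 0} \<subseteq> {..<m} \<union> {n..<n + m}"
  proof
    fix j assume "j \<in> {i. coeff ?p i \<noteq> 0}"
    then have nz: "coeff ?p j \<noteq> 0" by simp
    have "j < n + m" using nz big not_le by blast
    moreover have "\<not> (m \<le> j \<and> j < n)"
    proof
      assume "m \<le> j \<and> j < n"
      then have "coeff ?p (j - m + m) = 0" using assms(1) by (intro assms(2)) auto
      then show False using nz \<open>m \<le> j \<and> j < n\<close> by simp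
    qed
    ultimately show "j \<in> {..<m} \<union> {n..<n + m}" by auto
  qed
  then have "card {i. coeff ?p i \<noteq> 0} \<le> card ({..<m} \<union> {n..<n + m})"
    by (intro card_mono) auto
  also have "\<dots> \<le> 2 * m" using card_Un_le[of "{..<m}" "{n..<n + m}"] by simp
  finally have "?p = 0"
    by (intro sparse_polynomial_order_at_1[of "2 * m"]) (simp_all add: even_power_linear)
  then show ?thesis by simp
qed

lemma d_power_injective:
  assumes "cut n X = X" "m < n" "\<And>i. i + m < n \<Longrightarrow> ent ((d ^^ (2 * m)) X) i (i + m) = 0" "k + m < n"
  shows "ent X (k + m) k = 0"
proof -
  have "diagonal_poly m X = 0"
  proof (rule diagonal_poly_injective[OF assms(2)])
    fix i assume "i < n - m"
    then show "coeff ([:1, - 1:] ^ (2 * m) * diagonal_poly m X) (i + m) = 0"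
      using assms(3)[of i] d_power_coeff[OF assms(1,2), of i "i + m" "2 * m"] by simp
  qed (simp add: coeff_diagonal_poly)
  then show ?thesis using coeff_diagonal_poly[of m X k] assms(4) by (simp add: less_diff_conv)
qed

text \<open>Both diagonals have \<open>n - m\<close> entries, so injectivity makes the square system
  with matrix \<open>M\<close> solvable. Its solution, placed on the \<open>m\<close>-th
  subdiagonal, reproduces the \<open>m\<close>-th superdiagonal of \<open>X\<close>.\<close>

lemma d_power_surjective_leading:
  assumes m: "m < n" and X: "F (n - 1 + m) X"
  obtains Y where "F (n - 1 - m) Y" "F (n + m) (X - (d ^^ (2 * m)) Y)"
proof -
  define q where "q = [:1, - 1 :: 'a:] ^ (2 * m)"
  define N where "N = n - m"
  define M where "M = IMat (\<lambda>i k. if i < N \<and> k < N \<and> k \<le> i + m then coeff q (i + m - k) else 0)"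
  have M: "cut N M = M" by (auto simp: M_def imat_eq_iff cut_apply)
  have M_coeff: "(\<Sum>k<N. ent M i k * coeff h k) = coeff (q * h) (i + m)"
    if "i < N" "\<And>k. N \<le> k \<Longrightarrow> coeff h k = 0" for i h
  proof -
    have "coeff (q * h) (i + m) = (\<Sum>k\<le>i + m. coeff h k * coeff q (i + m - k))"
      by (simp add: mult.commute[of q] coeff_mult)
    also have "\<dots> = (\<Sum>k<N. ent M i k * coeff h k)"
    proof (rule sum.mono_neutral_cong)
      show "coeff h k * coeff q (i + m - k) = 0" if "k \<in> {..i + m} - {..<N}" for k
        using that \<open>\<And>k. N \<le> k \<Longrightarrow> coeff h k = 0\<close> by simp
      show "ent M i k * coeff h k = 0" if "k \<in> {..<N} - {..i + m}" for k
        using that by (auto simp: M_def)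
      show "coeff h k * coeff q (i + m - k) = ent M i k * coeff h k" if "k \<in> {..i + m} \<inter> {..<N}" for k
        using that \<open>i < N\<close> by (simp add: M_def)
    qed auto
    finally show ?thesis ..
  qed
  have poly_coeff: "coeff (\<Sum>k<N. monom (v k) k) k = (if k < N then v k else 0)" for v :: "nat \<Rightarrow> 'a" and k
    by (simp add: coeff_sum)
  have ker: "v k = 0" if "\<And>i. i < N \<Longrightarrow> (\<Sum>k<N. ent M i k * v k) = 0" "k < N" for v k
  proof -
    define h where "h = (\<Sum>k<N. monom (v k) k)"
    have ch: "coeff h k = (if k < N then v k else 0)" for k
      unfolding h_def by (rule poly_coeff)
    have "h = 0"
    proof (rule diagonal_poly_injective[OF m])
      fix i assume "i < n - m"
      then show "coeff ([:1, - 1:] ^ (2 * m) * h) (i + m) = 0"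
        using M_coeff[of i h] that(1)[of i] by (simp add: ch N_def q_def)
    qed (simp add: ch N_def)
    then show ?thesis using ch[of k] that(2) by simp
  qed
  obtain M' where M': "mm N M M' = idm N"
    by (rule imat_inverse[OF M]) (rule ker, assumption+)
  define v where "v k = (\<Sum>i<N. ent M' k i * ent X i (i + m))" for k
  define Y where "Y = IMat (\<lambda>i j. if i = j + m \<and> i < n then v j else 0)"
  have FY: "F (n - 1 - m) Y" using m by (auto simp: in_filtration_def Y_def)
  have Mv: "(\<Sum>k<N. ent M i k * v k) = ent X i (i + m)" if "i < N" for i
  proof -
    have "(\<Sum>k<N. ent M i k * v k) = (\<Sum>k<N. \<Sum>r<N. ent M i k * ent M' k r * ent X r (r + m))"
      by (simp add: v_def sum_distrib_left mult.assoc)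
    also have "\<dots> = (\<Sum>r<N. ent (mm N M M') i r * ent X r (r + m))"
      by (subst sum.swap) (simp add: mm_apply sum_distrib_right)
    also have "\<dots> = (\<Sum>r<N. if r = i then ent X i (i + m) else 0)"
      unfolding M' using that by (intro sum.cong refl) (auto simp: idm_apply)
    finally show ?thesis using that by simp
  qed
  have lead: "ent ((d ^^ (2 * m)) Y) i (i + m) = ent X i (i + m)" if "i + m < n" for i
  proof -
    have dp: "coeff (diagonal_poly m Y) k = (if k < N then v k else 0)" for k
      by (auto simp: coeff_diagonal_poly N_def Y_def)
    have "ent ((d ^^ (2 * m)) Y) i (i + m) = coeff (q * diagonal_poly m Y) (i + m)"
      unfolding q_def using that m by (intro d_power_coeff F_cut[OF FY]) auto
    also have "\<dots> = (\<Sum>k<N. ent M i k * coeff (diagonal_poly m Y) k)"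
      using that by (intro M_coeff[symmetric]) (auto simp: dp N_def)
    also have "\<dots> = ent X i (i + m)" using Mv[of i] that by (simp add: dp N_def)
    finally show ?thesis .
  qed
  have "n - 1 - m + 2 * m = n - 1 + m" using m by simp
  then have "F (n - 1 + m) ((d ^^ (2 * m)) Y)" using F_d_power[OF FY, of "2 * m"] by metis
  then have Z: "F (n - 1 + m) (X - (d ^^ (2 * m)) Y)" using X by (rule F_diff[rotated])
  have "F (n + m) (X - (d ^^ (2 * m)) Y)"
    unfolding in_filtration_def
  proof (intro allI impI)
    fix i j assume nz: "ent (X - (d ^^ (2 * m)) Y) i j \<noteq> 0"
    then have ij: "i < n" "j < n" "n - 1 + m + i < n + j" using Z by (auto simp: in_filtration_def)
    moreover have "j \<noteq> i + m" using nz lead[of i] ij by auto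
    ultimately show "i < n \<and> j < n \<and> n + m + i < n + j" by auto
  qed
  with FY show thesis by (rule that)
qed

text \<open>Successive approximation: the error of the leading solution \<open>Y\<close> starts one
  diagonal higher, hence is \<open>(d ^^ (2 * Suc m)) Z\<close> for some \<open>Z\<close>, and
  \<open>d (d Z)\<close> corrects \<open>Y\<close>.\<close>

lemma d_power_surjective:
  assumes "m \<le> n" "F (n - 1 + m) X"
  shows "\<exists>Y. F (n - 1 - m) Y \<and> (d ^^ (2 * m)) Y = X"
  using assms
proof (induction "n - m" arbitrary: m X)
  case 0
  then have "X = 0" using F_top[of X] n_ge_2 by (simp add: mult_2)
  then show ?case by (intro exI[of _ 0]) simp
next
  case (Suc r)
  then have m: "m < n" by simp
  obtain Y where Y: "F (n - 1 - m) Y" "F (n + m) (X - (d ^^ (2 * m)) Y)"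
    using d_power_surjective_leading[OF m Suc.prems(2)] .
  have r: "r = n - Suc m" using Suc.hyps(2) by simp
  have "F (n - 1 + Suc m) (X - (d ^^ (2 * m)) Y)" using Y(2) m by simp
  from Suc.hyps(1)[OF r _ this] m obtain Z where Z: "F (n - 1 - Suc m) Z" "(d ^^ (2 * Suc m)) Z = X - (d ^^ (2 * m)) Y"
    by (metis Suc_leI)
  have "(d ^^ (2 * Suc m)) Z = (d ^^ (2 * m)) (d (d Z))"
    using d_power_d[of "2 * m" "d Z"] d_power_d[of "Suc (2 * m)" Z] by simp
  then have "(d ^^ (2 * m)) (Y + d (d Z)) = X" using Z(2) by (simp add: d_power_add)
  moreover have "F (n - 1 - m) (d (d Z))"
    by (rule F_mono[OF F_d[OF F_d[OF Z(1)]]]) simp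
  ultimately show ?case using Y(1) by (intro exI[of _ "Y + d (d Z)"]) (simp add: F_add)
qed

text \<open>For \<open>m' > m\<close> also \<open>d ^^ (2 * m')\<close> kills \<open>Z\<close>, so
  by injectivity the \<open>m'\<close>-th subdiagonal is zero; the diagonals are discarded from the
  corner inwards.\<close>

lemma d_power_kernel_filtration:
  assumes "cut n Z = Z" "(d ^^ (2 * m + 1)) Z = 0" "D \<le> n - 1 - m"
  shows "F D Z"
  using assms(3)
proof (induction D)
  case 0
  then show ?case using assms(1) by (simp add: F_0)
next
  case (Suc D)
  define m' where "m' = n - 1 - D"
  have m': "m' < n" "m < m'" "D + m' = n - 1" using Suc.prems n_ge_2 by (auto simp: m'_def)
  have "(d ^^ (2 * m')) Z = (d ^^ (2 * m' - (2 * m + 1))) ((d ^^ (2 * m + 1)) Z)"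
    using m'(2) by (simp add: funpow_add[symmetric] flip: comp_apply[of "d ^^ _" "d ^^ _"] del: funpow.simps)
  then have "(d ^^ (2 * m')) Z = 0" using assms(2) by simp
  then have lead: "ent Z (k + m') k = 0" if "k + m' < n" for k
    using d_power_injective[OF assms(1) m'(1) _ that] by simp
  have "F D Z" using Suc by simp
  then show ?case
    unfolding in_filtration_def
  proof (intro allI impI)
    fix i j assume *: "\<forall>i j. ent Z i j \<noteq> 0 \<longrightarrow> i < n \<and> j < n \<and> D + i < n + j" and nz: "ent Z i j \<noteq> 0"
    then have ij: "i < n" "j < n" "D + i < n + j" by auto
    moreover have "i \<noteq> j + m'" using lead[of j] nz ij by auto
    ultimately show "i < n \<and> j < n \<and> Suc D + i < n + j" using m'(3) by linarith
  qed
qed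

lemma d_power_filtration_strict:
  assumes "m < n" "F (n - 1 - m) Z" "F (n + m) ((d ^^ (2 * m)) Z)"
  shows "F (n - m) Z"
proof -
  have "ent ((d ^^ (2 * m)) Z) i (i + m) = 0" for i
    using assms(3) unfolding in_filtration_def by (metis add.assoc add.commute less_irrefl)
  then have lead: "ent Z (k + m) k = 0" if "k + m < n" for k
    using d_power_injective[OF F_cut[OF assms(2)] assms(1) _ that] by simp
  show ?thesis
    unfolding in_filtration_def
  proof (intro allI impI)
    fix i j assume nz: "ent Z i j \<noteq> 0"
    then have ij: "i < n" "j < n" "n - 1 - m + i < n + j" using assms(2) by (auto simp: in_filtration_def)
    moreover have "i \<noteq> j + m" using lead[of j] nz ij by auto
    ultimately show "i < n \<and> j < n \<and> n - m + i < n + j" using assms(1) by linarith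
  qed
qed

section \<open>R on the centraliser of the Jordan block\<close>

lemma RS_idm_shift: "RS k 0 (idm n) = sc (1 / fact k) (shift_mat n k)"
proof (induction k)
  case 0
  show ?case by (auto simp: imat_eq_iff idm_apply shift_mat_apply)
next
  case (Suc k)
  have "sc (of_nat (k + 1)) (RS (Suc k) 0 (idm n)) = a \<odot> RS k 0 (idm n)"
    using a_RS_idm(1)[of k 0] by simp
  also have "\<dots> = sc (of_nat (k + 1)) (sc (1 / fact (Suc k)) (shift_mat n (Suc k)))"
    unfolding Suc mm_sc_right a_jordan shift_mat_mult
    by (simp add: field_simps del: of_nat_Suc)
  finally show ?case by (simp only: sc.scale_cancel_left) (simp del: of_nat_Suc)
qed

text \<open>\<open>R\<close> integrates the powers of \<open>a\<close>. As these span the kernel of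
  \<open>d\<close>, the effect of \<open>R\<close> on the filtration is explicit there.\<close>

lemma R_shift_mat: "R (shift_mat n k) = sc (1 / of_nat (Suc k)) (shift_mat n (Suc k))"
proof -
  have "shift_mat n k = sc (fact k) (RS k 0 (idm n))" by (simp add: RS_idm_shift)
  then have "R (shift_mat n k) = sc (fact k) (RS (Suc k) 0 (idm n))" by (simp add: R_sc left.R_RS)
  moreover have "fact k * (1 / fact (Suc k)) = (1 / of_nat (Suc k) :: 'a)"
    by (simp add: fact_Suc del: of_nat_Suc)
  ultimately show ?thesis by (simp only: RS_idm_shift sc.scale_scale)
qed

lemma F_shift_mat: "F (n - 1 + k) (shift_mat n k)"
  using n_ge_2 by (auto simp: in_filtration_def shift_mat_apply)

lemma d_kernel_expand:
  assumes "cut n X = X" "d X = 0"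
  shows "X = (\<Sum>k<n. sc (ent X 0 k) (shift_mat n k))"
proof (rule imat_eqI)
  fix i j
  have eq: "ent (a \<odot> X) i j = ent (X \<odot> a) i j" for i j using assms(2) by (simp add: d_def)
  have step: "ent X (Suc i) j = (if 0 < j then ent X i (j - 1) else 0)" if "Suc i < n" "j < n" for i j
    using eq[of i j] that by (simp add: a_left a_right)
  have "ent X i j = (if i \<le> j then ent X 0 (j - i) else 0)" if "i < n" "j < n"
    using that
  proof (induction i arbitrary: j)
    case (Suc i)
    then show ?case using step[of i j] Suc.IH[of "j - 1"] by auto
  qed simp
  moreover have "(\<Sum>k<n. ent X 0 k * ent (shift_mat n k) i j) = (if i < n \<and> j < n then if i \<le> j then ent X 0 (j - i) else 0 else 0)"
  proof -
    have "(\<Sum>k<n. ent X 0 k * ent (shift_mat n k) i j)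
        = (\<Sum>k<n. if k = j - i then if i \<le> j \<and> j < n then ent X 0 (j - i) else 0 else 0)"
      by (intro sum.cong refl) (auto simp: shift_mat_apply)
    then show ?thesis by auto
  qed
  moreover have "ent X i j = 0" if "\<not> (i < n \<and> j < n)" using assms(1) that by (metis cut_apply)
  ultimately show "ent X i j = ent (\<Sum>k<n. sc (ent X 0 k) (shift_mat n k)) i j" by auto
qed

lemma R_d_kernel_filtration:
  assumes "d X = 0" "F (n - 1 + m) X"
  shows "F (n + m) (R X)"
proof -
  have "R X = (\<Sum>k<n. sc (ent X 0 k) (R (shift_mat n k)))"
    by (subst d_kernel_expand[OF F_cut[OF assms(2)] assms(1)]) (simp add: left.R_sum R_sc)
  moreover have "F (n + m) (sc (ent X 0 k) (R (shift_mat n k)))" for k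
  proof (cases "k < m")
    case True
    then have "ent X 0 k = 0" using assms(2) n_ge_2 by (force simp: in_filtration_def)
    then show ?thesis by simp
  next
    case False
    then show ?thesis
      unfolding R_shift_mat using n_ge_2 by (intro F_sc F_mono[OF F_shift_mat]) auto
  qed
  ultimately show ?thesis by (simp add: F_sum)
qed

text \<open>\<open>R\<close> commutes with \<open>d\<close>, and \<open>d\<^bsup>2m\<^esup>\<close> identifies the \<open>m\<close>-th subdiagonal with the \<open>m\<close>-th
  superdiagonal; modulo the image of \<open>d\<close> this reduces the claim to powers of \<open>a\<close>.\<close>

theorem R_filtration_low: "D \<le> n - 1 \<Longrightarrow> F D X \<Longrightarrow> F (Suc D) (R X)"
proof (induction D arbitrary: X)
  case 0
  show ?case
  proof -
    have "0 + (2 * (n - 1) + 1) = 2 * n - 1" using n_ge_2 by simp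
    then have "F (2 * n - 1) ((d ^^ (2 * (n - 1) + 1)) X)"
      using F_d_power[OF 0(2), of "2 * (n - 1) + 1"] by metis
    then have "(d ^^ (2 * (n - 1) + 1)) X = 0" by (rule F_top)
    then have "d ((d ^^ (2 * (n - 1))) X) = 0" by simp
    moreover have "F (n - 1 + (n - 1)) ((d ^^ (2 * (n - 1))) X)"
      using F_d_power[OF 0(2), of "2 * (n - 1)"] by (simp add: mult_2)
    ultimately have "F (n + (n - 1)) (R ((d ^^ (2 * (n - 1))) X))" by (rule R_d_kernel_filtration)
    then have "F (n + (n - 1)) ((d ^^ (2 * (n - 1))) (R X))" by (simp add: d_power_R)
    moreover have "F (n - 1 - (n - 1)) (R X)" by (simp add: F_0 cut_R)
    ultimately have "F (n - (n - 1)) (R X)" using n_ge_2 by (intro d_power_filtration_strict) auto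
    then show ?thesis using n_ge_2 by simp
  qed
next
  case (Suc D)
  define m where "m = n - 1 - Suc D"
  have m: "m < n" "n - 1 - m = Suc D" "n - 1 - Suc m = D" "n - m = Suc (Suc D)"
    using Suc.prems n_ge_2 by (auto simp: m_def)
  have Dm: "Suc D + m = n - 1" using Suc.prems by (simp add: m_def)
  then have "Suc D + (2 * m + 1) = n - 1 + Suc m" by simp
  then have "F (n - 1 + Suc m) ((d ^^ (2 * m + 1)) X)"
    using F_d_power[OF Suc.prems(2), of "2 * m + 1"] by metis
  \<comment> \<open>\<open>Y\<close> is chosen so that \<open>X - d Y\<close> is killed by
    \<open>d ^^ (2 * m + 1)\<close>; the part \<open>d Y\<close> is settled by the induction
    hypothesis because \<open>R\<close> commutes with \<open>d\<close>.\<close>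
  then obtain Y where Y: "F D Y" "(d ^^ (2 * Suc m)) Y = (d ^^ (2 * m + 1)) X"
    using d_power_surjective[of "Suc m"] m by auto
  define X' where "X' = X - d Y"
  have "(d ^^ (2 * Suc m)) Y = (d ^^ (2 * m + 1)) (d Y)" using d_power_d[of "2 * m + 1" Y] by simp
  then have X'0: "(d ^^ (2 * m + 1)) X' = 0" using Y(2) by (simp only: X'_def d_power_diff) simp
  have FX': "F (Suc D) X'" unfolding X'_def by (intro F_diff Suc.prems F_d Y)
  have "(d ^^ (2 * m + 1)) (R X') = 0" by (simp only: d_power_R X'0 left.R_zero)
  then have 1: "F (n - 1 - m) (R X')"
    by (intro d_power_kernel_filtration[OF cut_R]) auto
  have "d ((d ^^ (2 * m)) X') = 0" using X'0 by simp
  moreover have "F (n - 1 + m) ((d ^^ (2 * m)) X')"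
  proof -
    have "Suc D + 2 * m = n - 1 + m" using Dm by simp
    then show ?thesis using F_d_power[OF FX', of "2 * m"] by metis
  qed
  ultimately have "F (n + m) (R ((d ^^ (2 * m)) X'))" by (rule R_d_kernel_filtration)
  then have "F (n + m) ((d ^^ (2 * m)) (R X'))" by (simp add: d_power_R)
  then have "F (n - m) (R X')" using 1 m(1) by (intro d_power_filtration_strict)
  then have "F (Suc (Suc D)) (R X')" by (simp only: m(4))
  moreover have "F (Suc (Suc D)) (d (R Y))" using Suc.IH[of Y] Suc.prems Y by (intro F_d) simp
  moreover have "R X = R X' + d (R Y)" by (simp add: X'_def left.R_diff d_R)
  ultimately show ?case by (simp add: F_add)
qed

text \<open>Above the main diagonal every element is \<open>(d ^^ (2 * m)) Y\<close> with
  \<open>Y\<close> in the range already treated, and \<open>R\<close> commutes with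
  \<open>d\<close>.\<close>

theorem R_filtration: "F D X \<Longrightarrow> F (Suc D) (R X)"
proof (cases "D \<le> n - 1")
  case True
  then show "F D X \<Longrightarrow> F (Suc D) (R X)" by (rule R_filtration_low)
next
  case False
  assume X: "F D X"
  define m where "m = D - (n - 1)"
  have m: "D = n - 1 + m" using False by (simp add: m_def)
  show ?thesis
  proof (cases "m \<le> n")
    case True
    then obtain Y where Y: "F (n - 1 - m) Y" "(d ^^ (2 * m)) Y = X"
      using d_power_surjective X m by blast
    have "F (Suc (n - 1 - m) + 2 * m) ((d ^^ (2 * m)) (R Y))"
      by (intro F_d_power R_filtration_low Y) simp
    then have *: "F (Suc (n - 1 - m) + 2 * m) (R X)" by (simp add: d_power_R Y)
    show ?thesis by (rule F_mono[OF *]) (use m in simp)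
  next
    case False
    then have "F (2 * n - 1) X" using F_mono[OF X] m by simp
    then have "X = 0" by (rule F_top)
    then show ?thesis by simp
  qed
qed

end

section \<open>Weight zero: image and kernel\<close>

definition b0_kernel :: "nat \<Rightarrow> nat \<Rightarrow> nat \<Rightarrow> nat \<Rightarrow> 'a::field" where
  "b0_kernel p q i j = (if j + p = Suc (i + q) then if p \<le> q then if p \<le> i then 1 else 0
    else if i < p then - 1 else 0 else 0)"

text \<open>Reflection in the antidiagonal, the antiautomorphism that fixes the Jordan block and the
  bottom left unit while exchanging the first and last diagonal entries; transposition would turn
  the block upside down.\<close>

definition flip_imat :: "nat \<Rightarrow> 'a::field imat \<Rightarrow> 'a imat" where
  "flip_imat n X = IMat (\<lambda>i j. if i < n \<and> j < n then ent X (n - 1 - j) (n - 1 - i) else 0)"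

lemma flip_imat_apply: "ent (flip_imat n X) i j = (if i < n \<and> j < n then ent X (n - 1 - j) (n - 1 - i) else 0)"
  by (simp add: flip_imat_def)

lemma mat_iso_flip: "mat_iso n (flip_imat n) (flip_imat n)"
proof -
  have mult: "flip_imat n (mm n X Y) = mm n (flip_imat n Y) (flip_imat n X)" for X Y :: "'a imat"
  proof (rule imat_eqI)
    fix i j
    have "(\<Sum>k<n. ent X (n - 1 - j) k * ent Y k (n - 1 - i))
        = (\<Sum>k<n. ent Y (n - 1 - k) (n - 1 - i) * ent X (n - 1 - j) (n - 1 - k))"
      by (rule sum.reindex_bij_witness[of _ "\<lambda>k. n - 1 - k" "\<lambda>k. n - 1 - k"]) (auto simp: mult.commute)
    then show "ent (flip_imat n (mm n X Y)) i j = ent (mm n (flip_imat n Y) (flip_imat n X)) i j"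
      by (auto simp: flip_imat_apply mm_apply)
  qed
  show ?thesis
    unfolding mat_iso_def
    by (intro conjI allI disjI2 mult) (auto simp: imat_eq_iff flip_imat_apply cut_apply)
qed

context rb_matrix
begin

lemma Rpow_cut: "0 < m \<Longrightarrow> (R ^^ m) (cut n X) = (R ^^ m) X"
  by (cases m) (simp_all add: funpow_Suc_right R_cut del: funpow.simps)

text \<open>The identity writes the product as \<open>R\<close> of two products with one exponent
  lowered. For \<open>p = q\<close> the lowering reverses the order of the exponents, so both orders
  are proved together.\<close>

lemma product_in_image: "p \<le> q \<Longrightarrow> l = 0 \<Longrightarrow>
    (\<exists>Z. (R ^^ p) X \<odot> (R ^^ q) Y = (R ^^ p) Z) \<and> (\<exists>Z. (R ^^ q) X \<odot> (R ^^ p) Y = (R ^^ p) Z)"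
proof (induction "p + q" arbitrary: p q rule: less_induct)
  case less
  show ?case
  proof (cases p)
    case 0
    then show ?thesis by auto
  next
    case (Suc p')
    with less.prems obtain q' where q: "q = Suc q'" by (cases q) auto
    have 1: "\<exists>Z. R ((R ^^ p) X \<odot> (R ^^ q') Y) = (R ^^ p) Z"
    proof (cases "p \<le> q'")
      case True
      then obtain Z where "(R ^^ p) X \<odot> (R ^^ q') Y = (R ^^ p) Z" using less.hyps[of p q'] less.prems(2) q by auto
      then show ?thesis by (intro exI[of _ "R Z"]) (simp add: funpow_swap1)
    next
      case False
      then have "p = q" using less.prems q by simp
      then obtain Z where "(R ^^ p) X \<odot> (R ^^ q') Y = (R ^^ q') Z"
        using less.hyps[of q' p] less.prems Suc q by auto
      then show ?thesis using \<open>p = q\<close> q by (intro exI[of _ Z]) simp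
    qed
    have 2: "\<exists>Z. R ((R ^^ q') X \<odot> (R ^^ p) Y) = (R ^^ p) Z"
    proof (cases "p \<le> q'")
      case True
      then obtain Z where "(R ^^ q') X \<odot> (R ^^ p) Y = (R ^^ p) Z" using less.hyps[of p q'] less.prems(2) q by auto
      then show ?thesis by (intro exI[of _ "R Z"]) (simp add: funpow_swap1)
    next
      case False
      then have "p = q" using less.prems q by simp
      then obtain Z where "(R ^^ q') X \<odot> (R ^^ p) Y = (R ^^ q') Z"
        using less.hyps[of q' p] less.prems Suc q by auto
      then show ?thesis using \<open>p = q\<close> q by (intro exI[of _ Z]) simp
    qed
    have 3: "\<exists>Z. R ((R ^^ p') X \<odot> (R ^^ q) Y) = (R ^^ p) Z" "\<exists>Z. R ((R ^^ q) X \<odot> (R ^^ p') Y) = (R ^^ p) Z"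
    proof -
      have "p' + q < p + q" "p' \<le> q" using Suc less.prems by auto
      then obtain Z1 Z2 where "(R ^^ p') X \<odot> (R ^^ q) Y = (R ^^ p') Z1" "(R ^^ q) X \<odot> (R ^^ p') Y = (R ^^ p') Z2"
        using less.hyps[of p' q] less.prems(2) by blast
      then show "\<exists>Z. R ((R ^^ p') X \<odot> (R ^^ q) Y) = (R ^^ p) Z" "\<exists>Z. R ((R ^^ q) X \<odot> (R ^^ p') Y) = (R ^^ p) Z"
        using Suc by auto
    qed
    have "(R ^^ p) X \<odot> (R ^^ q) Y = R ((R ^^ p) X \<odot> (R ^^ q') Y) + R ((R ^^ p') X \<odot> (R ^^ q) Y)"
      using RB[of "(R ^^ p') X" "(R ^^ q') Y"] less.prems(2) Suc q by (simp add: R_add)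
    moreover have "(R ^^ q) X \<odot> (R ^^ p) Y = R ((R ^^ q) X \<odot> (R ^^ p') Y) + R ((R ^^ q') X \<odot> (R ^^ p) Y)"
      using RB[of "(R ^^ q') X" "(R ^^ p') Y"] less.prems(2) Suc q by (simp add: R_add)
    ultimately show ?thesis using 1 2 3 by (metis left.Rpow_add)
  qed
qed

text \<open>Modulo the image of \<open>R^(p+1)\<close>, a factor in the image of a higher power may
  be moved inside \<open>R^p\<close>; the other term of the identity is absorbed by
  \<open>product_in_image\<close>.\<close>

lemma product_leading_term:
  assumes "p < q" "l = 0"
  shows "\<exists>Z. (R ^^ p) X \<odot> (R ^^ q) Y = (R ^^ p) (X \<odot> (R ^^ q) Y) + (R ^^ Suc p) Z"
    and "\<exists>Z. (R ^^ q) X \<odot> (R ^^ p) Y = (R ^^ p) ((R ^^ q) X \<odot> Y) + (R ^^ Suc p) Z"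
proof -
  have "(\<exists>Z. (R ^^ p) X \<odot> (R ^^ q) Y = (R ^^ p) (X \<odot> (R ^^ q) Y) + (R ^^ Suc p) Z) \<and>
      (\<exists>Z. (R ^^ q) X \<odot> (R ^^ p) Y = (R ^^ p) ((R ^^ q) X \<odot> Y) + (R ^^ Suc p) Z)"
    using assms(1)
  proof (induction p)
    case 0
    show ?case by (auto intro: exI[of _ 0])
  next
    case (Suc p)
    then obtain q' where q: "q = Suc q'" "Suc p \<le> q'" by (cases q) auto
    obtain Z1 Z2 where Z: "(R ^^ p) X \<odot> (R ^^ q) Y = (R ^^ p) (X \<odot> (R ^^ q) Y) + (R ^^ Suc p) Z1"
      "(R ^^ q) X \<odot> (R ^^ p) Y = (R ^^ p) ((R ^^ q) X \<odot> Y) + (R ^^ Suc p) Z2"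
      using Suc by auto
    obtain U1 U2 where U: "(R ^^ Suc p) X \<odot> (R ^^ q') Y = (R ^^ Suc p) U1"
      "(R ^^ q') X \<odot> (R ^^ Suc p) Y = (R ^^ Suc p) U2"
      using product_in_image[OF q(2) assms(2), of X Y] by blast
    have "(R ^^ Suc p) X \<odot> (R ^^ q) Y = R ((R ^^ Suc p) X \<odot> (R ^^ q') Y) + R ((R ^^ p) X \<odot> (R ^^ q) Y)"
      using RB[of "(R ^^ p) X" "(R ^^ q') Y"] assms(2) q by (simp add: R_add)
    also have "\<dots> = (R ^^ Suc p) (X \<odot> (R ^^ q) Y) + (R ^^ Suc (Suc p)) (U1 + Z1)"
      unfolding U Z by (simp add: R_add left.Rpow_add)
    finally have 1: "(R ^^ Suc p) X \<odot> (R ^^ q) Y = (R ^^ Suc p) (X \<odot> (R ^^ q) Y) + (R ^^ Suc (Suc p)) (U1 + Z1)" .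
    have "(R ^^ q) X \<odot> (R ^^ Suc p) Y = R ((R ^^ q) X \<odot> (R ^^ p) Y) + R ((R ^^ q') X \<odot> (R ^^ Suc p) Y)"
      using RB[of "(R ^^ q') X" "(R ^^ p) Y"] assms(2) q by (simp add: R_add)
    also have "\<dots> = (R ^^ Suc p) ((R ^^ q) X \<odot> Y) + (R ^^ Suc (Suc p)) (U2 + Z2)"
      unfolding U Z by (simp add: R_add left.Rpow_add)
    finally show ?case using 1 by blast
  qed
  then show "\<exists>Z. (R ^^ p) X \<odot> (R ^^ q) Y = (R ^^ p) (X \<odot> (R ^^ q) Y) + (R ^^ Suc p) Z"
    and "\<exists>Z. (R ^^ q) X \<odot> (R ^^ p) Y = (R ^^ p) ((R ^^ q) X \<odot> Y) + (R ^^ Suc p) Z" by blast+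
qed

lemma product_leading_term_equal:
  assumes "0 < q" "l = 0"
  obtains Z where "(R ^^ q) X \<odot> (R ^^ q) Y = (R ^^ q) ((R ^^ q) X \<odot> Y + X \<odot> (R ^^ q) Y) + (R ^^ Suc q) Z"
proof -
  obtain p where q: "q = Suc p" using assms(1) by (cases q) auto
  obtain Z1 Z2 where Z: "(R ^^ p) X \<odot> (R ^^ q) Y = (R ^^ p) (X \<odot> (R ^^ q) Y) + (R ^^ Suc p) Z1"
    "(R ^^ q) X \<odot> (R ^^ p) Y = (R ^^ p) ((R ^^ q) X \<odot> Y) + (R ^^ Suc p) Z2"
    using product_leading_term[of p q X Y] q assms(2) by blast
  have "(R ^^ q) X \<odot> (R ^^ q) Y = R ((R ^^ q) X \<odot> (R ^^ p) Y) + R ((R ^^ p) X \<odot> (R ^^ q) Y)"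
    using RB[of "(R ^^ p) X" "(R ^^ p) Y"] assms(2) q by (simp add: R_add)
  also have "\<dots> = (R ^^ q) ((R ^^ q) X \<odot> Y + X \<odot> (R ^^ q) Y) + (R ^^ Suc q) (Z1 + Z2)"
    unfolding Z by (simp add: q R_add left.Rpow_add)
  finally show thesis by (rule that)
qed

end

section \<open>The orbit of the bottom left corner\<close>

context rb_jordan
begin

abbreviation corner :: "'a imat" where "corner \<equiv> eu (n - 1) 0"

definition g :: "nat \<Rightarrow> 'a imat" where "g m = (R ^^ m) corner"

lemma cut_corner: "cut n corner = corner"
  using n_ge_2 by simp

lemma Rpow_filtration: "F D X \<Longrightarrow> F (D + m) ((R ^^ m) X)"
  by (induction m) (auto intro: R_filtration)

lemma Rpow_filtration': "0 < m \<Longrightarrow> F m ((R ^^ m) X)"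
  using Rpow_filtration[of 0 "cut n X" m] by (simp add: F_0 Rpow_cut)

lemma g_filtration: "F m (g m)"
  using Rpow_filtration[of 0 corner m] cut_corner by (simp add: F_0 g_def)

lemma cut_g [simp]: "cut n (g m) = g m"
  using F_cut g_filtration by blast

lemma g_Suc: "g (Suc m) = R (g m)" "g (Suc m) = (R ^^ m) (R corner)"
  by (simp_all add: g_def funpow_swap1)

lemma corner_expand: "cut n X = X \<Longrightarrow> F 1 (X - sc (ent X (n - 1) 0) corner)"
  unfolding in_filtration_def
proof (intro allI impI)
  fix i j assume X: "cut n X = X" and nz: "ent (X - sc (ent X (n - 1) 0) corner) i j \<noteq> 0"
  have "ent X i j = 0" if "\<not> (i < n \<and> j < n)" using X that by (metis cut_apply)
  then have ij: "i < n" "j < n" using nz n_ge_2 by (auto simp: eu_apply split: if_splits)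
  moreover have "\<not> (i = n - 1 \<and> j = 0)" using nz by (cases "j = 0") (auto simp: eu_apply)
  ultimately show "i < n \<and> j < n \<and> 1 + i < n + j" by linarith
qed

lemma g_top_nonzero: "g (2 * n - 2) \<noteq> 0"
proof
  assume zero: "g (2 * n - 2) = 0"
  obtain X where X: "cut n X = X" "(R ^^ (2 * n - 2)) X \<noteq> 0" using R_top by blast
  have "1 + (2 * n - 2) = 2 * n - 1" using n_ge_2 by simp
  then have "F (2 * n - 1) ((R ^^ (2 * n - 2)) (X - sc (ent X (n - 1) 0) corner))"
    using Rpow_filtration[OF corner_expand[OF X(1)], of "2 * n - 2"] by metis
  then have "(R ^^ (2 * n - 2)) (X - sc (ent X (n - 1) 0) corner) = 0" by (rule F_top)
  then show False using zero X(2) by (simp add: left.Rpow_diff left.Rpow_scale g_def)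
qed

text \<open>A premature gain in the filtration would, after the remaining applications of
  \<open>R\<close>, put \<open>g (2 * n - 2)\<close> into \<open>F (2 * n - 1)\<close>, which is
  zero.\<close>

lemma g_order: "m \<le> 2 * n - 2 \<Longrightarrow> \<not> F (Suc m) (g m)"
proof
  assume m: "m \<le> 2 * n - 2" and F: "F (Suc m) (g m)"
  have "Suc m + (2 * n - 2 - m) = 2 * n - 1" using m n_ge_2 by simp
  then have "F (2 * n - 1) ((R ^^ (2 * n - 2 - m)) (g m))" using Rpow_filtration[OF F] by metis
  moreover have "(R ^^ (2 * n - 2 - m)) (g m) = (R ^^ (2 * n - 2 - m + m)) corner"
    by (simp only: g_def funpow_add comp_apply)
  moreover have "2 * n - 2 - m + m = 2 * n - 2" using m by simp
  ultimately have "F (2 * n - 1) (g (2 * n - 2))" by (simp only: g_def)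
  then show False using F_top g_top_nonzero by blast
qed

lemma a_Rpow: "a \<odot> (R ^^ m) X = (R ^^ m) (a \<odot> X) + sc (of_nat m) ((R ^^ Suc m) X)"
  using left.L_RS[of m 0 X] by (simp add: left.RS_def left.S_def funpow_swap1)

lemma Rpow_a: "(R ^^ m) X \<odot> a = (R ^^ m) (X \<odot> a) + sc (of_nat m) ((R ^^ Suc m) X)"
  using right.L_RS[of m 0 X] by (simp add: right.RS_def right.S_def funpow_swap1)

definition al :: 'a where "al = ent (R corner) (n - 2) 0"
definition be :: 'a where "be = ent (R corner) (n - 1) 1"

lemma R_corner_leading: "F 2 (R corner - sc al (a \<odot> corner) - sc be (corner \<odot> a))"
  unfolding in_filtration_def
proof (intro allI impI)
  fix i j
  let ?X = "R corner - sc al (a \<odot> corner) - sc be (corner \<odot> a)"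
  assume nz: "ent ?X i j \<noteq> 0"
  have F1: "F 1 (R corner)" using g_filtration[of 1] by (simp add: g_def)
  have "F 1 (a \<odot> corner)" "F 1 (corner \<odot> a)"
    using F_a_left[of 0 corner] F_a_right[of 0 corner] cut_corner by (simp_all add: F_0)
  then have "F 1 ?X" using F1 by (intro F_diff F_sc)
  then have ij: "i < n" "j < n" "1 + i < n + j" using nz by (auto simp: in_filtration_def)
  moreover have "2 + i \<noteq> n + j"
  proof
    assume eq: "2 + i = n + j"
    then have "(i = n - 2 \<and> j = 0) \<or> (i = n - 1 \<and> j = 1)" using ij by auto
    moreover have "Suc (n - 2) = n - 1" using n_ge_2 by simp
    ultimately show False
      using nz n_ge_2 by (auto simp: a_left a_right eu_apply al_def be_def)
  qed
  ultimately show "i < n \<and> j < n \<and> 2 + i < n + j" by auto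
qed

text \<open>Modulo \<open>F 2\<close>, \<open>R corner\<close> is \<open>al\<close> times
  \<open>a corner\<close> plus \<open>be\<close> times \<open>corner a\<close>. Applying
  \<open>R^m\<close> and commuting \<open>a\<close> past it produces the factor
  \<open>1 + m (al + be)\<close>.\<close>

lemma g_recursion:
  "F (m + 2) (sc (1 + of_nat m * (al + be)) (g (Suc m)) - sc al (a \<odot> g m) - sc be (g m \<odot> a))"
proof -
  have "F (2 + m) ((R ^^ m) (R corner - sc al (a \<odot> corner) - sc be (corner \<odot> a)))"
    by (rule Rpow_filtration[OF R_corner_leading])
  moreover have "(R ^^ m) (R corner - sc al (a \<odot> corner) - sc be (corner \<odot> a))
      = g (Suc m) - sc al (a \<odot> g m - sc (of_nat m) (g (Suc m))) - sc be (g m \<odot> a - sc (of_nat m) (g (Suc m)))"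
    by (simp add: left.Rpow_diff left.Rpow_scale g_def a_Rpow Rpow_a funpow_swap1)
  moreover have "\<dots> = sc (1 + of_nat m * (al + be)) (g (Suc m)) - sc al (a \<odot> g m) - sc be (g m \<odot> a)"
    by (simp add: imat_eq_iff algebra_simps)
  ultimately show ?thesis by (simp add: add.commute)
qed

text \<open>With \<open>q = n - 1\<close>, let \<open>u\<close> and \<open>v\<close> be the last and
  first diagonal entries of \<open>g q\<close>. Modulo the image of \<open>R^n\<close>, the square
  of \<open>g q\<close> is \<open>R^q\<close> of a matrix with corner entry \<open>u + v\<close>;
  comparing last diagonal entries gives \<open>u^2 = (u + v) u\<close>.\<close>

lemma corner_entries: "ent (g (n - 1)) (n - 1) (n - 1) * ent (g (n - 1)) 0 0 = 0"
proof -
  define q where "q = n - 1"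
  have q: "0 < q" using n_ge_2 by (simp add: q_def)
  define W where "W = g q \<odot> corner + corner \<odot> g q"
  obtain Z where "g q \<odot> g q = (R ^^ q) W + (R ^^ Suc q) Z"
    using product_leading_term_equal[OF q, of corner corner] unfolding g_def W_def by blast
  then have eq: "ent (g q \<odot> g q) q q = ent ((R ^^ q) W) q q + ent ((R ^^ Suc q) Z) q q" by simp
  have z: "ent X q q = 0" if "F n X" for X
    using that n_ge_2 unfolding in_filtration_def q_def by force
  have "F n ((R ^^ Suc q) Z)" using Rpow_filtration'[of "Suc q" Z] n_ge_2 by (simp add: q_def)
  then have 1: "ent ((R ^^ Suc q) Z) q q = 0" by (rule z)
  have "cut n W = W" unfolding W_def by (simp only: cut_add cut_mm cut_g cut_corner)
  then have "F (1 + q) ((R ^^ q) (W - sc (ent W q 0) corner))"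
    unfolding q_def by (intro Rpow_filtration corner_expand)
  then have "F n ((R ^^ q) (W - sc (ent W q 0) corner))" using n_ge_2 by (simp add: q_def)
  then have "ent ((R ^^ q) (W - sc (ent W q 0) corner)) q q = 0" by (rule z)
  then have 2: "ent ((R ^^ q) W) q q = ent W q 0 * ent (g q) q q"
    by (simp add: left.Rpow_diff left.Rpow_scale g_def)
  have "ent W q 0 = ent (g q) q q + ent (g q) 0 0"
    unfolding W_def using n_ge_2 by (simp add: mm_eu_left mm_eu_right q_def)
  moreover have "ent (g q \<odot> g q) q q = ent (g q) q q * ent (g q) q q"
  proof -
    have "ent (g q) q k = 0" if "k \<noteq> q" for k
      using g_filtration[of q] that n_ge_2 unfolding in_filtration_def q_def by force
    then have "(\<Sum>k<n. ent (g q) q k * ent (g q) k q) = (\<Sum>k<n. if k = q then ent (g q) q q * ent (g q) q q else 0)"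
      by (intro sum.cong refl) auto
    then show ?thesis using n_ge_2 by (simp add: mm_apply q_def)
  qed
  ultimately have "ent (g q) q q * ent (g q) 0 0 = 0"
    using eq 1 2 by (simp add: algebra_simps)
  then show ?thesis by (simp add: q_def)
qed

end

text \<open>By \<open>corner_entries\<close> one of two entries vanishes; the reflection in the antidiagonal exchanges them, so
  that one may assume it is the first.\<close>

locale rb_left = rb_jordan +
  assumes corner_zero: "ent ((R ^^ (n - 1)) (eu (n - 1) 0)) (n - 1) (n - 1) = 0"
begin

text \<open>With \<open>be\<close> nonzero the recursion would keep the entry of \<open>g m\<close>
  in the last row and column \<open>m\<close> nonzero up to \<open>m = n - 1\<close>, where it is
  zero by \<open>corner_zero\<close>.\<close>

lemma be_zero: "be = 0"
proof (rule ccontr)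
  assume be: "be \<noteq> 0"
  have "ent (g m) (n - 1) m \<noteq> 0" if "m \<le> n - 1" for m
    using that
  proof (induction m)
    case 0
    show ?case by (simp add: g_def eu_apply)
  next
    case (Suc m)
    let ?X = "sc (1 + of_nat m * (al + be)) (g (Suc m)) - sc al (a \<odot> g m) - sc be (g m \<odot> a)"
    have "ent ?X (n - 1) (Suc m) = 0"
      using g_recursion[of m] n_ge_2 unfolding in_filtration_def by force
    then have "(1 + of_nat m * (al + be)) * ent (g (Suc m)) (n - 1) (Suc m) = be * ent (g m) (n - 1) m"
      using Suc.prems n_ge_2 by (simp add: a_left a_right)
    then show ?case using be Suc by auto
  qed
  then show False using corner_zero by (simp add: g_def)
qed

lemma al_nonzero: "al \<noteq> 0"
proof
  assume "al = 0"
  then have "F (Suc 1) (g 1)" using g_recursion[of 0] by (simp add: be_zero numeral_2_eq_2)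
  moreover have "1 \<le> 2 * n - 2" using n_ge_2 by linarith
  ultimately show False using g_order by blast
qed

text \<open>As \<open>be = 0\<close>, only left multiplication by \<open>a\<close> remains in the
  recursion, and it moves the leading unit up the first column. The factor \<open>t\<close> cannot
  vanish: a nonzero multiple of that unit would otherwise lie too deep in the filtration.\<close>

lemma g_leading: "m \<le> n - 1 \<Longrightarrow> \<exists>A. A \<noteq> 0 \<and> F (Suc m) (g m - sc A (eu (n - 1 - m) 0))"
proof (induction m)
  case 0
  show ?case by (rule exI[of _ 1]) (simp add: g_def)
next
  case (Suc m)
  then obtain A where A: "A \<noteq> 0" "F (Suc m) (g m - sc A (eu (n - 1 - m) 0))" by auto
  define t where "t = 1 + of_nat m * al"
  have "F (Suc (Suc m)) (sc al (a \<odot> (g m - sc A (eu (n - 1 - m) 0))))"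
    by (intro F_sc F_a_left A)
  moreover have "a \<odot> eu (n - 1 - m) 0 = eu (n - 1 - Suc m) 0"
    using Suc.prems n_ge_2 by (auto simp: imat_eq_iff a_left eu_apply)
  ultimately have "F (Suc (Suc m)) (sc al (a \<odot> g m) - sc (al * A) (eu (n - 1 - Suc m) 0))"
    by (simp add: mm_simps sc.scale_right_diff_distrib)
  moreover have "F (Suc (Suc m)) (sc t (g (Suc m)) - sc al (a \<odot> g m))"
    using g_recursion[of m] by (simp add: be_zero t_def)
  ultimately have *: "F (Suc (Suc m)) (sc t (g (Suc m)) - sc (al * A) (eu (n - 1 - Suc m) 0))"
    using F_add by fastforce
  have "t \<noteq> 0"
  proof
    assume "t = 0"
    then have "F (Suc (Suc m)) (sc (al * A) (eu (n - 1 - Suc m) 0))"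
      using F_minus[OF *] by simp
    moreover have "ent (sc (al * A) (eu (n - 1 - Suc m) 0)) (n - 1 - Suc m) 0 \<noteq> 0"
      using al_nonzero A(1) by (simp add: eu_apply)
    ultimately have "Suc (Suc m) + (n - 1 - Suc m) < n + 0" unfolding in_filtration_def by blast
    then show False using Suc.prems by simp
  qed
  then have "F (Suc (Suc m)) (g (Suc m) - sc (al * A / t) (eu (n - 1 - Suc m) 0))"
    using F_sc[OF *, of "1 / t"] by (simp add: sc.scale_right_diff_distrib)
  then show ?case using \<open>t \<noteq> 0\<close> al_nonzero A(1) by (intro exI[of _ "al * A / t"]) simp
qed

text \<open>Otherwise let \<open>q\<close> be maximal such that \<open>R\<^sup>q\<close> has values with nonzero last row. Modulo the image of
  \<open>R\<^sup>q\<^sup>+\<^sup>1\<close>, the product \<open>R\<^sup>q(X) R\<^sup>q(Y)\<close> is \<open>R\<^sup>q(R\<^sup>q(X) Y + X R\<^sup>q(Y))\<close>; for \<open>Y = e\<^sub>n\<^sub>1\<close> and a suitable \<open>X\<close> the first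
  nonzero entry of the last row gives a contradiction.\<close>

lemma last_row_zero: "ent (R X) (n - 1) j = 0"
proof (rule ccontr)
  assume nz: "ent (R X) (n - 1) j \<noteq> 0"
  define P where "P q \<longleftrightarrow> 0 < q \<and> (\<exists>X j. ent ((R ^^ q) X) (n - 1) j \<noteq> 0)" for q
  have P1: "P 1" using nz by (auto simp: P_def)
  have P_bound: "q \<le> n - 1" if "P q" for q
  proof -
    obtain X j where "ent ((R ^^ q) X) (n - 1) j \<noteq> 0" "0 < q" using \<open>P q\<close> by (auto simp: P_def)
    then have "j < n \<and> q + (n - 1) < n + j"
      using Rpow_filtration'[of q X] by (auto simp: in_filtration_def)
    then show ?thesis by linarith
  qed
  define q where "q = (GREATEST q. P q)"
  have Pq: "P q" unfolding q_def using GreatestI_nat[of P 1 "n - 1"] P1 P_bound by blast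
  have max: "\<not> P q'" if "q < q'" for q'
  proof
    assume "P q'"
    then have "q' \<le> q" unfolding q_def using Greatest_le_nat[of P q' "n - 1"] P_bound by blast
    then show False using that by simp
  qed
  have q: "0 < q" "q \<le> n - 1" using Pq P_bound by (auto simp: P_def)
  have next0: "ent ((R ^^ Suc q) Y) (n - 1) j = 0" for Y j
    using max[of "Suc q"] unfolding P_def by blast
  define s where "s k = ent (g q) (n - 1) k" for k
  \<comment> \<open>In the last row, where \<open>R^(q+1)\<close> contributes nothing,
    \<open>R^q\<close> commutes with multiplication by \<open>a\<close> on either side. Since
    \<open>a Y\<close> has zero last row, only units of the last row count, and the rows they
    produce are shifts of \<open>s\<close>.\<close>
  have row_eu: "ent ((R ^^ q) (eu p r)) (n - 1) j = (if p = n - 1 \<and> r \<le> j then s (j - r) else 0)"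
    if "p < n" "r < n" "j < n" for p r j
  proof (cases "p = n - 1")
    case False
    then have "eu p r = a \<odot> eu (Suc p) r" using that by (auto simp: imat_eq_iff a_left eu_apply)
    then have "(R ^^ q) (eu p r) = a \<odot> (R ^^ q) (eu (Suc p) r) - sc (of_nat q) ((R ^^ Suc q) (eu (Suc p) r))"
      using a_Rpow[of q "eu (Suc p) r"] by simp
    then show ?thesis using False next0 n_ge_2 by (simp add: a_left del: funpow.simps)
  next
    case True
    have "ent ((R ^^ q) (eu (n - 1) r)) (n - 1) j = (if r \<le> j then s (j - r) else 0)" if "r < n" "j < n" for r j
      using that
    proof (induction r arbitrary: j)
      case 0
      then show ?case by (simp add: s_def g_def)
    next
      case (Suc r)
      have "eu (n - 1) (Suc r) = eu (n - 1) r \<odot> a"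
        using Suc.prems by (auto simp: imat_eq_iff a_right eu_apply)
      then have "(R ^^ q) (eu (n - 1) (Suc r)) = (R ^^ q) (eu (n - 1) r) \<odot> a - sc (of_nat q) ((R ^^ Suc q) (eu (n - 1) r))"
        using Rpow_a[of q "eu (n - 1) r"] by simp
      then have "ent ((R ^^ q) (eu (n - 1) (Suc r))) (n - 1) j
          = (if 0 < j then ent ((R ^^ q) (eu (n - 1) r)) (n - 1) (j - 1) else 0)"
        using next0 Suc.prems by (simp add: a_right del: funpow.simps)
      then show ?case using Suc.IH[of "j - 1"] Suc.prems by auto
    qed
    with True that show ?thesis by simp
  qed
  have row: "ent ((R ^^ q) Y) (n - 1) j = (\<Sum>r<n. ent Y (n - 1) r * (if r \<le> j then s (j - r) else 0))"
    if "j < n" for Y j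
  proof -
    have "(R ^^ q) Y = (\<Sum>p<n. \<Sum>r<n. sc (ent Y p r) ((R ^^ q) (eu p r)))"
      by (subst Rpow_cut[OF q(1), symmetric]) (simp add: cut_expand left.Rpow_sum left.Rpow_scale)
    then have "ent ((R ^^ q) Y) (n - 1) j
        = (\<Sum>p<n. \<Sum>r<n. ent Y p r * (if p = n - 1 \<and> r \<le> j then s (j - r) else 0))"
      using row_eu that by simp
    also have "\<dots> = (\<Sum>p<n. if p = n - 1 then \<Sum>r<n. ent Y (n - 1) r * (if r \<le> j then s (j - r) else 0) else 0)"
      by (intro sum.cong refl) auto
    finally show ?thesis using n_ge_2 by simp
  qed
  have "\<exists>k<n. s k \<noteq> 0"
  proof (rule ccontr)
    assume "\<not> (\<exists>k<n. s k \<noteq> 0)"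
    then have s0: "s k = 0" if "k < n" for k using that by blast
    obtain Y j where Y: "ent ((R ^^ q) Y) (n - 1) j \<noteq> 0" using Pq by (auto simp: P_def)
    have "F q ((R ^^ q) Y)" using Rpow_filtration' q by blast
    then have "j < n" using Y by (auto simp: in_filtration_def)
    then have "ent ((R ^^ q) Y) (n - 1) j = (\<Sum>r<n. 0)"
      unfolding row[OF \<open>j < n\<close>] by (intro sum.cong refl) (auto simp: s0)
    with Y show False by simp
  qed
  define i where "i = (LEAST k. s k \<noteq> 0)"
  obtain k0 where k0: "k0 < n" "s k0 \<noteq> 0" using \<open>\<exists>k<n. s k \<noteq> 0\<close> by blast
  have si: "s i \<noteq> 0" unfolding i_def by (rule LeastI[of "\<lambda>k. s k \<noteq> 0", OF k0(2)])
  have i_lt: "i < n" using Least_le[of "\<lambda>k. s k \<noteq> 0", OF k0(2)] k0(1) by (simp add: i_def)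
  have si_min: "s k = 0" if "k < i" for k
    using not_less_Least[of k "\<lambda>k. s k \<noteq> 0"] that by (simp add: i_def)
  obtain A where A: "A \<noteq> 0" "F (Suc q) (g q - sc A (eu (n - 1 - q) 0))" using g_leading q by blast
  have s_small: "s k = 0" if "k \<le> q" for k
  proof -
    have "ent (g q - sc A (eu (n - 1 - q) 0)) (n - 1) k = 0"
      using A(2) that n_ge_2 unfolding in_filtration_def by force
    moreover have "n - 1 \<noteq> n - 1 - q" using q by simp
    ultimately show ?thesis by (simp add: s_def eu_apply)
  qed
  then have iq: "q < i" using si not_le by blast
  \<comment> \<open>\<open>p\<close> is the row of the leading entry \<open>A\<close> of
    \<open>g q\<close>. For the unit \<open>?X\<close> the last row of \<open>R^q ?X\<close> is
    \<open>s\<close> shifted by \<open>p\<close>, hence zero because \<open>s\<close> vanishes up to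
    index \<open>q = n - 1 - p\<close>; but \<open>?X\<close> times \<open>g q\<close> has corner
    entry \<open>A\<close>. Column \<open>i\<close> of the last row then reads
    \<open>0 = A s_i\<close>.\<close>
  define p where "p = n - 1 - q"
  have p: "p < n" "p + q = n - 1" using q n_ge_2 by (auto simp: p_def)
  have gA: "ent (g q) p 0 = A"
  proof -
    have "ent (g q - sc A (eu (n - 1 - q) 0)) p 0 = 0"
      using A(2) p unfolding in_filtration_def by force
    then show ?thesis by (simp add: eu_apply p_def)
  qed
  let ?X = "eu (n - 1) p :: 'a imat"
  define W where "W = (R ^^ q) ?X \<odot> corner + ?X \<odot> g q"
  obtain Z where "(R ^^ q) ?X \<odot> g q = (R ^^ q) W + (R ^^ Suc q) Z"
    using product_leading_term_equal[OF q(1), of ?X corner] unfolding g_def W_def by blast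
  then have eq: "ent ((R ^^ q) ?X \<odot> g q) (n - 1) i = ent ((R ^^ q) W) (n - 1) i"
    using next0 by (simp del: funpow.simps)
  have row_X: "ent ((R ^^ q) ?X) (n - 1) k = (if p \<le> k then s (k - p) else 0)" if "k < n" for k
    using row_eu[of "n - 1" p k] p that by simp
  have "ent ((R ^^ q) ?X \<odot> g q) (n - 1) i = 0"
    unfolding mm_apply
  proof (rule sum.neutral, rule ballI)
    fix k assume "k \<in> {..<n}"
    then have "ent ((R ^^ q) ?X) (n - 1) k = 0" using row_X[of k] p s_small[of "k - p"] by auto
    then show "ent ((R ^^ q) ?X) (n - 1) k * ent (g q) k i = 0" by simp
  qed
  moreover have "ent ((R ^^ q) W) (n - 1) i = ent W (n - 1) 0 * s i"
  proof -
    have "ent ((R ^^ q) W) (n - 1) i = (\<Sum>r<n. if r = 0 then ent W (n - 1) 0 * s i else 0)"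
      unfolding row[OF i_lt] by (intro sum.cong refl) (auto simp: si_min)
    then show ?thesis using n_ge_2 by simp
  qed
  moreover have "ent W (n - 1) 0 = A"
  proof -
    have "ent ((R ^^ q) ?X) (n - 1) (n - 1) = 0"
      using row_X[of "n - 1"] p s_small[of "n - 1 - p"] n_ge_2 by simp
    then show ?thesis using p n_ge_2 by (simp add: W_def mm_eu_left mm_eu_right gA)
  qed
  ultimately show False using eq A(1) si by simp
qed

end

section \<open>Image and kernel of R after the reflection\<close>

context rb_left
begin

lemma image_a:
  assumes "Z \<in> range R"
  shows "a \<odot> Z \<in> range R" "Z \<odot> a \<in> range R"
proof -
  obtain X where "Z = R X" using assms by blast
  then have "a \<odot> Z = R (a \<odot> X + R X)" "Z \<odot> a = R (X \<odot> a + R X)"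
    by (simp_all add: mm_a_R R_mm_a R_add)
  then show "a \<odot> Z \<in> range R" "Z \<odot> a \<in> range R" by auto
qed

lemma image_sc: "Z \<in> range R \<Longrightarrow> sc c Z \<in> range R"
  by (auto simp: R_sc[symmetric])

lemma image_add: "Y \<in> range R \<Longrightarrow> Z \<in> range R \<Longrightarrow> Y + Z \<in> range R"
  by (auto simp: R_add[symmetric])

lemma image_sum: "(\<And>i. i \<in> A \<Longrightarrow> f i \<in> range R) \<Longrightarrow> sum f A \<in> range R"
proof (induction A rule: infinite_finite_induct)
  case (insert x A)
  then show ?case by (simp add: image_add)
qed (use left.R_zero in \<open>metis rangeI sum.infinite sum.empty\<close>)+

lemma image_shift:
  assumes "Z \<in> range R"
  shows "shift_mat n k \<odot> Z \<in> range R" "Z \<odot> shift_mat n k \<in> range R"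
proof -
  obtain X where X: "Z = R X" using assms by blast
  have id: "(shift_mat n 0 :: 'a imat) = idm n" by (auto simp: imat_eq_iff shift_mat_apply idm_apply)
  have cZ: "cut n Z = Z" by (simp add: X cut_R)
  show "shift_mat n k \<odot> Z \<in> range R"
  proof (induction k)
    case (Suc k)
    have "shift_mat n (Suc k) \<odot> Z = a \<odot> (shift_mat n k \<odot> Z)"
      by (simp add: a_jordan mm_assoc[symmetric] shift_mat_mult)
    then show ?case using image_a(1)[OF Suc] by simp
  qed (use assms cZ id in simp)
  show "Z \<odot> shift_mat n k \<in> range R"
  proof (induction k)
    case (Suc k)
    have "Z \<odot> shift_mat n (Suc k) = (Z \<odot> shift_mat n k) \<odot> a"
      by (simp add: a_jordan mm_assoc shift_mat_mult)
    then show ?case using image_a(2)[OF Suc] by simp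
  qed (use assms cZ id in simp)
qed

text \<open>The leading term of \<open>R corner\<close> is \<open>al\<close> times the unit at
  \<open>(n - 2, 0)\<close>. Powers of \<open>a\<close> on both sides move it to any position
  outside the last row without leaving the image.\<close>

definition image_unit :: "nat \<Rightarrow> nat \<Rightarrow> 'a imat" where
  "image_unit i j = sc (1 / al) (shift_mat n (n - 2 - i) \<odot> R corner \<odot> shift_mat n j)"

lemma image_unit_in_image: "image_unit i j \<in> range R"
  unfolding image_unit_def by (intro image_sc image_shift rangeI)

lemma image_unit_leading:
  assumes "i < n - 1" "j < n"
  shows "F (n - i + j) (image_unit i j - eu i j)"
proof -
  define Y where "Y = sc (1 / al) (R corner) - eu (n - 2) 0"
  have "a \<odot> corner = eu (n - 2) 0"
    using n_ge_2 by (auto simp: imat_eq_iff a_left eu_apply)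
  then have "Y = sc (1 / al) (R corner - sc al (a \<odot> corner) - sc be (corner \<odot> a))"
    using al_nonzero by (simp add: Y_def be_zero sc.scale_right_diff_distrib)
  then have FY: "F 2 Y" using F_sc[OF R_corner_leading] by simp
  have left: "F (D + k) (shift_mat n k \<odot> Z)" if "F D Z" for D k Z
    unfolding in_filtration_def
  proof (intro allI impI)
    fix r s assume "ent (shift_mat n k \<odot> Z) r s \<noteq> 0"
    then have r: "ent Z (r + k) s \<noteq> 0" by (auto simp: shift_mat_left split: if_splits)
    then have "r + k < n \<and> s < n \<and> D + (r + k) < n + s"
      using that unfolding in_filtration_def by blast
    then show "r < n \<and> s < n \<and> D + k + r < n + s" by auto
  qed
  have right: "F (D + k) (Z \<odot> shift_mat n k)" if "F D Z" for D k Z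
    unfolding in_filtration_def
  proof (intro allI impI)
    fix r s assume "ent (Z \<odot> shift_mat n k) r s \<noteq> 0"
    then have s: "k \<le> s" "s < n" "ent Z r (s - k) \<noteq> 0" by (auto simp: shift_mat_right split: if_splits)
    then have "r < n \<and> D + r < n + (s - k)" using that unfolding in_filtration_def by blast
    with s show "r < n \<and> s < n \<and> D + k + r < n + s" by auto
  qed
  have "F (2 + (n - 2 - i) + j) (shift_mat n (n - 2 - i) \<odot> Y \<odot> shift_mat n j)"
    by (intro left right FY)
  moreover have "2 + (n - 2 - i) + j = n - i + j" using assms n_ge_2 by simp
  moreover have "shift_mat n (n - 2 - i) \<odot> Y \<odot> shift_mat n j = image_unit i j - eu i j"
  proof -
    have "shift_mat n (n - 2 - i) \<odot> eu (n - 2) 0 = eu i 0"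
      using assms n_ge_2 by (auto simp: imat_eq_iff shift_mat_left eu_apply)
    moreover have "eu i 0 \<odot> shift_mat n j = eu i j"
      using assms by (auto simp: imat_eq_iff shift_mat_right eu_apply)
    ultimately show ?thesis by (simp add: Y_def image_unit_def mm_simps)
  qed
  ultimately show ?thesis by metis
qed

text \<open>The units \<open>e\<^sub>i\<^sub>j\<close> outside the last row are leading terms of elements of the image.\<close>

lemma image_eq:
  assumes "cut n Z = Z" "\<And>j. ent Z (n - 1) j = 0"
  shows "Z \<in> range R"
proof -
  have "F D Z \<Longrightarrow> (\<And>j. ent Z (n - 1) j = 0) \<Longrightarrow> Z \<in> range R" for D Z
  proof (induction "2 * n - 1 - D" arbitrary: D Z rule: less_induct)
    case less
    show ?case
    proof (cases "2 * n - 1 \<le> D")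
      case True
      then have "Z = 0" using F_top F_mono less.prems(1) by blast
      then show ?thesis using left.R_zero by (metis rangeI)
    next
      case False
      define lead where "lead i j = (if i < n - 1 \<and> n + j = Suc D + i then ent Z i j else 0)" for i j
      define V where "V = (\<Sum>i<n. \<Sum>j<n. sc (lead i j) (image_unit i j))"
      have V: "V \<in> range R" unfolding V_def by (intro image_sum image_sc image_unit_in_image)
      have "F (Suc D) (Z - V)"
      proof -
        define E where "E = (\<Sum>i<n. \<Sum>j<n. sc (lead i j) (eu i j))"
        have "E = cut n (IMat lead)" unfolding E_def cut_expand by simp
        then have E: "ent E i j = (if i < n \<and> j < n then lead i j else 0)" for i j
          by (simp add: cut_apply)
        have "F (Suc D) (Z - E)"
          unfolding in_filtration_def
        proof (intro allI impI)
          fix i j assume nz: "ent (Z - E) i j \<noteq> 0"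
          then have "ent Z i j \<noteq> 0" by (auto simp: E lead_def split: if_splits)
          then have ij: "i < n" "j < n" "D + i < n + j" "i \<noteq> n - 1"
            using less.prems unfolding in_filtration_def by auto
          moreover have "i < n - 1" using ij by linarith
          moreover have "n + j \<noteq> Suc D + i" using nz ij \<open>i < n - 1\<close> by (auto simp: E lead_def)
          ultimately show "i < n \<and> j < n \<and> Suc D + i < n + j" by linarith
        qed
        moreover have "F (Suc D) (V - E)"
        proof -
          have "F (Suc D) (sc (lead i j) (image_unit i j - eu i j))" if "i < n" "j < n" for i j
          proof (cases "i < n - 1 \<and> n + j = Suc D + i")
            case True
            then have "n - i + j = Suc D" by linarith
            then show ?thesis using image_unit_leading[of i j] True that by (metis F_sc)
          next
            case False
            then have "lead i j = 0" unfolding lead_def by (rule if_not_P)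
            then show ?thesis by simp
          qed
          moreover have "V - E = (\<Sum>i<n. \<Sum>j<n. sc (lead i j) (image_unit i j - eu i j))"
            by (simp add: V_def E_def sum_subtractf sc.scale_right_diff_distrib)
          ultimately show ?thesis by (metis (no_types, lifting) F_sum lessThan_iff)
        qed
        ultimately have "F (Suc D) ((Z - E) - (V - E))" by (rule F_diff)
        then show ?thesis by simp
      qed
      moreover have "ent (Z - V) (n - 1) j = 0" for j
        using V less.prems(2) last_row_zero by auto
      moreover have "2 * n - 1 - Suc D < 2 * n - 1 - D" using False by simp
      ultimately have "Z - V \<in> range R" using less.hyps by blast
      then have "(Z - V) + V \<in> range R" using V by (rule image_add)
      then show ?thesis by simp
    qed
  qed
  then show ?thesis using assms F_0 by blast
qed

lemma kernel_a: "R X = 0 \<Longrightarrow> R (a \<odot> X) = 0"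
  using mm_a_R[of X] by simp

lemma kernel_shift: "R X = 0 \<Longrightarrow> R (shift_mat n k \<odot> X) = 0"
proof (induction k)
  case 0
  have "(shift_mat n 0 :: 'a imat) = idm n" by (auto simp: imat_eq_iff shift_mat_apply idm_apply)
  then show ?case using 0 R_idm(1)[of X] by simp
next
  case (Suc k)
  have "shift_mat n (Suc k) \<odot> X = a \<odot> (shift_mat n k \<odot> X)"
    by (simp add: a_jordan mm_assoc[symmetric] shift_mat_mult)
  then show ?case using kernel_a Suc by simp
qed

text \<open>\<open>g (n - 1)\<close> is a multiple of this unit modulo \<open>F n\<close>; if
  \<open>R\<close> annihilated the unit, \<open>g n\<close> would lie in \<open>F (n + 1)\<close>,
  against \<open>g_order\<close>.\<close>

lemma R_eu_0_0: "R (eu 0 0) \<noteq> 0"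
proof
  assume zero: "R (eu 0 0) = 0"
  obtain A where A: "F (Suc (n - 1)) (g (n - 1) - sc A (eu (n - 1 - (n - 1)) 0))"
    using g_leading[of "n - 1"] by blast
  have "F (Suc (Suc (n - 1))) (R (g (n - 1) - sc A (eu (n - 1 - (n - 1)) 0)))" by (rule R_filtration[OF A])
  then have "F (Suc (Suc (n - 1))) (g (Suc (n - 1)))"
    using zero by (simp add: left.R_diff R_sc g_Suc(1))
  moreover have "Suc (n - 1) \<le> 2 * n - 2" using n_ge_2 by linarith
  ultimately show False using g_order by blast
qed

text \<open>For \<open>R Y = eu j 0\<close> the identity shows that \<open>X\<close> times
  \<open>eu j 0\<close> is again in the kernel, which moves column \<open>j\<close> to column 0. A
  power of \<open>a\<close> then lifts the lowest nonzero entry to position \<open>(0, 0)\<close>.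
  The last column is exempt since \<open>eu (n - 1) 0\<close> is not in the image.\<close>

lemma kernel_columns:
  assumes "cut n X = X" "R X = 0" "j < n - 1"
  shows "ent X i j = 0"
proof (rule ccontr)
  assume nz: "ent X i j \<noteq> 0"
  have out: "ent X r s = 0" if "\<not> (r < n \<and> s < n)" for r s using assms(1) that by (metis cut_apply)
  have "eu j 0 \<in> range R" by (rule image_eq) (use assms(3) in \<open>auto simp: eu_apply\<close>)
  then obtain Y where Y: "R Y = eu j 0" unfolding image_iff by metis
  have K: "R (X \<odot> eu j 0) = 0"
    using RB[of X Y] assms(2) by (simp add: Y[symmetric])
  define s where "s = (GREATEST i. ent X i j \<noteq> 0)"
  have bound: "r \<le> n" if "ent X r j \<noteq> 0" for r using out[of r j] that by (metis less_imp_le)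
  have s: "ent X s j \<noteq> 0" unfolding s_def
    using GreatestI_nat[of "\<lambda>i. ent X i j \<noteq> 0" i n] nz bound by blast
  have s_max: "r \<le> s" if "ent X r j \<noteq> 0" for r unfolding s_def
    using Greatest_le_nat[of "\<lambda>i. ent X i j \<noteq> 0" r n] that bound by blast
  have "s < n" using s out by blast
  have "shift_mat n s \<odot> (X \<odot> eu j 0) = sc (ent X s j) (eu 0 0)"
  proof (rule imat_eqI)
    fix r t
    have "ent X (r + s) j = 0" if "r \<noteq> 0" using s_max[of "r + s"] that by auto
    then show "ent (shift_mat n s \<odot> (X \<odot> eu j 0)) r t = ent (sc (ent X s j) (eu 0 0)) r t"
      using assms(3) \<open>s < n\<close> by (auto simp: shift_mat_left mm_eu_right eu_apply)
  qed
  then have "sc (ent X s j) (R (eu 0 0)) = 0" using kernel_shift[OF K, of s] by (simp add: R_sc)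
  then show False using s R_eu_0_0 by simp
qed

text \<open>Up to the last column, \<open>R\<close> inverts the derivation \<open>X \<mapsto> w X - X w\<close>.\<close>

lemma derivation_matrix:
  obtains w where "cut n w = w" "\<And>r. ent w r (n - 1) = 0"
    "\<And>Y r i. cut n Y = Y \<Longrightarrow> i < n - 1 \<Longrightarrow> ent Y r i = ent (w \<odot> R Y - R Y \<odot> w) r i"
proof -
  have "\<exists>y. R y = eu i 0 \<and> cut n y = y" if "i < n - 1" for i
  proof -
    have "eu i 0 \<in> range R" by (rule image_eq) (use that in \<open>auto simp: eu_apply\<close>)
    then obtain y where "R y = eu i 0" unfolding image_iff by metis
    then show ?thesis by (intro exI[of _ "cut n y"]) (simp add: R_cut)
  qed
  then obtain y where y: "\<And>i. i < n - 1 \<Longrightarrow> R (y i) = eu i 0" "\<And>i. i < n - 1 \<Longrightarrow> cut n (y i) = y i"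
    by metis
  \<comment> \<open>Column \<open>i\<close> of \<open>w\<close> is the first column of a preimage of
    \<open>eu i 0\<close>; the last column, for which there is no preimage, is set to zero.\<close>
  define w where "w = cut n (IMat (\<lambda>r i. if i < n - 1 then ent (y i) r 0 else 0))"
  have w: "ent w r i = (if r < n \<and> i < n - 1 then ent (y i) r 0 else 0)" for r i
    by (auto simp: w_def cut_apply)
  have "ent Y r i = ent (w \<odot> R Y - R Y \<odot> w) r i" if Y: "cut n Y = Y" and i: "i < n - 1" for Y r i
  proof (cases "r < n")
    case False
    then have "ent Y r k = 0" "ent (R Y) r k = 0" for k
      using Y cut_R[of Y] by (metis cut_apply)+
    with False show ?thesis by (simp add: mm_apply w)
  next
    case r: True
    define X where "X = R Y"
    \<comment> \<open>With \<open>X = R Y\<close>, the first two terms together and the sum have the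
      same image under \<open>R\<close>, namely \<open>X\<close> times \<open>eu i 0\<close>. So
      \<open>V\<close> lies in the kernel, and its column 0 vanishes; this column is the desired
      equation.\<close>
    define V where "V = X \<odot> y i + Y \<odot> eu i 0 - (\<Sum>k<n - 1. sc (ent X k i) (y k))"
    have cX: "cut n X = X" by (simp add: X_def cut_R)
    have last: "ent X (n - 1) j = 0" for j unfolding X_def by (rule last_row_zero)
    have sum_n: "(\<Sum>k<n. f k) = (\<Sum>k<n - 1. f k) + f (n - 1)" for f :: "nat \<Rightarrow> 'a"
      using n_ge_2 by (metis Suc_pred' lessThan_Suc_atMost less_le_trans pos2 sum.lessThan_Suc)
    have "R (X \<odot> y i + Y \<odot> eu i 0) = X \<odot> eu i 0"
      using RB[of Y "y i"] y(1)[OF i] by (simp add: X_def)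
    also have "X \<odot> eu i 0 = (\<Sum>k<n - 1. sc (ent X k i) (eu k 0))"
    proof (rule imat_eqI)
      fix p q
      have "(\<Sum>k<n - 1. ent X k i * ent (eu k 0) p q) = (\<Sum>k<n - 1. if k = p then if q = 0 then ent X p i else 0 else 0)"
        by (intro sum.cong refl) (auto simp: eu_apply)
      also have "\<dots> = (if q = 0 then ent X p i else 0)"
      proof (cases "p < n - 1")
        case False
        then have "p = n - 1 \<or> \<not> p < n" by linarith
        then have "ent X p i = 0" using last[of i] cX by (metis cut_apply)
        then show ?thesis by simp
      qed simp
      finally show "ent (X \<odot> eu i 0) p q = ent (\<Sum>k<n - 1. sc (ent X k i) (eu k 0)) p q"
        using i by (simp add: mm_eu_right)
    qed
    also have "\<dots> = R (\<Sum>k<n - 1. sc (ent X k i) (y k))"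
      using y(1) by (simp add: left.R_sum R_sc)
    finally have "R V = 0" by (simp add: V_def left.R_diff)
    moreover have "cut n V = V"
      using y(2) i Y by (simp add: V_def cut_add cut_diff cut_mm cut_sum cut_sc cX)
    ultimately have "ent V r 0 = 0" using n_ge_2 by (intro kernel_columns) auto
    moreover have "ent (X \<odot> y i) r 0 = ent (X \<odot> w) r i" using i by (simp add: mm_apply w)
    moreover have "ent (Y \<odot> eu i 0) r 0 = ent Y r i" using i by (simp add: mm_eu_right)
    moreover have "(\<Sum>k<n - 1. ent X k i * ent (y k) r 0) = ent (w \<odot> X) r i"
      unfolding mm_apply sum_n by (simp add: w r mult.commute)
    ultimately have "ent (X \<odot> w) r i + ent Y r i - ent (w \<odot> X) r i = 0"
      by (simp add: V_def)
    then show ?thesis by (simp add: X_def algebra_simps)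
  qed
  then show thesis by (intro that[of w]) (simp_all add: w, simp add: w_def)
qed

end

lemma kernel_operator_apply:
  "ent (kernel_operator n b X) i j = (if i < n \<and> j < n then \<Sum>p<n. \<Sum>q<n. ent X p q * b p q i j else 0)"
  by (simp add: kernel_operator_def cut_apply)

lemma kernel_operator_b0_last_row: "ent (kernel_operator n b0_kernel X) (n - 1) j = 0"
proof (cases "j < n")
  case True
  have "b0_kernel p q (n - 1) j = (0 :: 'a)" if "p < n" "q < n" for p q
    using that True by (auto simp: b0_kernel_def)
  then show ?thesis by (simp add: kernel_operator_apply)
qed (simp add: kernel_operator_apply)

text \<open>This is the derivation equation for \<open>B_0\<close>, with minus the lower shift
  matrix in the place of \<open>w\<close>.\<close>

lemma kernel_operator_b0_shift:
  assumes "r < n" "Suc i < n"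
  shows "ent (kernel_operator n b0_kernel X) r (Suc i)
    - (if 0 < r then ent (kernel_operator n b0_kernel X) (r - 1) i else 0) = ent X r i"
proof -
  have b: "b0_kernel p q r (Suc i) - (if 0 < r then b0_kernel p q (r - 1) i else 0)
      = (if p = r \<and> q = i then 1 else (0 :: 'a))" for p q
    using assms by (auto simp: b0_kernel_def)
  have "ent (kernel_operator n b0_kernel X) r (Suc i)
      - (if 0 < r then ent (kernel_operator n b0_kernel X) (r - 1) i else 0)
      = (\<Sum>p<n. \<Sum>q<n. ent X p q * (b0_kernel p q r (Suc i) - (if 0 < r then b0_kernel p q (r - 1) i else 0)))"
    using assms by (simp add: kernel_operator_apply right_diff_distrib sum_subtractf)
  also have "\<dots> = (\<Sum>p<n. \<Sum>q<n. if p = r then if q = i then ent X r i else 0 else 0)"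
    unfolding b by (intro sum.cong refl) auto
  also have "\<dots> = (\<Sum>p<n. if p = r then ent X r i else 0)"
    using assms by (intro sum.cong refl) simp
  finally show ?thesis using assms by simp
qed

text \<open>The recursion propagates entries along diagonals: from the first column and from the last row.\<close>

lemma toeplitz_last_row_zero:
  assumes "cut n X = X" "\<And>j. ent X (n - 1) j = 0"
    and step: "\<And>r i. r < n \<Longrightarrow> Suc i < n \<Longrightarrow> ent X r (Suc i) = (if 0 < r then ent X (r - 1) i else 0)"
  shows "X = 0"
proof (rule imat_eqI)
  fix r c
  have down: "ent X (r + t) (c + t) = ent X r c" if "r + t < n" "c + t < n" for r c t
    using that
  proof (induction t)
    case (Suc t)
    then show ?case using step[of "Suc (r + t)" "c + t"] by simp
  qed simp
  show "ent X r c = ent 0 r c"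
  proof (cases "r < n \<and> c < n")
    case False
    then show ?thesis using assms(1) by (metis cut_apply ent_arith(1))
  next
    case True
    show ?thesis
    proof (cases "c \<le> r")
      case True
      then have "r + (n - 1 - r) = n - 1" "r + (n - 1 - r) < n" "c + (n - 1 - r) < n"
        using \<open>r < n \<and> c < n\<close> by linarith+
      then show ?thesis using down[of r "n - 1 - r" c] assms(2) by simp
    next
      case False
      then have "c - r < n" "Suc (c - r - 1) = c - r" "0 < n" using True by linarith+
      then have "ent X 0 (c - r) = 0" using step[of 0 "c - r - 1"] by simp
      then show ?thesis using down[of 0 r "c - r"] True False by simp
    qed
  qed
qed

section \<open>Conjugating the derivation to a shift\<close>

context rb_left
begin

theorem classification_left:
  obtains f h where "mat_iso n f h" "\<And>X. f (R (h X)) = kernel_operator n b0_kernel X"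
proof -
  obtain w where w: "cut n w = w" "\<And>r. ent w r (n - 1) = 0"
    and star: "\<And>Y r i. cut n Y = Y \<Longrightarrow> i < n - 1 \<Longrightarrow> ent Y r i = ent (w \<odot> R Y - R Y \<odot> w) r i"
    using derivation_matrix by blast
  \<comment> \<open>The future columns of the conjugating matrix: \<open>- w\<close> acts on them as
    the lower shift.\<close>
  define V where "V k = ((\<lambda>X. - (w \<odot> X)) ^^ k) (eu 0 0 :: 'a imat)" for k
  have V0: "V 0 = eu 0 0" and VS: "V (Suc k) = - (w \<odot> V k)" for k by (simp_all add: V_def)
  have cV: "cut n (V k) = V k" for k
    using n_ge_2 by (induction k) (simp_all add: V0 VS cut_minus cut_mm w(1))
  \<comment> \<open>Taking \<open>Y = 1\<close> in \<open>star\<close> gives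
    \<open>w a - a w = 1\<close> in every column but the last; this applies to \<open>X\<close>
    whose last row is zero.\<close>
  have comm: "(w \<odot> a - a \<odot> w) \<odot> X = X"
    if "cut n X = X" "\<And>r c. ent X r c \<noteq> 0 \<Longrightarrow> r < n - 1" for X
  proof (rule imat_eqI)
    fix r c
    have "(\<Sum>i<n. ent (w \<odot> a - a \<odot> w) r i * ent X i c) = (\<Sum>i<n. if i = r then ent X r c else 0)"
    proof (intro sum.cong refl)
      fix i assume "i \<in> {..<n}"
      show "ent (w \<odot> a - a \<odot> w) r i * ent X i c = (if i = r then ent X r c else 0)"
      proof (cases "ent X i c = 0")
        case False
        then have "i < n - 1" using that by blast
        then have "ent (w \<odot> a - a \<odot> w) r i = ent (idm n) r i"
          using star[of "idm n" i r] by (simp add: a_def)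
        moreover have "i < n" using \<open>i < n - 1\<close> by simp
        ultimately show ?thesis by (auto simp: idm_apply)
      qed auto
    qed
    moreover have "ent X r c = 0" if "\<not> r < n" using that \<open>cut n X = X\<close> by (metis cut_apply)
    ultimately show "ent ((w \<odot> a - a \<odot> w) \<odot> X) r c = ent X r c" by (auto simp: mm_apply)
  qed
  \<comment> \<open>By the canonical commutation relation \<open>a\<close> lowers \<open>V k\<close>
    to \<open>k\<close> times \<open>V (k - 1)\<close>. As \<open>a\<close> shifts rows upwards,
    this determines the rows of \<open>V k\<close> below the first, and makes the conjugating matrix
    upper triangular with diagonal entries \<open>k!\<close>.\<close>
  have V: "(\<forall>r c. ent (V k) r c \<noteq> 0 \<longrightarrow> r \<le> k \<and> c = 0) \<and> ent (V k) k 0 = fact k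
      \<and> a \<odot> V k = (if k = 0 then 0 else sc (of_nat k) (V (k - 1)))" if "k < n" for k
    using that
  proof (induction k)
    case 0
    have "a \<odot> V 0 = 0" by (auto simp: imat_eq_iff a_left eu_apply V0)
    then show ?case by (simp add: V0 eu_apply)
  next
    case (Suc k)
    have supp: "\<And>r c. ent (V k) r c \<noteq> 0 \<Longrightarrow> r \<le> k \<and> c = 0"
      and diag: "ent (V k) k 0 = fact k"
      and eig: "a \<odot> V k = (if k = 0 then 0 else sc (of_nat k) (V (k - 1)))"
      using Suc by auto
    have "(w \<odot> a - a \<odot> w) \<odot> V k = V k"
      by (rule comm[OF cV]) (use supp Suc.prems in fastforce)
    then have "a \<odot> V (Suc k) = V k - w \<odot> (a \<odot> V k)"
      by (simp add: VS mm_simps mm_assoc) (metis diff_eq_eq uminus_add_conv_diff)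
    also have "w \<odot> (a \<odot> V k) = - sc (of_nat k) (V k)"
      unfolding eig by (cases k) (simp_all add: mm_simps VS sc.scale_minus_right)
    finally have eigS: "a \<odot> V (Suc k) = sc (of_nat (Suc k)) (V k)"
      by (simp add: sc.scale_left_distrib)
    have ent_S: "ent (V (Suc k)) (Suc r) c = of_nat (Suc k) * ent (V k) r c" if "Suc r < n" for r c
      using arg_cong[OF eigS, of "\<lambda>X. ent X r c"] that by (simp add: a_left)
    have "r \<le> Suc k \<and> c = 0" if nz: "ent (V (Suc k)) r c \<noteq> 0" for r c
    proof
      have "r < n" using nz cV[of "Suc k"] by (metis cut_apply)
      then show "r \<le> Suc k" using nz ent_S[of "r - 1" c] supp[of "r - 1" c] by (cases r) auto
      show "c = 0"
      proof (rule ccontr)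
        assume "c \<noteq> 0"
        then have "ent (V k) i c = 0" for i using supp by blast
        then show False using nz by (simp add: VS mm_apply)
      qed
    qed
    moreover have "ent (V (Suc k)) (Suc k) 0 = fact (Suc k)"
      using ent_S[of k 0] Suc.prems diag by simp
    ultimately show ?case using eigS by simp
  qed
  define P where "P = cut n (IMat (\<lambda>r k. ent (V k) r 0))"
  have P: "ent P r k = (if r < n \<and> k < n then ent (V k) r 0 else 0)" for r k
    by (simp add: P_def cut_apply)
  have P_upper: "ent P r k = 0" if "k < r" for r k using V[of k] that
    by (metis P not_le)
  have P_diag: "ent P k k = fact k" if "k < n" for k using V[of k] that by (simp add: P)
  have cP: "cut n P = P" by (simp add: P_def)
  have ker: "v k = 0" if v: "\<And>i. i < n \<Longrightarrow> (\<Sum>k<n. ent P i k * v k) = 0" and k: "k < n" for v k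
    using k
  proof (induction "n - k" arbitrary: k rule: less_induct)
    case less
    have "(\<Sum>j<n. ent P k j * v j) = (\<Sum>j<n. if j = k then fact k * v k else 0)"
    proof (intro sum.cong refl)
      fix j assume j: "j \<in> {..<n}"
      show "ent P k j * v j = (if j = k then fact k * v k else 0)"
      proof (cases j k rule: linorder_cases)
        case greater
        then have "v j = 0" using less j by auto
        then show ?thesis using greater by simp
      qed (use P_upper P_diag less.prems in auto)
    qed
    then show ?case using v[OF less.prems] less.prems by simp
  qed
  obtain Q where Q: "cut n Q = Q" "P \<odot> Q = idm n" "Q \<odot> P = idm n"
    by (rule imat_inverse[OF cP]) (rule ker, assumption+)
  define f where "f X = Q \<odot> (cut n X \<odot> P)" for X
  define h where "h X = P \<odot> (cut n X \<odot> Q)" for X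
  have iso: "mat_iso n f h"
    unfolding f_def h_def by (rule mat_iso_conj[OF Q(2,3) cP Q(1)])
  note D = mat_isoD[OF iso]
  have f_diff: "f (X - Y) = f X - f Y" for X Y by (simp add: f_def cut_diff mm_simps)
  have f_mult: "f (X \<odot> Y) = f X \<odot> f Y" for X Y
  proof -
    have "f X \<odot> f Y = Q \<odot> (cut n X \<odot> ((P \<odot> Q) \<odot> (cut n Y \<odot> P)))" by (simp add: f_def mm_assoc)
    also have "\<dots> = Q \<odot> (cut n X \<odot> (cut n Y \<odot> P))"
      by (simp add: Q(2) cut_mm cP)
    also have "\<dots> = f (X \<odot> Y)" by (simp add: f_def cut_mm mm_assoc)
    finally show ?thesis by simp
  qed
  have fw: "ent (f w) r i = (if r = Suc i then - 1 else 0)" if "Suc i < n" for r i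
  proof -
    have "ent (w \<odot> P) s i = - ent P s (Suc i)" for s
    proof -
      have "ent (w \<odot> P) s i = (\<Sum>k<n. ent w s k * ent (V i) k 0)" using that by (simp add: mm_apply P)
      also have "\<dots> = - ent (V (Suc i)) s 0" by (simp add: VS mm_apply)
      also have "ent (V (Suc i)) s 0 = ent P s (Suc i)"
        using that cV[of "Suc i"] by (metis P cut_apply)
      finally show ?thesis .
    qed
    then have "ent (f w) r i = - ent (Q \<odot> P) r (Suc i)"
      by (simp add: f_def w(1) mm_apply[of n Q] sum_negf)
    then show ?thesis using that by (simp add: Q(3) idm_apply)
  qed
  \<comment> \<open>The last row of \<open>Q\<close> is concentrated on the diagonal, so a zero last
    row stays zero under the conjugation.\<close>
  have Q_last: "ent Q (n - 1) s = 0" if "s < n - 1" for s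
  proof -
    have "ent (P \<odot> Q) (n - 1) s = (\<Sum>k<n. if k = n - 1 then fact (n - 1) * ent Q (n - 1) s else 0)"
      unfolding mm_apply using P_upper[of _ "n - 1"] P_diag[of "n - 1"] n_ge_2
      by (intro sum.cong refl) auto
    then have "fact (n - 1) * ent Q (n - 1) s = 0"
      using that n_ge_2 by (simp add: Q(2) idm_apply)
    then show ?thesis by simp
  qed
  have "f (R (h Y)) = kernel_operator n b0_kernel Y" if Y: "cut n Y = Y" for Y
  proof -
    define X where "X = f (R (h Y))"
    have cX: "cut n X = X" by (simp add: X_def D)
    have last: "ent X (n - 1) j = 0" for j
    proof -
      have "ent (R (h Y) \<odot> P) (n - 1) j = 0"
        unfolding mm_apply last_row_zero by simp
      then show ?thesis
        unfolding X_def f_def mm_apply[of n Q] cut_R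
        by (intro sum.neutral ballI) (metis Q_last lessThan_iff mult_zero_left mult_zero_right n_ge_2
            Suc_pred' less_antisym pos2 less_le_trans)
    qed
    have eq: "ent X r (Suc i) - (if 0 < r then ent X (r - 1) i else 0) = ent Y r i"
      if r: "r < n" and i: "Suc i < n" for r i
    proof -
      \<comment> \<open>\<open>M\<close> is the failure of the derivation formula. It is confined to
        the last column, and right multiplication by the upper triangular \<open>P\<close> keeps it
        there.\<close>
      define M where "M = h Y - (w \<odot> R (h Y) - R (h Y) \<odot> w)"
      have M: "ent M s k = 0" if "k < n - 1" for s k
        using star[of "h Y" k s] that by (simp add: M_def D)
      have "cut n M = M" by (simp add: M_def cut_diff cut_mm cut_R D w(1))
      then have "ent (f M) r i = (\<Sum>s<n. ent Q r s * (\<Sum>k<n. ent M s k * ent P k i))"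
        by (simp add: f_def mm_apply)
      also have "\<dots> = 0"
      proof (intro sum.neutral ballI)
        fix s assume "s \<in> {..<n}"
        have "ent M s k * ent P k i = 0" if "k \<in> {..<n}" for k
          using M[of k s] P_upper[of i k] i that by (cases "k < n - 1") auto
        then show "ent Q r s * (\<Sum>k<n. ent M s k * ent P k i) = 0" by (simp add: sum.neutral)
      qed
      finally have fM0: "ent (f M) r i = 0" .
      have "f M = Y - (f w \<odot> X - X \<odot> f w)"
        by (simp add: M_def f_diff f_mult X_def D Y)
      then have 0: "ent Y r i = ent (f w \<odot> X) r i - ent (X \<odot> f w) r i"
        using fM0 by simp
      have 1: "ent (X \<odot> f w) r i = - ent X r (Suc i)"
      proof -
        have "(\<Sum>s<n. ent X r s * ent (f w) s i) = (\<Sum>s<n. if s = Suc i then - ent X r (Suc i) else 0)"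
          by (intro sum.cong refl) (auto simp: fw[OF i])
        then show ?thesis using i by (simp add: mm_apply)
      qed
      have 2: "ent (f w \<odot> X) r i = (if 0 < r then - ent X (r - 1) i else 0)"
      proof -
        have "(\<Sum>s<n. ent (f w) r s * ent X s i)
            = (\<Sum>s<n. if s = r - 1 then if 0 < r then - ent X (r - 1) i else 0 else 0)"
        proof (intro sum.cong refl)
          fix s assume s: "s \<in> {..<n}"
          show "ent (f w) r s * ent X s i = (if s = r - 1 then if 0 < r then - ent X (r - 1) i else 0 else 0)"
          proof (cases "s = n - 1")
            case True
            then show ?thesis using last[of i] r by auto
          next
            case False
            then have "Suc s < n" using s by auto
            then show ?thesis by (auto simp: fw)
          qed
        qed
        then show ?thesis using r by (auto simp: mm_apply)
      qed
      show ?thesis using 0 1 2 by auto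
    qed
    define Z where "Z = X - kernel_operator n b0_kernel Y"
    have "Z = 0"
    proof (rule toeplitz_last_row_zero)
      show "cut n Z = Z" by (simp add: Z_def cut_diff cX kernel_operator_def)
      show "ent Z (n - 1) j = 0" for j
        unfolding Z_def ent_arith last kernel_operator_b0_last_row by simp
      show "ent Z r (Suc i) = (if 0 < r then ent Z (r - 1) i else 0)" if "r < n" "Suc i < n" for r i
        using eq[OF that] kernel_operator_b0_shift[OF that, of Y] by (auto simp: Z_def algebra_simps)
    qed
    then show ?thesis by (simp add: Z_def X_def)
  qed
  moreover have "kernel_operator n b0_kernel (cut n X) = kernel_operator n b0_kernel X" for X :: "'a imat"
    by (simp add: imat_eq_iff kernel_operator_apply cut_apply)
  ultimately have "f (R (h X)) = kernel_operator n b0_kernel X" for X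
    by (metis D(6) cut_cut)
  then show thesis using that iso by blast
qed

end

section \<open>Weight zero: Jordan form\<close>

lemma (in rb_matrix) conj_power:
  assumes "mat_iso n f g" "cut n X = X"
  shows "((\<lambda>X. f (R (g X))) ^^ k) X = f ((R ^^ k) (g X))"
proof (induction k)
  case (Suc k)
  then show ?case by (simp add: mat_isoD[OF assms(1)] R_cut)
qed (simp add: mat_isoD[OF assms(1)] assms(2))

lemma (in rb_matrix) conj_rb_jordan:
  assumes l: "l = 0" and n: "n \<ge> 2" and iso: "mat_iso n f g" and a: "f a = shift_mat n 1"
    and zero: "\<And>X. cut n X = X \<Longrightarrow> (R ^^ (2 * n - 1)) X = 0"
    and top: "cut n Z = Z" "(R ^^ (2 * n - 2)) Z \<noteq> 0"
  shows "rb_jordan n (\<lambda>X. f (R (g X)))"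
proof -
  note D = mat_isoD[OF iso]
  interpret C: rb_matrix n 0 "\<lambda>X. f (R (g X))"
    using conj_rb_matrix[OF iso] by (simp add: l)
  have f0: "f 0 = 0" using D(2)[of 0 0] by simp
  show ?thesis
  proof
    show "n \<ge> 2" by (rule n)
    have "g (idm n) = idm n" by (rule mat_iso_idm[OF mat_iso_sym[OF iso]])
    then show "C.a = shift_mat n 1" using a by (simp add: C.a_def a_def)
    show "((\<lambda>X. f (R (g X))) ^^ (2 * n - 1)) X = 0" if "cut n X = X" for X
      using zero[of "g X"] that f0 by (simp only: conj_power[OF iso] D)
    have "f ((R ^^ (2 * n - 2)) Z) \<noteq> 0"
    proof
      assume "f ((R ^^ (2 * n - 2)) Z) = 0"
      then have "g (f ((R ^^ (2 * n - 2)) Z)) = 0" using D(4)[of 0 0] by simp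
      moreover have "cut n ((R ^^ m) Z) = (R ^^ m) Z" for m
        by (cases m) (simp_all add: top(1) cut_R)
      ultimately show False using top(2) by (simp add: D)
    qed
    then show "\<exists>X. cut n X = X \<and> ((\<lambda>X. f (R (g X))) ^^ (2 * n - 2)) X \<noteq> 0"
      using top(1) by (intro exI[of _ "f Z"]) (simp only: conj_power[OF iso] D simp_thms)
  qed
qed

lemma (in rb_jordan) classification_jordan:
  obtains f h where "mat_iso n f h" "\<And>X. f (R (h X)) = kernel_operator n b0_kernel X"
proof (cases "ent (g (n - 1)) (n - 1) (n - 1) = 0")
  case True
  interpret rb_left n R
    by unfold_locales (use True in \<open>simp only: g_def\<close>)
  show thesis using classification_left that by blast
next
  case False
  then have z: "ent (g (n - 1)) 0 0 = 0" using corner_entries by simp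
  let ?f = "flip_imat n :: 'a imat \<Rightarrow> 'a imat"
  obtain Z where Z: "cut n Z = Z" "(R ^^ (2 * n - 2)) Z \<noteq> 0" using R_top by blast
  have "?f a = shift_mat n 1"
    using n_ge_2 by (auto simp: a_jordan imat_eq_iff flip_imat_apply shift_mat_apply)
  then interpret C: rb_jordan n "\<lambda>X. ?f (R (?f X))"
    using conj_rb_jordan[OF refl n_ge_2 mat_iso_flip _ R_nilpotent Z] by blast
  have c: "?f (eu (n - 1) 0) = eu (n - 1) 0"
    using n_ge_2 by (auto simp: imat_eq_iff flip_imat_apply eu_apply)
  have "cut n (eu (n - 1) 0) = (eu (n - 1) 0 :: 'a imat)" using n_ge_2 by (intro cut_eu) auto
  then have "((\<lambda>X. ?f (R (?f X))) ^^ (n - 1)) (eu (n - 1) 0) = ?f (g (n - 1))"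
    by (simp only: conj_power[OF mat_iso_flip] c g_def)
  then interpret C: rb_left n "\<lambda>X. ?f (R (?f X))"
    by unfold_locales (use n_ge_2 z in \<open>simp add: flip_imat_apply\<close>)
  obtain f h where fh: "mat_iso n f h" "\<And>X. f (?f (R (?f (h X)))) = kernel_operator n b0_kernel X"
    using C.classification_left by blast
  show thesis by (rule that[OF mat_iso_trans[OF mat_iso_flip fh(1)] fh(2)])
qed

section \<open>Powers of a and its Jordan form\<close>

context rb_matrix
begin

abbreviation Lpow :: "nat \<Rightarrow> 'a imat \<Rightarrow> 'a imat" where
  "Lpow k \<equiv> (\<lambda>X. a \<odot> X) ^^ k"

lemma Lpow_mm: "Lpow k (X \<odot> Y) = Lpow k X \<odot> Y"
  by (induction k) (simp_all add: mm_assoc)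

lemma Lpow_lin: "Lpow k (X - Y) = Lpow k X - Lpow k Y" "Lpow k (sc c X) = sc c (Lpow k X)"
  "Lpow k 0 = 0" "Lpow k (sum h A) = (\<Sum>i\<in>A. Lpow k (h i))"
  by (induction k) (simp_all add: mm_simps mm_sum_right)

lemma Lpow_cut: "cut n X = X \<Longrightarrow> cut n (Lpow k X) = Lpow k X"
  by (induction k) (simp_all add: cut_mm)

lemma Lpow_Suc_right: "Lpow (Suc k) X = Lpow k (a \<odot> X)"
  by (simp add: funpow_swap1)

lemma Rpow_commutator:
  assumes "l = 0"
  shows "a \<odot> (R ^^ k) X = (R ^^ k) (a \<odot> X) + sc (of_nat k) ((R ^^ Suc k) X)"
proof -
  have "sc l Y = 0" for Y by (simp add: assms)
  with left.L_RS[of k 0 X] show ?thesis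
    unfolding left.RS_Suc_right by (simp add: left.RS_def)
qed

lemma Lpow_idm:
  assumes "l = 0"
  shows "Lpow k (idm n) = sc (fact k) ((R ^^ k) (idm n))"
proof (induction k)
  case (Suc k)
  have "a \<odot> idm n = R (idm n)" by simp (rule a_def)
  then have "a \<odot> (R ^^ k) (idm n) = sc (of_nat (Suc k)) ((R ^^ Suc k) (idm n))"
    unfolding Rpow_commutator[OF assms] \<open>a \<odot> idm n = R (idm n)\<close> by (simp add: funpow_swap1 sc.scale_left_distrib add.commute)
  then show ?case using Suc by (simp add: mm_simps mult.commute)
qed simp

text \<open>If \<open>L\<^sup>n\<^sup>-\<^sup>1 = 0\<close>, then \<open>(t + 1) R\<^sup>t\<^sup>+\<^sup>2 = L R\<^sup>t\<^sup>+\<^sup>1 - R\<^sup>t\<^sup>+\<^sup>1 L\<close> makes \<open>R\<^sup>2\<^sup>n\<^sup>-\<^sup>2\<close> a combination of products \<open>L\<^sup>i R L\<^sup>j\<close>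
  with \<open>i + j = 2n - 3\<close>, all of which vanish.\<close>

lemma Lpow_idm_nonzero:
  assumes l: "l = 0" and n: "n \<ge> 2" and top: "cut n Z = Z" "(R ^^ (2 * n - 2)) Z \<noteq> 0"
  shows "Lpow (n - 1) (idm n) \<noteq> 0"
proof
  assume zero: "Lpow (n - 1) (idm n) = 0"
  have L0: "Lpow k X = 0" if "cut n X = X" "n - 1 \<le> k" for X k
  proof -
    have "Lpow (n - 1) X = Lpow (n - 1) (idm n) \<odot> X" by (simp add: Lpow_mm[symmetric] that(1))
    then have "Lpow (n - 1) X = 0" using zero by simp
    moreover have "Lpow k X = Lpow (k - (n - 1)) (Lpow (n - 1) X)"
      using that(2) by (simp only: funpow_add[symmetric, THEN fun_cong, unfolded comp_def] le_add_diff_inverse2)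
    ultimately show ?thesis by (simp add: Lpow_lin)
  qed
  have "Lpow i ((R ^^ Suc t) (Lpow j Z)) = 0" if "i + j + t = 2 * n - 3" for i j t
    using that
  proof (induction t arbitrary: i j)
    case 0
    then consider "n - 1 \<le> i" | "n - 1 \<le> j" using n by linarith
    then show ?case
    proof cases
      case 1
      then show ?thesis by (intro L0) (simp_all add: cut_R)
    next
      case 2
      then show ?thesis using L0[OF top(1)] by (simp add: Lpow_lin)
    qed
  next
    case (Suc t)
    have "sc (of_nat (Suc t)) ((R ^^ Suc (Suc t)) (Lpow j Z))
        = a \<odot> (R ^^ Suc t) (Lpow j Z) - (R ^^ Suc t) (Lpow (Suc j) Z)"
      unfolding Rpow_commutator[OF l] by simp
    then have "sc (of_nat (Suc t)) (Lpow i ((R ^^ Suc (Suc t)) (Lpow j Z)))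
        = Lpow (Suc i) ((R ^^ Suc t) (Lpow j Z)) - Lpow i ((R ^^ Suc t) (Lpow (Suc j) Z))"
      unfolding Lpow_lin(2)[symmetric] Lpow_Suc_right by (simp only: Lpow_lin)
    also have "\<dots> = 0" using Suc.IH[of "Suc i" j] Suc.IH[of i "Suc j"] Suc.prems by simp
    finally show ?case using of_nat_neq_0[of t, where 'a = 'a] by (simp only: sc.scale_eq_0_iff) blast
  qed
  from this[of 0 0 "2 * n - 3"] have "(R ^^ Suc (2 * n - 3)) Z = 0" by simp
  moreover have "Suc (2 * n - 3) = 2 * n - 2" using n by linarith
  ultimately show False using top(2) by metis
qed

lemma jordan_form:
  assumes l: "l = 0" and n: "n \<ge> 2"
    and zero: "\<And>X. cut n X = X \<Longrightarrow> (R ^^ (2 * n - 1)) X = 0"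
    and top: "cut n Z = Z" "(R ^^ (2 * n - 2)) Z \<noteq> 0"
  obtains f g where "mat_iso n f g" "f a = shift_mat n 1"
proof -
  define M where "M k = Lpow k (idm n)" for k
  have MS: "a \<odot> M k = M (Suc k)" for k by (simp add: M_def)
  have M_add: "Lpow i (M k) = M (i + k)" for i k by (simp add: M_def funpow_add)
  have M_zero: "M k = 0" if "2 * n - 1 \<le> k" for k
  proof -
    have "M (2 * n - 1) = 0" by (simp only: M_def Lpow_idm[OF l] zero cut_idm sc.scale_zero_right)
    then show ?thesis using M_add[of "k - (2 * n - 1)" "2 * n - 1"] that by (simp add: Lpow_lin)
  qed
  define s where "s = (GREATEST k. M k \<noteq> 0)"
  have bound: "k \<le> 2 * n - 1" if "M k \<noteq> 0" for k using M_zero[of k] that by linarith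
  have nz: "M (n - 1) \<noteq> 0" unfolding M_def by (rule Lpow_idm_nonzero[OF l n top])
  have s: "M s \<noteq> 0" unfolding s_def using GreatestI_nat[of "\<lambda>k. M k \<noteq> 0", OF nz] bound by blast
  have s_max: "k \<le> s" if "M k \<noteq> 0" for k
    unfolding s_def using Greatest_le_nat[of "\<lambda>k. M k \<noteq> 0", OF that] bound by blast
  have sn: "n - 1 \<le> s" using s_max nz by blast
  obtain r0 c where rc: "ent (M s) r0 c \<noteq> 0" using s by (auto simp: imat_eq_iff)
  have cM: "cut n (M k) = M k" for k by (simp add: M_def Lpow_cut)
  \<comment> \<open>\<open>s \<ge> n - 1\<close> is the last exponent with \<open>a^s\<close>
    nonzero. A nonzero column \<open>c\<close> of \<open>a^s\<close> ends a chain of at least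
    \<open>n\<close> vectors, the columns \<open>c\<close> of the powers \<open>a^(s-j)\<close>; its
    last \<open>n\<close> members form the Jordan basis.\<close>
  define P where "P = IMat (\<lambda>r j. if j < n then ent (M (s - j)) r c else 0)"
  have P: "ent P r j = (if j < n then ent (M (s - j)) r c else 0)" for r j by (simp add: P_def)
  have cP: "cut n P = P"
  proof (rule imat_eqI)
    show "ent (cut n P) r j = ent P r j" for r j
      using cM[of "s - j"] by (simp add: cut_apply P) (metis cut_apply)
  qed
  have aP: "a \<odot> P = P \<odot> shift_mat n 1"
  proof (rule imat_eqI)
    fix r j
    have "ent (a \<odot> P) r j = (if j < n then ent (M (Suc (s - j))) r c else 0)"
      by (simp add: mm_apply P MS[symmetric])
    moreover have "M (Suc s) = 0" using s_max[of "Suc s"] by auto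
    moreover have "Suc (s - j) = s - (j - 1)" if "0 < j" "j < n" using that sn by linarith
    ultimately show "ent (a \<odot> P) r j = ent (P \<odot> shift_mat n 1) r j"
      by (cases "j = 0") (auto simp: shift_mat_right P)
  qed
  have ker: "v k = 0" if v: "\<And>i. i < n \<Longrightarrow> (\<Sum>j<n. ent P i j * v j) = 0" and k: "k < n" for v k
    using k
  proof (induction "n - k" arbitrary: k rule: less_induct)
    case less
    define W where "W = (\<Sum>j<n. sc (v j) (M (s - j)))"
    have W: "ent W i c = 0" for i
    proof (cases "i < n")
      case True
      then show ?thesis using v[of i] by (simp add: W_def P mult.commute)
    next
      case False
      have "cut n W = W" by (simp add: W_def cut_sum cut_sc cM)
      with False show ?thesis by (metis cut_apply)
    qed
    have "ent (Lpow t W) i c = 0" for t i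
      by (induction t arbitrary: i) (simp_all add: W mm_apply)
    \<comment> \<open>Applying \<open>a^k\<close> kills the terms with \<open>j < k\<close>, whose
      exponent exceeds \<open>s\<close>; the coefficients with \<open>j > k\<close> are zero by
      induction.\<close>
    moreover have "Lpow k W = sc (v k) (M s)"
    proof -
      have "Lpow k W = (\<Sum>j<n. sc (v j) (M (k + (s - j))))" by (simp add: W_def Lpow_lin M_add)
      also have "\<dots> = (\<Sum>j<n. if j = k then sc (v k) (M s) else 0)"
      proof (intro sum.cong refl)
        fix j assume j: "j \<in> {..<n}"
        show "sc (v j) (M (k + (s - j))) = (if j = k then sc (v k) (M s) else 0)"
        proof (cases j k rule: linorder_cases)
          case less
          then have "s < k + (s - j)" using j sn by auto
          then have "M (k + (s - j)) = 0" using s_max by (meson not_le)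
          with less show ?thesis by simp
        next
          case equal
          then show ?thesis using less.prems sn by simp
        next
          case greater
          then have "v j = 0" using less.hyps[of j] j by auto
          with greater show ?thesis by simp
        qed
      qed
      finally show ?thesis using less.prems by simp
    qed
    ultimately have "v k * ent (M s) r0 c = 0" by (metis sc_apply)
    then show ?case using rc by simp
  qed
  obtain Q where Q: "cut n Q = Q" "P \<odot> Q = idm n" "Q \<odot> P = idm n"
    by (rule imat_inverse[OF cP]) (rule ker, assumption+)
  have "Q \<odot> (cut n a \<odot> P) = shift_mat n 1"
    by (simp add: aP mm_assoc[symmetric] Q(3))
  then show thesis by (rule that[OF mat_iso_conj[OF Q(2,3) cP Q(1)]])
qed

theorem classification_zero_weight:
  assumes l: "l = 0" and n: "n \<ge> 1"
    and zero: "\<And>X. cut n X = X \<Longrightarrow> (R ^^ (2 * n - 1)) X = 0"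
    and top: "cut n Z = Z" "(R ^^ (2 * n - 2)) Z \<noteq> 0"
  obtains f g where "mat_iso n f g" "\<And>X. f (R (g X)) = kernel_operator n b0_kernel X"
proof (cases "n = 1")
  case True
  \<comment> \<open>For \<open>n = 1\<close> the nilpotency assumption already says
    \<open>R = 0\<close>, and \<open>B_0\<close> is zero as well.\<close>
  have "R X = 0" for X using zero[of "cut n X"] R_cut[of X] True by simp
  moreover have "kernel_operator n b0_kernel X = 0" for X :: "'a imat"
    by (auto simp: True imat_eq_iff kernel_operator_apply b0_kernel_def)
  ultimately show thesis by (intro that[OF mat_iso_id]) simp
next
  case False
  with n have n2: "n \<ge> 2" by simp
  obtain f g where fg: "mat_iso n f g" "f a = shift_mat n 1"
    using jordan_form[OF l n2 zero top] by blast
  interpret C: rb_jordan n "\<lambda>X. f (R (g X))"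
    by (rule conj_rb_jordan[OF l n2 fg zero top])
  obtain f' h where h: "mat_iso n f' h" "\<And>X. f' (f (R (g (h X)))) = kernel_operator n b0_kernel X"
    using C.classification_jordan by blast
  show thesis by (rule that[OF mat_iso_trans[OF fg(1) h(1)] h(2)])
qed

end

section \<open>Transfer to matrices\<close>

definition imat_of :: "nat \<Rightarrow> 'a::field mat \<Rightarrow> 'a imat" where
  "imat_of n A = IMat (\<lambda>i j. if i < n \<and> j < n then A $$ (i, j) else 0)"

definition mat_of :: "nat \<Rightarrow> 'a::field imat \<Rightarrow> 'a mat" where
  "mat_of n X = mat n n (\<lambda>(i, j). ent X i j)"

lemma imat_of_apply: "ent (imat_of n A) i j = (if i < n \<and> j < n then A $$ (i, j) else 0)"
  by (simp add: imat_of_def)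

lemma mat_of_carrier [simp]: "mat_of n X \<in> carrier_mat n n"
  by (simp add: mat_of_def)

lemma cut_imat_of [simp]: "cut n (imat_of n A) = imat_of n A"
  by (auto simp: imat_eq_iff cut_apply imat_of_apply)

lemma imat_of_mat_of [simp]: "imat_of n (mat_of n X) = cut n X"
  by (auto simp: imat_eq_iff cut_apply imat_of_apply mat_of_def)

lemma mat_of_imat_of [simp]: "A \<in> carrier_mat n n \<Longrightarrow> mat_of n (imat_of n A) = A"
  by (rule eq_matI) (auto simp: mat_of_def imat_of_apply)

lemma mat_of_cut [simp]: "mat_of n (cut n X) = mat_of n X"
  by (rule eq_matI) (auto simp: mat_of_def cut_apply)

lemma mat_of_0: "mat_of n 0 = 0\<^sub>m n n"
  and mat_of_idm: "mat_of n (idm n) = 1\<^sub>m n"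
  and mat_of_add: "mat_of n (X + Y) = mat_of n X + mat_of n Y"
  and mat_of_diff: "mat_of n (X - Y) = mat_of n X - mat_of n Y"
  and mat_of_minus: "mat_of n (- X) = - mat_of n X"
  and mat_of_sc: "mat_of n (sc c X) = c \<cdot>\<^sub>m mat_of n X"
  by (rule eq_matI; simp add: mat_of_def idm_apply)+

lemma mat_of_mm: "mat_of n (mm n X Y) = mat_of n X * mat_of n Y"
  by (rule eq_matI) (auto simp: mat_of_def mm_apply scalar_prod_def lessThan_atLeast0)

lemma imat_of_eqI:
  assumes "A \<in> carrier_mat n n" "B \<in> carrier_mat n n" "imat_of n A = imat_of n B"
  shows "A = B"
  using assms by (metis mat_of_imat_of)

lemma imat_of_hom:
  assumes "A \<in> carrier_mat n n"
  shows "B \<in> carrier_mat n n \<Longrightarrow> imat_of n (A + B) = imat_of n A + imat_of n B"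
    "B \<in> carrier_mat n n \<Longrightarrow> imat_of n (A * B) = mm n (imat_of n A) (imat_of n B)"
    "imat_of n (c \<cdot>\<^sub>m A) = sc c (imat_of n A)"
    "imat_of n (- A) = - imat_of n A"
  using assms
  by (auto simp: imat_eq_iff imat_of_apply mm_apply scalar_prod_def lessThan_atLeast0)

lemma imat_of_0: "imat_of n (0\<^sub>m n n) = 0"
  by (simp add: mat_of_0[symmetric])

lemma finsum_matrix_space:
  fixes f :: "'b \<Rightarrow> 'a::field mat"
  assumes "finite A" "\<And>i. i \<in> A \<Longrightarrow> f i \<in> carrier_mat n n"
  shows "(\<Oplus>\<^bsub>matrix_space n\<^esub> i\<in>A. f i) \<in> carrier_mat n n \<and>
    imat_of n (\<Oplus>\<^bsub>matrix_space n\<^esub> i\<in>A. f i) = (\<Sum>i\<in>A. imat_of n (f i))"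
  using assms
proof (induction A rule: finite_induct)
  case empty
  interpret abelian_group "matrix_space n :: ('a, 'a mat) module" by (rule abelian_group_mat)
  show ?case by (simp add: module_mat_simps imat_of_0)
next
  case (insert i A)
  interpret abelian_group "matrix_space n :: ('a, 'a mat) module" by (rule abelian_group_mat)
  have "f \<in> A \<rightarrow> carrier (matrix_space n)" "f i \<in> carrier (matrix_space n)"
    using insert by (auto simp: module_mat_simps)
  then have "(\<Oplus>\<^bsub>matrix_space n\<^esub> i\<in>insert i A. f i) = f i + (\<Oplus>\<^bsub>matrix_space n\<^esub> i\<in>A. f i)"
    using insert by (subst finsum_insert) (simp_all add: module_mat_simps)
  then show ?case using insert by (simp add: imat_of_hom)
qed

lemma linear_operator_iff:
  fixes f :: "'a::field mat \<Rightarrow> 'a mat"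
  shows "linear_operator n f \<longleftrightarrow>
  (\<forall>A\<in>carrier_mat n n. f A \<in> carrier_mat n n) \<and>
  (\<forall>A\<in>carrier_mat n n. \<forall>B\<in>carrier_mat n n. f (A + B) = f A + f B) \<and>
  (\<forall>c. \<forall>A\<in>carrier_mat n n. f (c \<cdot>\<^sub>m A) = c \<cdot>\<^sub>m f A)"
proof -
  have V: "vectorspace class_ring (matrix_space n :: ('a, 'a mat) module)" by (rule matrix_vs)
  then have M: "module class_ring (matrix_space n :: ('a, 'a mat) module)"
    by (simp add: vectorspace_def)
  have "linear_operator n f \<longleftrightarrow> f \<in> LinearCombinations.module_hom class_ring (matrix_space n) (matrix_space n)"
    unfolding linear_operator_def linear_map_def mod_hom_def mod_hom_axioms_def using V M by blast
  then show ?thesis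
    by (auto simp: LinearCombinations.module_hom_def module_mat_simps class_ring_simps Pi_iff)
qed

lemma bij_betw_mat_iso:
  assumes "mat_iso n f g"
  shows "bij_betw (\<lambda>A. mat_of n (f (imat_of n A))) (carrier_mat n n) (carrier_mat n n)"
proof (rule bij_betw_byWitness[where f' = "\<lambda>A. mat_of n (g (imat_of n A))"])
  note D = mat_isoD[OF assms]
  show "\<forall>A\<in>carrier_mat n n. mat_of n (g (imat_of n (mat_of n (f (imat_of n A))))) = A"
    "\<forall>A\<in>carrier_mat n n. mat_of n (f (imat_of n (mat_of n (g (imat_of n A))))) = A"
    by (simp_all add: D)
qed auto

lemma mat_iso_algebra:
  assumes "mat_iso n f g"
  shows "algebra_automorphism n (\<lambda>A. mat_of n (f (imat_of n A))) \<or>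
    algebra_antiautomorphism n (\<lambda>A. mat_of n (f (imat_of n A)))"
proof -
  note D = mat_isoD[OF assms]
  let ?p = "\<lambda>A. mat_of n (f (imat_of n A))"
  have lin: "linear_operator n ?p"
    unfolding linear_operator_iff by (auto simp: imat_of_hom D mat_of_add mat_of_sc)
  have bij: "bij_betw ?p (carrier_mat n n) (carrier_mat n n)" by (rule bij_betw_mat_iso[OF assms])
  have "?p (1\<^sub>m n) = 1\<^sub>m n"
    by (simp add: mat_of_idm[symmetric] mat_iso_idm(1)[OF assms])
  consider "\<forall>X Y. f (mm n X Y) = mm n (f X) (f Y)" | "\<forall>X Y. f (mm n X Y) = mm n (f Y) (f X)"
    using assms unfolding mat_iso_def by blast
  then show ?thesis
  proof cases
    case 1
    have "?p \<in> ring_iso (matrix_ring n) (matrix_ring n)"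
      unfolding ring_iso_def Ring.ring_hom_def ring_mat_simps
      using bij \<open>?p (1\<^sub>m n) = 1\<^sub>m n\<close> 1 by (auto simp: imat_of_hom D mat_of_add mat_of_mm)
    with lin show ?thesis by (simp add: algebra_automorphism_def)
  next
    case 2
    then have "\<forall>A\<in>carrier_mat n n. \<forall>B\<in>carrier_mat n n. ?p (A * B) = ?p B * ?p A"
      by (simp add: imat_of_hom mat_of_mm)
    with lin bij show ?thesis by (simp add: algebra_antiautomorphism_def)
  qed
qed

lemma conjugate_operator_mat_iso:
  assumes iso: "mat_iso n f g" and T: "\<And>X. cut n (T X) = T X"
    and B: "\<And>A. A \<in> carrier_mat n n \<Longrightarrow> B A \<in> carrier_mat n n \<and> imat_of n (B A) = f (T (g (imat_of n A)))"
    and A: "A \<in> carrier_mat n n"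
  shows "conjugate_operator n (\<lambda>A. mat_of n (f (imat_of n A))) B A = mat_of n (T (imat_of n A))"
proof -
  note D = mat_isoD[OF iso]
  let ?p = "\<lambda>A. mat_of n (f (imat_of n A))"
  have B': "B (?p A) \<in> carrier_mat n n" "imat_of n (B (?p A)) = f (T (imat_of n A))"
    using B[of "?p A"] by (simp_all add: D)
  have "?p (mat_of n (T (imat_of n A))) = mat_of n (imat_of n (B (?p A)))"
    by (simp add: B'(2) D)
  then have "?p (mat_of n (T (imat_of n A))) = B (?p A)" using B'(1) by simp
  moreover have "inj_on ?p (carrier_mat n n)"
    using bij_betw_mat_iso[OF iso] by (rule bij_betw_imp_inj_on)
  ultimately show ?thesis
    unfolding conjugate_operator_def by (intro inv_into_f_eq) simp_all
qed

section \<open>The coefficients of B_0 and B_1\<close>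

lemma sum_shift_int: "(\<Sum>i\<in>{1..int n}. h i) = (\<Sum>p<n. h (int p + 1))"
proof (rule sum.reindex_bij_betw[symmetric])
  show "bij_betw (\<lambda>p. int p + 1) {..<n} {1..int n}"
    by (rule bij_betw_byWitness[where f' = "\<lambda>i. nat (i - 1)"]) auto
qed

lemma linear_extension_kernel:
  assumes f: "\<And>i j. f i j \<in> carrier_mat n n" and A: "A \<in> carrier_mat n n"
    and b: "\<And>p q i j. p < n \<Longrightarrow> q < n \<Longrightarrow> i < n \<Longrightarrow> j < n \<Longrightarrow>
      f (int p + 1) (int q + 1) $$ (i, j) = b p q i j"
  shows "linear_extension n f A \<in> carrier_mat n n \<and>
    imat_of n (linear_extension n f A) = kernel_operator n b (imat_of n A)"
proof -
  define h where "h i j = A $$ (nat (i - 1), nat (j - 1)) \<cdot>\<^sub>m f i j" for i j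
  have h: "h i j \<in> carrier_mat n n" for i j using f by (simp add: h_def)
  define H where "H i = (\<Oplus>\<^bsub>matrix_space n\<^esub> j\<in>{1..int n}. h i j)" for i
  have H: "H i \<in> carrier_mat n n" "imat_of n (H i) = (\<Sum>j\<in>{1..int n}. imat_of n (h i j))" for i
    using finsum_matrix_space[of "{1..int n}" "h i" n] h by (simp_all add: H_def)
  have E: "linear_extension n f A \<in> carrier_mat n n"
    "imat_of n (linear_extension n f A) = (\<Sum>i\<in>{1..int n}. imat_of n (H i))"
    using finsum_matrix_space[of "{1..int n}" H n] H
    unfolding linear_extension_def h_def[symmetric] H_def[symmetric] by simp_all
  have "imat_of n (linear_extension n f A)
      = (\<Sum>p<n. \<Sum>q<n. sc (A $$ (p, q)) (imat_of n (f (int p + 1) (int q + 1))))"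
    unfolding E(2) H(2) sum_shift_int h_def using f by (simp add: imat_of_hom)
  also have "\<dots> = kernel_operator n b (imat_of n A)"
    by (rule imat_eqI) (auto simp: kernel_operator_apply imat_of_apply b intro!: sum.cong)
  finally show ?thesis using E(1) by simp
qed

lemma matrix_unit_sum:
  assumes "i < n" "j < n"
  shows "(\<Oplus>\<^bsub>matrix_space n\<^esub> r\<in>{a..int n}. matrix_unit n (u r) (v r)) $$ (i, j)
    = (\<Sum>r\<in>{a..int n}. if int i + 1 = u r \<and> int j + 1 = v r then 1 else (0 :: 'a::field))"
proof -
  let ?s = "\<Oplus>\<^bsub>matrix_space n\<^esub> r\<in>{a..int n}. (matrix_unit n (u r) (v r) :: 'a mat)"
  have "?s $$ (i, j) = ent (imat_of n ?s) i j" using assms by (simp add: imat_of_apply)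
  also have "imat_of n ?s = (\<Sum>r\<in>{a..int n}. imat_of n (matrix_unit n (u r) (v r)))"
    by (subst finsum_matrix_space[THEN conjunct2]) (simp_all add: matrix_unit_def)
  also have "ent \<dots> i j
      = (\<Sum>r\<in>{a..int n}. if int i + 1 = u r \<and> int j + 1 = v r then 1 else (0 :: 'a))"
    using assms by (simp add: imat_of_apply matrix_unit_def)
  finally show ?thesis .
qed

lemma matrix_unit_sum_carrier:
  "(\<Oplus>\<^bsub>matrix_space n\<^esub> r\<in>{a..int n}. (matrix_unit n (u r) (v r) :: 'a::field mat)) \<in> carrier_mat n n"
  by (rule finsum_matrix_space[THEN conjunct1]) (simp_all add: matrix_unit_def)

text \<open>A given position is hit by at most one summand: its row fixes \<open>r = r0\<close>, and
  \<open>C\<close> says that it lies on the right diagonal.\<close>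

lemma sum_single:
  fixes a :: int
  assumes "\<And>r. Q r \<longleftrightarrow> r = r0 \<and> C"
  shows "(\<Sum>r\<in>{a..int n}. if Q r then 1 else (0 :: 'a::field)) = (if a \<le> r0 \<and> r0 \<le> int n \<and> C then 1 else 0)"
proof -
  have "(\<Sum>r\<in>{a..int n}. if Q r then 1 else (0 :: 'a)) = (\<Sum>r\<in>{a..int n}. if r = r0 then if C then 1 else 0 else 0)"
    by (intro sum.cong refl) (simp add: assms)
  then show ?thesis by simp
qed

lemma B0_kernel:
  assumes "A \<in> carrier_mat n n"
  shows "B0 n A \<in> carrier_mat n n \<and> imat_of n (B0 n A) = kernel_operator n b0_kernel (imat_of n A)"
  unfolding B0_def
proof (rule linear_extension_kernel[OF _ assms])
  show "(B0_on_unit n i j :: 'a mat) \<in> carrier_mat n n" for i j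
    by (simp add: B0_on_unit_def matrix_unit_sum_carrier)
  fix p q i j assume *: "p < n" "q < n" "i < n" "j < n"
  let ?down = "(\<Sum>r\<in>{0..int n}. if int i + 1 = int p + 1 + r \<and> int j + 1 = int q + 1 + r + 1 then 1 else (0 :: 'a))"
  let ?up = "(\<Sum>r\<in>{1..int n}. if int i + 1 = int p + 1 - r \<and> int j + 1 = int q + 1 - r + 1 then 1 else (0 :: 'a))"
  have down: "?down
      = (if 0 \<le> int i - int p \<and> int i - int p \<le> int n \<and> int j + int p = int q + 1 + int i then 1 else 0)"
    by (rule sum_single) auto
  have up: "?up
      = (if 1 \<le> int p - int i \<and> int p - int i \<le> int n \<and> int j + int p = int q + 1 + int i then 1 else 0)"
    by (rule sum_single) auto
  have minus: "(- M) $$ (i, j) = - (M $$ (i, j))" if "M \<in> carrier_mat n n" for M :: "'a mat"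
    using that * by simp
  have "B0_on_unit n (int p + 1) (int q + 1) $$ (i, j) = (if p \<le> q then ?down else - ?up)"
    using * by (simp add: B0_on_unit_def minus[OF matrix_unit_sum_carrier] matrix_unit_sum)
  also have "\<dots> = b0_kernel p q i j"
    unfolding down up using * by (auto simp: b0_kernel_def)
  finally show "B0_on_unit n (int p + 1) (int q + 1) $$ (i, j) = (b0_kernel p q i j :: 'a)" .
qed

lemma B1_kernel:
  assumes "A \<in> carrier_mat n n"
  shows "B1 n A \<in> carrier_mat n n \<and> imat_of n (B1 n A) = kernel_operator n b1_kernel (imat_of n A)"
  unfolding B1_def
proof (rule linear_extension_kernel[OF _ assms])
  show "(B1_on_unit n i j :: 'a mat) \<in> carrier_mat n n" for i j
    by (simp add: B1_on_unit_def matrix_unit_sum_carrier)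
  fix p q i j assume *: "p < n" "q < n" "i < n" "j < n"
  let ?down = "(\<Sum>r\<in>{1..int n}. if int i + 1 = int p + 1 + r \<and> int j + 1 = int q + 1 + r then 1 else (0 :: 'a))"
  let ?up = "(\<Sum>r\<in>{0..int n}. if int i + 1 = int p + 1 - r \<and> int j + 1 = int q + 1 - r then 1 else (0 :: 'a))"
  have down: "?down
      = (if 1 \<le> int i - int p \<and> int i - int p \<le> int n \<and> int j + int p = int q + int i then 1 else 0)"
    by (rule sum_single) auto
  have up: "?up
      = (if 0 \<le> int p - int i \<and> int p - int i \<le> int n \<and> int j + int p = int q + int i then 1 else 0)"
    by (rule sum_single) auto
  have minus: "(- M) $$ (i, j) = - (M $$ (i, j))" if "M \<in> carrier_mat n n" for M :: "'a mat"
    using that * by simp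
  have "B1_on_unit n (int p + 1) (int q + 1) $$ (i, j) = (if q \<le> p then ?down else - ?up)"
    using * by (simp add: B1_on_unit_def minus[OF matrix_unit_sum_carrier] matrix_unit_sum)
  also have "\<dots> = b1_kernel p q i j"
    unfolding down up using * by (auto simp: b1_kernel_def)
  finally show "B1_on_unit n (int p + 1) (int q + 1) $$ (i, j) = (b1_kernel p q i j :: 'a)" .
qed

section \<open>Transfer of the operator and of its minimal polynomial\<close>

lemma rota_baxter_imat:
  fixes R :: "'a::field_char_0 mat \<Rightarrow> 'a mat"
  assumes "rota_baxter_operator n l R"
  shows "rb_matrix n l (\<lambda>X. imat_of n (R (mat_of n X)))"
proof
  have lin: "\<And>A. A \<in> carrier_mat n n \<Longrightarrow> R A \<in> carrier_mat n n"
    "\<And>A B. A \<in> carrier_mat n n \<Longrightarrow> B \<in> carrier_mat n n \<Longrightarrow> R (A + B) = R A + R B"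
    "\<And>c A. A \<in> carrier_mat n n \<Longrightarrow> R (c \<cdot>\<^sub>m A) = c \<cdot>\<^sub>m R A"
    and RB: "\<And>A B. A \<in> carrier_mat n n \<Longrightarrow> B \<in> carrier_mat n n \<Longrightarrow>
      R A * R B = R (R A * B + A * R B + l \<cdot>\<^sub>m (A * B))"
    using assms unfolding rota_baxter_operator_def linear_operator_iff by blast+
  let ?R = "\<lambda>X. imat_of n (R (mat_of n X))"
  fix X Y :: "'a imat" and c :: 'a
  show "?R (X + Y) = ?R X + ?R Y" by (simp add: mat_of_add lin imat_of_hom)
  show "?R (sc c X) = sc c (?R X)" by (simp add: mat_of_sc lin imat_of_hom)
  show "?R (cut n X) = ?R X" "cut n (?R X) = ?R X" by simp_all
  show "mm n (?R X) (?R Y) = ?R (mm n (?R X) Y + mm n X (?R Y) + sc l (mm n X Y))"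
    by (simp add: imat_of_hom(2)[symmetric] lin(1) RB mat_of_add mat_of_sc mat_of_mm)
qed

lemma eval_at_operator_imat:
  fixes R :: "'a::field_char_0 mat \<Rightarrow> 'a mat"
  assumes "rota_baxter_operator n l R" "A \<in> carrier_mat n n"
  shows "eval_at_operator n q R A \<in> carrier_mat n n \<and> imat_of n (eval_at_operator n q R A) =
    commutator_pair.ev sc (\<lambda>X. imat_of n (R (mat_of n X))) q (imat_of n A)"
proof -
  let ?R = "\<lambda>X. imat_of n (R (mat_of n X))"
  interpret I: rb_matrix n l ?R using assms(1) by (rule rota_baxter_imat)
  have R: "\<And>A. A \<in> carrier_mat n n \<Longrightarrow> R A \<in> carrier_mat n n"
    using assms(1) unfolding rota_baxter_operator_def linear_operator_iff by blast
  have pow: "(R ^^ k) A \<in> carrier_mat n n \<and> imat_of n ((R ^^ k) A) = (?R ^^ k) (imat_of n A)" for k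
  proof (induction k)
    case (Suc k)
    then have "mat_of n ((?R ^^ k) (imat_of n A)) = (R ^^ k) A" by (metis mat_of_imat_of)
    with Suc R show ?case by simp
  qed (simp add: assms(2))
  then show ?thesis
    unfolding eval_at_operator_def I.left.ev_def
    using finsum_matrix_space[of "{..degree q}" "\<lambda>k. coeff q k \<cdot>\<^sub>m (R ^^ k) A" n]
    by (simp add: imat_of_hom)
qed

theorem theorem1p1:
  fixes n :: nat and l :: "'a::field_char_0" and R :: "'a mat \<Rightarrow> 'a mat" and p :: "'a poly"
  assumes "n \<ge> 1"
    and "rota_baxter_operator n l R"
    and "is_minimal_polynomial n R p"
    and "degree p = 2 * n - 1"
  shows "(l = 0 \<longrightarrow>
      (\<exists>c \<psi>. c \<noteq> 0 \<and> (algebra_automorphism n \<psi> \<or> algebra_antiautomorphism n \<psi>) \<and>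
        (\<forall>X\<in>carrier_mat n n. R X = c \<cdot>\<^sub>m conjugate_operator n \<psi> (B0 n) X))) \<and>
    (l \<noteq> 0 \<longrightarrow>
      (\<exists>\<psi>. (algebra_automorphism n \<psi> \<or> algebra_antiautomorphism n \<psi>) \<and>
        ((\<forall>X\<in>carrier_mat n n. R X = conjugate_operator n \<psi> (\<lambda>Y. l \<cdot>\<^sub>m B1 n Y) X) \<or>
         (\<forall>X\<in>carrier_mat n n. - R X - l \<cdot>\<^sub>m X = conjugate_operator n \<psi> (\<lambda>Y. l \<cdot>\<^sub>m B1 n Y) X))))"
proof -
  define R' where "R' X = imat_of n (R (mat_of n X))" for X
  interpret rb_matrix n l R'
    unfolding R'_def[abs_def] using assms(2) by (rule rota_baxter_imat)
  have ev: "eval_at_operator n q R A \<in> carrier_mat n n"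
    "imat_of n (eval_at_operator n q R A) = left.ev q (imat_of n A)" if "A \<in> carrier_mat n n" for q A
    using eval_at_operator_imat[OF assms(2) that, of q] unfolding R'_def[abs_def] by blast+
  have annihilates_iff: "annihilates n q R \<longleftrightarrow> (\<forall>X. cut n X = X \<longrightarrow> left.ev q X = 0)" for q
  proof
    assume q: "annihilates n q R"
    show "\<forall>X. cut n X = X \<longrightarrow> left.ev q X = 0"
    proof (intro allI impI)
      fix X :: "'a imat" assume "cut n X = X"
      then show "left.ev q X = 0"
        using ev(2)[of "mat_of n X" q] q unfolding annihilates_def by (simp add: imat_of_0)
    qed
  next
    assume "\<forall>X. cut n X = X \<longrightarrow> left.ev q X = 0"
    then show "annihilates n q R"
      unfolding annihilates_def using ev[of _ q] by (auto intro!: imat_of_eqI simp: imat_of_0)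
  qed
  have min: "annihilates n p R" "\<And>q. q \<noteq> 0 \<Longrightarrow> annihilates n q R \<Longrightarrow> 2 * n - 1 \<le> degree q"
    using assms(3,4) unfolding is_minimal_polynomial_def by auto
  have pos: "2 * n - 1 \<ge> 1" using assms(1) by simp
  obtain k m where km: "k + m = 2 * n - 1" "l = 0 \<longrightarrow> m = 0"
    and zero: "\<And>X. cut n X = X \<Longrightarrow> RS k m X = 0"
    and top: "k > 0 \<Longrightarrow> \<exists>X. cut n X = X \<and> RS (k - 1) m X \<noteq> 0"
      "m > 0 \<Longrightarrow> \<exists>X. cut n X = X \<and> RS k (m - 1) X \<noteq> 0"
  proof (rule left.minimal_polynomial_exponents[OF pos assms(4), of "\<lambda>X. cut n X = X"])
    show "cut n (a \<odot> X) = a \<odot> X" if "cut n X = X" for X using that by (simp add: cut_mm)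
    show "left.ev p X = 0" if "cut n X = X" for X using min(1) that annihilates_iff by blast
    show "2 * n - 1 \<le> degree q" if "q \<noteq> 0" "\<And>X. cut n X = X \<Longrightarrow> left.ev q X = 0" for q
      using min(2)[OF that(1)] that(2) annihilates_iff by blast
  qed blast
  have R_A: "mat_of n (R' (imat_of n A)) = R A" if "A \<in> carrier_mat n n" for A
  proof -
    have "R A \<in> carrier_mat n n"
      using assms(2) that unfolding rota_baxter_operator_def linear_operator_iff by blast
    with that show ?thesis by (simp add: R'_def)
  qed
  have B1: "l \<cdot>\<^sub>m B1 n A \<in> carrier_mat n n \<and> imat_of n (l \<cdot>\<^sub>m B1 n A) = sc l (kernel_operator n b1_kernel (imat_of n A))"
    if "A \<in> carrier_mat n n" for A
    using B1_kernel[OF that] by (simp add: imat_of_hom)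
  show ?thesis
  proof (cases "l = 0")
    case True
    then have k: "m = 0" "k = 2 * n - 1" using km by simp_all
    obtain Z where Z: "cut n Z = Z" "RS (k - 1) m Z \<noteq> 0" using top(1) k pos by (metis less_le_trans less_one)
    have pow: "RS i 0 X = (R' ^^ i) X" for i X by (simp add: left.RS_def)
    have "(R' ^^ (2 * n - 1)) X = 0" if "cut n X = X" for X
      using zero[OF that] unfolding k pow .
    moreover have "(R' ^^ (2 * n - 2)) Z \<noteq> 0"
      using Z(2) unfolding k pow by (simp add: numeral_2_eq_2)
    ultimately obtain f g where fg: "mat_iso n f g" "\<And>X. f (R' (g X)) = kernel_operator n b0_kernel X"
      using classification_zero_weight[OF True assms(1) _ Z(1)] by blast
    define \<psi> where "\<psi> A = mat_of n (f (imat_of n A))" for A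
    have "conjugate_operator n \<psi> (B0 n) A = R A" if "A \<in> carrier_mat n n" for A
      unfolding \<psi>_def[abs_def] R_A[OF that, symmetric]
      by (rule conjugate_operator_mat_iso[OF fg(1) cut_R _ that]) (simp add: fg(2) B0_kernel)
    moreover have "1 \<cdot>\<^sub>m A = A" for A :: "'a mat" by (rule eq_matI) simp_all
    ultimately have "\<forall>A\<in>carrier_mat n n. R A = 1 \<cdot>\<^sub>m conjugate_operator n \<psi> (B0 n) A"
      by simp
    moreover have "algebra_automorphism n \<psi> \<or> algebra_antiautomorphism n \<psi>"
      unfolding \<psi>_def[abs_def] by (rule mat_iso_algebra[OF fg(1)])
    \<comment> \<open>The scalar can be taken to be 1: as \<open>B_0\<close> moves every diagonal by
      one, rescaling it is itself a conjugation by a diagonal matrix.\<close>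
    ultimately show ?thesis using True by (intro conjI impI exI[of _ 1] exI[of _ \<psi>]) auto
  next
    case l: False
    show ?thesis
    proof (cases "n \<le> k")
      case True
      obtain f g where fg: "mat_iso n f g" "\<And>X. f (R' (g X)) = sc l (kernel_operator n b1_kernel X)"
        using classification_nonzero_weight[OF l assms(1) True km(1) zero top] by blast
      define \<psi> where "\<psi> A = mat_of n (f (imat_of n A))" for A
      have "R A = conjugate_operator n \<psi> (\<lambda>Y. l \<cdot>\<^sub>m B1 n Y) A" if "A \<in> carrier_mat n n" for A
        unfolding \<psi>_def[abs_def] R_A[OF that, symmetric]
        by (rule conjugate_operator_mat_iso[OF fg(1) cut_R _ that, symmetric]) (simp only: fg(2) B1)
      moreover have "algebra_automorphism n \<psi> \<or> algebra_antiautomorphism n \<psi>"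
        unfolding \<psi>_def[abs_def] by (rule mat_iso_algebra[OF fg(1)])
      ultimately show ?thesis using l by blast
    next
      case False
      \<comment> \<open>The exponents add up to \<open>2n - 1\<close>, so one of them is at least
        \<open>n\<close>; here it is \<open>m\<close>, and \<open>-R - l id\<close> has the two
        exchanged.\<close>
      then have m: "n \<le> m" "m + k = 2 * n - 1" using km(1) by linarith+
      define T where "T X = - R' X - sc l (cut n X)" for X
      interpret T: rb_matrix n l T unfolding T_def[abs_def] by (rule dual_rb_matrix)
      have T_RS: "T.RS i j X = sc ((- 1) ^ (i + j)) (RS j i X)" if "cut n X = X" for i j X
        unfolding T_def[abs_def] by (rule dual_RS[OF that])
      have nz: "sc ((- 1) ^ i) X = 0 \<longleftrightarrow> X = 0" for i and X :: "'a imat" by simp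
      have "T.RS m k X = 0" if "cut n X = X" for X using zero that by (simp add: T_RS)
      moreover have "m > 0 \<Longrightarrow> \<exists>X. cut n X = X \<and> T.RS (m - 1) k X \<noteq> 0"
        "k > 0 \<Longrightarrow> \<exists>X. cut n X = X \<and> T.RS m (k - 1) X \<noteq> 0"
        using top T_RS by (metis nz)+
      ultimately obtain f g where fg: "mat_iso n f g" "\<And>X. f (T (g X)) = sc l (kernel_operator n b1_kernel X)"
        using T.classification_nonzero_weight[OF l assms(1) m] by blast
      define \<psi> where "\<psi> A = mat_of n (f (imat_of n A))" for A
      have "- R A - l \<cdot>\<^sub>m A = conjugate_operator n \<psi> (\<lambda>Y. l \<cdot>\<^sub>m B1 n Y) A" if "A \<in> carrier_mat n n" for A
      proof -
        have "- R A - l \<cdot>\<^sub>m A = mat_of n (T (imat_of n A))"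
          using that by (simp add: T_def mat_of_diff mat_of_minus mat_of_sc R_A)
        also have "\<dots> = conjugate_operator n \<psi> (\<lambda>Y. l \<cdot>\<^sub>m B1 n Y) A"
          unfolding \<psi>_def[abs_def]
          by (rule conjugate_operator_mat_iso[OF fg(1) T.cut_R _ that, symmetric]) (simp only: fg(2) B1)
        finally show ?thesis .
      qed
      moreover have "algebra_automorphism n \<psi> \<or> algebra_antiautomorphism n \<psi>"
        unfolding \<psi>_def[abs_def] by (rule mat_iso_algebra[OF fg(1)])
      ultimately show ?thesis using l by blast
    qed
  qed
qed

end
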